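(* Let $\Lambda=\dot{\bigcup}_{i}\Lambda_i$ be the typed point set of a primitive, unimodular PV inflation rule (as described in the context), and consider the natural cut and project scheme that emerges from the Minkowski embedding. Then, each $\Lambda_i$ induces a unique measure in internal space $\mathbb{R}^{d-1}$, namely $$\mu_i=\frac{\operatorname{dens}(\Lambda_i)}{\operatorname{vol}(W_i)}\,1_{W_i}\,\mu_{\mathrm{Leb}},$$ where the $W_i$ are the solutions of the window iterated function system $W_i=\bigcup_{j=1}^N\bigcup_{t\in T_{ij}}(QW_j+t^\star)$, $1\leqslant i\leqslant N$. This entails the statement that, for all $1\leqslant i\leqslant N$, the set $\Lambda_i^\star=\{x^\star:x\in\Lambda_i\}$ is uniformly distributed in $W_i$.
   Context: Setting. Let $\varrho$ be a primitive substitution on the alphabet $\{a_1,\ldots,a_N\}$ with substitution matrix $M$, where $M_{ij}$ is the number of letters $a_i$ in $\varrho(a_j)$. Let $\lambda$ be the Perron–Frobenius (PF) eigenvalue of $M$, assumed to be a Pisot–Vijayaraghavan (PV) unit of degree $d\leqslant N$: $\lambda>1$ is an algebraic integer and a unit, and all its other algebraic conjugates have modulus $<1$. The characteristic polynomial of $M$ need not be irreducible. Let $v=(v_1,\ldots,v_N)^T$ and $u=(u_1,\ldots,u_N)$ be the strictly positive right and left PF eigenvectors of $M$, normalised by $\sum_i v_i=1$ and $\sum_i u_iv_i=1$. Geometric realisation. Letter $a_i$ is realised as an interval (tile) of length $\ell_i=c\,u_i$ with a constant $c>0$ chosen such that all control points (left endpoints of tiles), relative to one of them placed at $0$, lie in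 $\mathbb{Z}[\lambda]$, but in no proper $\lambda$-invariant submodule of it. For $1\leqslant i,j\leqslant N$, $T_{ij}\subset\mathbb{Z}[\lambda]$ is the finite set of positions of the left endpoints of the tiles of type $a_i$ in the supertile $\varrho(a_j)$ (of length $\lambda\ell_j$, left endpoint at $0$), so $\operatorname{card}(T_{ij})=M_{ij}$. Typed point set. $\Lambda=\dot\bigcup_i\Lambda_i\subset\mathbb{Z}[\lambda]$ is the set of control points of a tiling of $\mathbb{R}$ all of whose finite patches are legal (occur in some iterated supertile $\varrho^n(a_j)$), with $\Lambda_i$ the control points of type $a_i$ and $0\in\Lambda$; it arises by iterating the inflation from a legal pair of tiles meeting at $0$ and is a fixed point of the inflation, $\Lambda_i=\dot\bigcup_{j}(\lambda\Lambda_j+T_{ij})$ for all $i$ (this can always be achieved by replacing $\varrho$ with a suitable power). Densities: $\operatorname{dens}(\Lambda_i)=\lim_{r\to\infty}\frac{1}{2r}\operatorname{card}(\Lambda_i\cap[-r,r])$. Minkowski embedding. Let $\kappa_1=\mathrm{id},\kappa_2,\ldots,\kappa_r$ be the real embeddings of $\mathbb{Q}(\lambda)$ and $\sigma_1,\overline{\sigma_1},\ldots,\sigma_s,\overline{\sigma_s}$ the complex ones, $d=r+2s$. For $x\in\mathbb{Z}[\lambda]$, put $x^\star=(\kappa_2(x),\ldots,\kappa_r(x),\operatorname{Re}\sigma_1(x),\operatorname{Im}\sigma_1(x),\ldots,\operatorname{Re}\sigma_s(x),\operatorname{Im}\sigma_s(x))\in\mathbb{R}^{d-1}$. The cut and project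 scheme is $(\mathbb{R},\mathbb{R}^{d-1},\mathcal{L})$ with lattice $\mathcal{L}=\{(x,x^\star):x\in\mathbb{Z}[\lambda]\}\subset\mathbb{R}^d$. Let $Q$ be the linear map on $\mathbb{R}^{d-1}$ with $(\lambda x)^\star=Qx^\star$, i.e. $Q=\operatorname{diag}(\kappa_2(\lambda),\ldots,\kappa_r(\lambda))\oplus\bigoplus_{i=1}^s\begin{pmatrix}\operatorname{Re}\sigma_i(\lambda)&-\operatorname{Im}\sigma_i(\lambda)\\ \operatorname{Im}\sigma_i(\lambda)&\operatorname{Re}\sigma_i(\lambda)\end{pmatrix}$. Windows. $(W_1,\ldots,W_N)$ is the unique $N$-tuple of non-empty compact subsets of $\mathbb{R}^{d-1}$ solving the stated iterated function system; all $\operatorname{vol}(W_i)>0$ (Lebesgue measure). $1_K$ is the characteristic function of $K$, and $\mu_{\mathrm{Leb}}$ is Lebesgue measure on $\mathbb{R}^{d-1}$. Induced measure. $\Lambda_i$ induces the measure $\mu_i$ if the point measures $\mu_i^{(n)}=\frac{1}{2n}\sum_{x\in\Lambda_i,\,|x|\leqslant n}\delta_{x^\star}$ converge weakly to $\mu_i$ as $n\to\infty$. Uniform distribution of $\Lambda_i^\star$ in $W_i$ means that the normalised counting measures on $\{x^\star:x\in\Lambda_i,|x|\leqslant n\}$ converge weakly to normalised Lebesgue measure on $W_i$ as $n\to\infty$. *)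

theory Defs
  imports "HOL-Analysis.Analysis" "HOL-Library.Sublist"
begin

section \<open>Substitutions\<close>

definition subst_word :: "('a \<Rightarrow> 'a list) \<Rightarrow> 'a list \<Rightarrow> 'a list" where
  "subst_word \<rho> w = concat (map \<rho> w)"

definition primitive_subst :: "('a \<Rightarrow> 'a list) \<Rightarrow> bool" where
  "primitive_subst \<rho> \<longleftrightarrow> (\<exists>n\<ge>1. \<forall>i j. i \<in> set ((subst_word \<rho> ^^ n) [j]))"

definition legal :: "('a \<Rightarrow> 'a list) \<Rightarrow> 'a list \<Rightarrow> bool" where
  "legal \<rho> x \<longleftrightarrow> (\<exists>n j. sublist x ((subst_word \<rho> ^^ n) [j]))"

text \<open>The alphabet is a finite type. The entry type is left open, so that the same matrix can be
  read over the reals and over the complex numbers.\<close>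

definition subst_matrix :: "('a::finite \<Rightarrow> 'a list) \<Rightarrow> 'b::semiring_1 ^ 'a ^ 'a" where
  "subst_matrix \<rho> = (\<chi> i j. of_nat (count_list (\<rho> j) i))"

definition PF_eigenvalue :: "('a::finite \<Rightarrow> 'a list) \<Rightarrow> real \<Rightarrow> bool" where
  "PF_eigenvalue \<rho> lam \<longleftrightarrow>
     (\<exists>x :: complex ^ 'a. x \<noteq> 0 \<and> subst_matrix \<rho> *v x = complex_of_real lam *s x) \<and>
     (\<forall>\<mu> (x :: complex ^ 'a). x \<noteq> 0 \<and> subst_matrix \<rho> *v x = \<mu> *s x \<longrightarrow> cmod \<mu> \<le> lam)"


section \<open>Pisot units\<close>

definition conjugates :: "real \<Rightarrow> complex set" where
  "conjugates lam = {\<mu>. \<exists>p :: rat poly. irreducible p \<and>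
     poly (map_poly of_rat p) lam = 0 \<and> poly (map_poly of_rat p) \<mu> = 0}"

definition PV_unit :: "real \<Rightarrow> bool" where
  "PV_unit lam \<longleftrightarrow> lam > 1 \<and> algebraic_int lam \<and> algebraic_int (inverse lam) \<and>
     (\<forall>\<mu> \<in> conjugates lam - {complex_of_real lam}. cmod \<mu> < 1)"

text \<open>The ring \<open>\<int>[lam]\<close> and the field \<open>\<rat>(lam)\<close>, as sets of reals.\<close>

definition int_ring :: "real \<Rightarrow> real set" where
  "int_ring lam = range (\<lambda>p :: int poly. poly (map_poly of_int p) lam)"

definition number_field :: "real \<Rightarrow> real set" where
  "number_field lam = {poly (map_poly of_rat p) lam / poly (map_poly of_rat q) lam | p q :: rat poly.
     poly (map_poly of_rat q) lam \<noteq> 0}"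

definition invariant_submodule :: "real \<Rightarrow> real set \<Rightarrow> bool" where
  "invariant_submodule lam G \<longleftrightarrow>
     0 \<in> G \<and> (\<forall>x\<in>G. \<forall>y\<in>G. x - y \<in> G) \<and> (\<forall>x\<in>G. lam * x \<in> G)"


section \<open>Minkowski embedding\<close>

text \<open>Field embeddings of \<open>\<rat>(lam)\<close> are made unique as functions by extensionality.\<close>

definition embeddings :: "real \<Rightarrow> (real \<Rightarrow> complex) set" where
  "embeddings lam = {\<phi> \<in> extensional (number_field lam). \<phi> 1 = 1 \<and>
     (\<forall>x \<in> number_field lam. \<forall>y \<in> number_field lam.
        \<phi> (x + y) = \<phi> x + \<phi> y \<and> \<phi> (x * y) = \<phi> x * \<phi> y)}"

definition real_embeddings :: "real \<Rightarrow> (real \<Rightarrow> complex) set" where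
  "real_embeddings lam = {\<phi> \<in> embeddings lam. \<phi> ` number_field lam \<subseteq> \<real>}"

definition complex_embeddings :: "real \<Rightarrow> (real \<Rightarrow> complex) set" where
  "complex_embeddings lam = embeddings lam - real_embeddings lam"

definition id_embedding :: "real \<Rightarrow> real \<Rightarrow> complex" where
  "id_embedding lam = restrict complex_of_real (number_field lam)"

definition conj_embedding :: "real \<Rightarrow> (real \<Rightarrow> complex) \<Rightarrow> real \<Rightarrow> complex" where
  "conj_embedding lam \<phi> = restrict (\<lambda>x. cnj (\<phi> x)) (number_field lam)"

text \<open>Internal space is \<open>real ^ 'm\<close>. Its coordinate axes are labelled by the real embeddings other
  than the identity (value \<open>Re_of \<phi>\<close>) and by the real and imaginary parts of one representative of
  each pair of complex conjugate embeddings. An index type carries no order, so the order of the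
  axes is that of the labelling \<open>cd\<close>, which is an arbitrary bijection. Since the number of
  embeddings is the degree \<open>d\<close> of \<open>lam\<close>, a labelling exists only if \<open>CARD('m) = d - 1\<close>.\<close>

datatype coordinate = Re_of "real \<Rightarrow> complex" | Im_of "real \<Rightarrow> complex"

definition minkowski_coordinates :: "real \<Rightarrow> ('m \<Rightarrow> coordinate) \<Rightarrow> bool" where
  "minkowski_coordinates lam cd \<longleftrightarrow> (\<exists>S.
     S \<union> conj_embedding lam ` S = complex_embeddings lam \<and>
     S \<inter> conj_embedding lam ` S = {} \<and>
     bij_betw cd UNIV
       (Re_of ` (real_embeddings lam - {id_embedding lam}) \<union> Re_of ` S \<union> Im_of ` S))"

definition star :: "('m::finite \<Rightarrow> coordinate) \<Rightarrow> real \<Rightarrow> real ^ 'm" where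
  "star cd x = (\<chi> k. case cd k of Re_of \<phi> \<Rightarrow> Re (\<phi> x) | Im_of \<phi> \<Rightarrow> Im (\<phi> x))"

text \<open>The block diagonal matrix \<open>Q\<close>: entry \<open>\<phi> lam\<close> for a real embedding, a 2 by 2 block
  representing multiplication by \<open>\<phi> lam\<close> for a complex one.\<close>

definition Q_matrix :: "real \<Rightarrow> ('m::finite \<Rightarrow> coordinate) \<Rightarrow> real ^ 'm ^ 'm" where
  "Q_matrix lam cd = (\<chi> k l. case (cd k, cd l) of
       (Re_of \<phi>, Re_of \<psi>) \<Rightarrow> (if \<phi> = \<psi> then Re (\<phi> lam) else 0)
     | (Re_of \<phi>, Im_of \<psi>) \<Rightarrow> (if \<phi> = \<psi> then - Im (\<phi> lam) else 0)
     | (Im_of \<phi>, Re_of \<psi>) \<Rightarrow> (if \<phi> = \<psi> then Im (\<phi> lam) else 0)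
     | (Im_of \<phi>, Im_of \<psi>) \<Rightarrow> (if \<phi> = \<psi> then Re (\<phi> lam) else 0))"


section \<open>Inflation tilings\<close>

definition tile_positions :: "('a \<Rightarrow> 'a list) \<Rightarrow> ('a \<Rightarrow> real) \<Rightarrow> 'a \<Rightarrow> 'a \<Rightarrow> real set" where
  "tile_positions \<rho> len i j =
     {(\<Sum>m<k. len (\<rho> j ! m)) | k. k < length (\<rho> j) \<and> \<rho> j ! k = i}"

text \<open>A tiling is given by a bi-infinite word \<open>w\<close>; the tile \<open>w 0\<close> has its left endpoint at 0.
  At most one of the two sums is non-empty.\<close>

definition left_endpoint :: "('a \<Rightarrow> real) \<Rightarrow> (int \<Rightarrow> 'a) \<Rightarrow> int \<Rightarrow> real" where
  "left_endpoint len w k = (\<Sum>m\<in>{0..<k}. len (w m)) - (\<Sum>m\<in>{k..<0}. len (w m))"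

definition control_points :: "('a \<Rightarrow> real) \<Rightarrow> (int \<Rightarrow> 'a) \<Rightarrow> 'a \<Rightarrow> real set" where
  "control_points len w i = {left_endpoint len w k | k. w k = i}"

definition inflate_from :: "real \<Rightarrow> ('a \<Rightarrow> 'a \<Rightarrow> real set) \<Rightarrow> ('a \<Rightarrow> real set) \<Rightarrow> 'a \<Rightarrow> 'a \<Rightarrow> real set" where
  "inflate_from lam T X i j = {lam * x + t | x t. x \<in> X j \<and> t \<in> T i j}"

definition inflate :: "real \<Rightarrow> ('a \<Rightarrow> 'a \<Rightarrow> real set) \<Rightarrow> ('a \<Rightarrow> real set) \<Rightarrow> 'a \<Rightarrow> real set" where
  "inflate lam T X i = (\<Union>j. inflate_from lam T X i j)"

text \<open>The control points of a tile of type \<open>a\<close> followed by one of type \<open>b\<close>, meeting at 0.\<close>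

definition seed_pair :: "('a \<Rightarrow> real) \<Rightarrow> 'a \<Rightarrow> 'a \<Rightarrow> 'a \<Rightarrow> real set" where
  "seed_pair len a b i = (if a = i then {- len a} else {}) \<union> (if b = i then {0} else {})"

definition dens :: "real set \<Rightarrow> real" where
  "dens X = Lim at_top (\<lambda>r :: real. real (card (X \<inter> {-r..r})) / (2 * r))"


section \<open>Windows and measures on internal space\<close>

definition window_system ::
  "real \<Rightarrow> ('m::finite \<Rightarrow> coordinate) \<Rightarrow> ('a \<Rightarrow> 'a \<Rightarrow> real set) \<Rightarrow> ('a \<Rightarrow> (real ^ 'm) set) \<Rightarrow> bool" where
  "window_system lam cd T W \<longleftrightarrow>
     (\<forall>i. compact (W i) \<and> W i \<noteq> {} \<and>
          W i = (\<Union>j. \<Union>t\<in>T i j. (\<lambda>y. Q_matrix lam cd *v y + star cd t) ` W j))"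

definition weakly_converges :: "(nat \<Rightarrow> 'b::euclidean_space measure) \<Rightarrow> 'b measure \<Rightarrow> bool" where
  "weakly_converges M \<mu> \<longleftrightarrow> sets \<mu> = sets borel \<and> finite_measure \<mu> \<and>
     (\<forall>f :: 'b \<Rightarrow> real. continuous_on UNIV f \<and> bounded (range f) \<longrightarrow>
        (\<lambda>n. integral\<^sup>L (M n) f) \<longlonglongrightarrow> integral\<^sup>L \<mu> f)"

text \<open>The push-forward of counting measure on the finite set of points \<open>x \<in> X\<close> with
  \<open>\<bar>x\<bar> \<le> n\<close> is the sum of the Dirac measures at the points \<open>star cd x\<close>.\<close>

definition point_measures :: "('m::finite \<Rightarrow> coordinate) \<Rightarrow> real set \<Rightarrow> nat \<Rightarrow> (real ^ 'm) measure" where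
  "point_measures cd X n = scale_measure (ennreal (1 / (2 * real n)))
     (distr (count_space {x \<in> X. \<bar>x\<bar> \<le> real n}) borel (star cd))"

definition induces_measure ::
  "('m::finite \<Rightarrow> coordinate) \<Rightarrow> real set \<Rightarrow> (real ^ 'm) measure \<Rightarrow> bool" where
  "induces_measure cd X \<mu> \<longleftrightarrow> weakly_converges (point_measures cd X) \<mu>"

text \<open>\<open>distr\<close> only changes the \<open>\<sigma>\<close>-algebra here, from the power set of a finite set to the
  Borel sets of internal space.\<close>

definition star_uniformly_distributed ::
  "('m::finite \<Rightarrow> coordinate) \<Rightarrow> real set \<Rightarrow> (real ^ 'm) set \<Rightarrow> bool" where
  "star_uniformly_distributed cd X K \<longleftrightarrow>
     weakly_converges
       (\<lambda>n. distr (uniform_count_measure (star cd ` {x \<in> X. \<bar>x\<bar> \<le> real n})) borel (\<lambda>y. y))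
       (uniform_measure lborel K)"

end

theory Submission
  imports Defs
    "HOL-Computational_Algebra.Field_as_Ring"
    "HOL-Computational_Algebra.Polynomial_Factorial"
    "HOL-Computational_Algebra.Fundamental_Theorem_Algebra"
begin

text \<open>For a continuous function \<open>g\<close> on internal space let \<open>F\<^sub>i(g, r)\<close> be the sum of the \<open>g(x\<^sup>*)\<close> over
  the \<open>x \<in> \<Lambda>\<^sub>i\<close> with \<open>\<bar>x\<bar> \<le> r\<close>, divided by \<open>2 r\<close>, and let \<open>V\<^sub>i(g)\<close> be the integral of \<open>g\<close> over
  \<open>W\<^sub>i\<close>. The inflation fixed point equation expresses \<open>F\<^sub>i(g, \<lambda> r)\<close>, up to \<open>O(1/r)\<close>, as \<open>1/\<lambda>\<close> times the sum of
  the \<open>F\<^sub>j(g \<circ> \<phi>\<^sub>t, r)\<close> with \<open>\<phi>\<^sub>t(y) = Q y + t\<^sup>*\<close>, over all \<open>j\<close> and \<open>t \<in> T\<^sub>i\<^sub>j\<close>. The integrals \<open>V\<^sub>i\<close> obey the same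
  relation exactly: as \<open>\<lambda>\<close> is a unit, \<open>Q\<close> scales volume by \<open>1/\<lambda>\<close>, and pairing the volumes with the
  left eigenvector shows that the pieces of each window overlap in null sets only.
  Densities and volumes are both right eigenvectors, hence proportional. So
  \<open>limsup \<bar>F\<^sub>i(g, r) - \<kappa> V\<^sub>i(g)\<bar>\<close> is at most a constant times the oscillation of \<open>g\<close> on a ball that contains
  all windows and star images; iterating the relation contracts the maps \<open>\<phi>\<^sub>t\<close> and makes the
  oscillation arbitrarily small.\<close>


section \<open>Control points of a tiling\<close>

text \<open>Star images and windows are never compared point by point. For \<open>g\<close> of small
  oscillation, average and window integral are both close to a value of \<open>g\<close> times a
  mass, and \<open>\<kappa>\<close> is chosen so that the masses agree in the limit. The recursion
  transports this crude estimate without loss: the bound is a multiple of the density vector, which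
  the recursion reproduces exactly, and \<open>\<kappa>\<close> is common to all types, so it passes
  through a sum that mixes types. Convergence is not known beforehand, hence all estimates concern
  upper limits, which do not change when \<open>r\<close> is replaced by \<open>lam * r\<close>.
  Letter densities follow the same pattern: dividing counts by the right eigenvector turns a
  positive power of the substitution matrix into a stochastic one. Its contraction of differences
  also gives the proportionality of eigenvectors, and the total tile length fixes the scale. On the
  arithmetic side \<open>Q\<close> is a sum of scalars and scaled plane rotations, so its volume
  factor is the product of the moduli of the conjugates other than \<open>lam\<close>; this is
  \<open>1 / lam\<close> because a unit has norm 1 or -1.\<close>

lemma card_separated_le:
  fixes X :: "real set"
  assumes sep: "\<And>x y. x \<in> X \<Longrightarrow> y \<in> X \<Longrightarrow> x < y \<Longrightarrow> x + e \<le> y" and "e > 0" "a \<le> b"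
  shows "finite (X \<inter> {a..b})" "real (card (X \<inter> {a..b})) \<le> (b - a) / e + 1"
proof -
  \<comment> \<open>The index of the cell of length \<open>e\<close> containing \<open>x\<close>:
    points at least \<open>e\<close> apart lie in different cells. The last, possibly incomplete
    cell accounts for the summand 1 in the bound.\<close>
  define h where "h x = \<lfloor>(x - a) / e\<rfloor>" for x
  have less: "h x < h y" if "x \<in> X" "y \<in> X" "x < y" for x y
  proof -
    have "(x + e - a) / e \<le> (y - a) / e"
      using sep[OF that] \<open>e > 0\<close> by (simp add: divide_right_mono)
    moreover have "(x + e - a) / e = (x - a) / e + 1"
      using \<open>e > 0\<close> by (simp add: field_simps)
    ultimately have "(x - a) / e + 1 \<le> (y - a) / e" by simp
    then show ?thesis unfolding h_def by linarith
  qed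
  have inj: "inj_on h (X \<inter> {a..b})"
    by (rule inj_onI) (metis IntD1 less less_irrefl linorder_neqE)
  have sub: "h ` (X \<inter> {a..b}) \<subseteq> {0..\<lfloor>(b - a) / e\<rfloor>}"
    using \<open>e > 0\<close> by (auto simp: h_def divide_right_mono floor_mono)
  have "finite (h ` (X \<inter> {a..b}))" using sub finite_subset by blast
  then show "finite (X \<inter> {a..b})" using inj finite_imageD by blast
  have "card (X \<inter> {a..b}) = card (h ` (X \<inter> {a..b}))"
    using inj by (simp add: card_image)
  also have "\<dots> \<le> card {0..\<lfloor>(b - a) / e\<rfloor>}" using sub by (intro card_mono) auto
  also have "\<dots> = nat (\<lfloor>(b - a) / e\<rfloor> + 1)" by simp
  finally have "real (card (X \<inter> {a..b})) \<le> real (nat (\<lfloor>(b - a) / e\<rfloor> + 1))" by simp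
  also have "\<dots> \<le> (b - a) / e + 1"
    using \<open>e > 0\<close> \<open>a \<le> b\<close> by (simp add: of_nat_nat)
  finally show "real (card (X \<inter> {a..b})) \<le> (b - a) / e + 1" .
qed

lemma left_endpoint_step: "left_endpoint len w (k + 1) = left_endpoint len w k + len (w k)"
proof (cases "k \<ge> 0")
  case True
  then have "{0..<k + 1} = insert k {0..<k}" "{k..<0} = {}" "{k + 1..<0} = {}" by auto
  then show ?thesis by (simp add: left_endpoint_def)
next
  case False
  then have "{k..<0} = insert k {k + 1..<0}" "{0..<k} = {}" "{0..<k + 1} = {}" by auto
  then show ?thesis by (simp add: left_endpoint_def)
qed

text \<open>Serves twice: with \<open>e = 0\<close> for monotonicity, and with \<open>e\<close> the
  shortest tile length to see that the tiling leaves every bounded interval.\<close>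

lemma left_endpoint_add_ge:
  assumes "\<And>i. len i \<ge> e" 
  shows "left_endpoint len w k + real n * e \<le> left_endpoint len w (k + int n)"
proof (induction n)
  case (Suc n)
  have "k + int (Suc n) = (k + int n) + 1" by simp
  then have "left_endpoint len w (k + int (Suc n)) = left_endpoint len w (k + int n) + len (w (k + int n))"
    using left_endpoint_step by metis
  then show ?case using Suc assms[of "w (k + int n)"] by (simp add: algebra_simps)
qed simp

lemma left_endpoint_strict_mono:
  assumes "\<And>i. len i > 0" 
  shows "strict_mono (left_endpoint len w)"
proof (rule strict_monoI)
  fix k l :: int assume "k < l"
  then have l: "l = (k + 1) + int (nat (l - k - 1))" by simp
  have "left_endpoint len w (k + 1) \<le> left_endpoint len w l"
    using left_endpoint_add_ge[of 0 len w "k + 1" "nat (l - k - 1)"] assms l by (simp add: less_imp_le)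
  then show "left_endpoint len w k < left_endpoint len w l"
    using left_endpoint_step[of len w k] assms[of "w k"] by simp
qed

lemma control_points_gap:
  assumes "\<And>i. len i > 0" "x \<in> control_points len w i" "y \<in> control_points len w j" "x < y"
  shows "x + len i \<le> y"
proof -
  obtain k l where kl: "x = left_endpoint len w k" "w k = i" "y = left_endpoint len w l"
    using assms(2,3) by (auto simp: control_points_def)
  have sm: "strict_mono (left_endpoint len w)" using left_endpoint_strict_mono assms(1) by blast
  then have "k < l" using kl assms(4) by (simp add: strict_mono_less)
  then have "left_endpoint len w (k + 1) \<le> left_endpoint len w l"
    using sm by (simp add: strict_mono_less_eq)
  then show ?thesis using kl left_endpoint_step[of len w k] by simp
qed

text \<open>The tiles that start in \<open>{-r..r}\<close> are consecutive. They cover an interval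
  that starts at most \<open>B\<close> to the right of \<open>-r\<close> and ends at most
  \<open>B\<close> to the right of \<open>r\<close>. These two excesses are subtracted, so the error
  is at most \<open>B\<close> and not \<open>2 * B\<close>.\<close>

lemma tiling_length_sum:
  fixes len :: "'a::finite \<Rightarrow> real"
  assumes pos: "\<And>i. len i > 0" and le: "\<And>i. len i \<le> B" and "r \<ge> 0"
  shows "\<bar>(\<Sum>i\<in>UNIV. len i * real (card (control_points len w i \<inter> {-r..r}))) - 2 * r\<bar> \<le> B"
proof -
  define f where "f = left_endpoint len w"
  have sm: "strict_mono f" unfolding f_def using left_endpoint_strict_mono pos by blast
  then have inj: "inj f" by (rule strict_mono_imp_inj_on)
  define e where "e = Min (range len)"
  have e: "e > 0" "\<And>i. e \<le> len i" using pos unfolding e_def by (auto simp: Min_gr_iff)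
  define K where "K = {k. \<bar>f k\<bar> \<le> r}"
  obtain N :: nat where N: "r < real N * e" using e(1) reals_Archimedean3 by blast
  have f0: "f 0 = 0" by (simp add: f_def left_endpoint_def)
  have up: "f k > r" if "k \<ge> int N" for k
  proof -
    have "0 + real N * e \<le> f (int N)" using left_endpoint_add_ge[of e len w 0 N] e(2) f0 by (simp add: f_def)
    also have "\<dots> \<le> f k" using sm that by (simp add: strict_mono_less_eq)
    finally show ?thesis using N by simp
  qed
  have dn: "f k < -r" if "k \<le> - int N" for k
  proof -
    have "f k \<le> f (- int N)" using sm that by (simp add: strict_mono_less_eq)
    moreover have "f (- int N) + real N * e \<le> f 0"
      using left_endpoint_add_ge[of e len w "- int N" N] e(2) by (simp add: f_def)
    ultimately show ?thesis using N f0 by simp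
  qed
  have Ksub: "K \<subseteq> {- int N..int N}"
  proof
    fix k assume "k \<in> K"
    then show "k \<in> {- int N..int N}" using up[of k] dn[of k] unfolding K_def by force
  qed
  then have finK: "finite K" using finite_subset by blast
  have K0: "0 \<in> K" using f0 assms(3) by (simp add: K_def)
  define p q where "p = Min K" and "q = Max K"
  have pq: "p \<in> K" "q \<in> K" "\<And>k. k \<in> K \<Longrightarrow> p \<le> k \<and> k \<le> q"
    using Min_in[OF finK] Max_in[OF finK] Min_le[OF finK] Max_ge[OF finK] K0
    unfolding p_def q_def by blast+
  have K_eq: "K = {p..<q + 1}"
  proof
    show "K \<subseteq> {p..<q + 1}" using pq(3) by force
    have "f p \<le> f k \<and> f k \<le> f q" if "k \<in> {p..<q + 1}" for k
      using that sm by (simp add: strict_mono_less_eq)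
    then show "{p..<q + 1} \<subseteq> K" using pq(1,2) unfolding K_def by fastforce
  qed
  have tele: "(\<Sum>k\<in>{p..<p + int n}. len (w k)) = f (p + int n) - f p" for n
  proof (induction n)
    case (Suc n)
    have "{p..<p + int (Suc n)} = insert (p + int n) {p..<p + int n}" by auto
    moreover have "f (p + int (Suc n)) = f (p + int n) + len (w (p + int n))"
      using left_endpoint_step[of len w "p + int n"] by (simp add: f_def algebra_simps)
    ultimately show ?case using Suc by simp
  qed simp
  have "p \<le> q" using pq(1,3) by blast
  then have sumK: "(\<Sum>k\<in>K. len (w k)) = f (q + 1) - f p"
    using tele[of "nat (q + 1 - p)"] K_eq by simp
  \<comment> \<open>The neighbours of an extremal index lie outside \<open>K\<close>; as lengths are
    positive, they can only have left the interval on the respective outer side.\<close>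
  have "q + 1 \<notin> K" "p - 1 \<notin> K" using pq(3) by force+
  moreover have fq: "f (q + 1) = f q + len (w q)" unfolding f_def by (rule left_endpoint_step)
  moreover have fp: "f p = f (p - 1) + len (w (p - 1))"
    unfolding f_def using left_endpoint_step[of len w "p - 1"] by simp
  moreover have "\<bar>f p\<bar> \<le> r" "\<bar>f q\<bar> \<le> r" using pq(1,2) by (auto simp: K_def)
  ultimately have "f (q + 1) > r" "f (p - 1) < -r"
    using pos[of "w q"] pos[of "w (p - 1)"] unfolding K_def by auto
  then have bound: "\<bar>(\<Sum>k\<in>K. len (w k)) - 2 * r\<bar> \<le> B"
    using sumK fq fp \<open>\<bar>f p\<bar> \<le> r\<close> \<open>\<bar>f q\<bar> \<le> r\<close> le[of "w q"] le[of "w (p - 1)"] pos[of "w q"] by (auto simp: abs_le_iff)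
  have "(\<Sum>k\<in>K. len (w k)) = (\<Sum>i\<in>UNIV. \<Sum>k\<in>{k\<in>K. w k = i}. len (w k))"
    using sum.group[OF finK, of UNIV w "\<lambda>k. len (w k)"] by simp
  also have "\<dots> = (\<Sum>i\<in>UNIV. len i * real (card {k\<in>K. w k = i}))"
    by (intro sum.cong) auto
  also have "\<dots> = (\<Sum>i\<in>UNIV. len i * real (card (control_points len w i \<inter> {-r..r})))"
  proof (intro sum.cong refl)
    fix i
    have "control_points len w i \<inter> {-r..r} = f ` {k\<in>K. w k = i}"
      by (auto simp: control_points_def K_def f_def)
    moreover have "inj_on f {k\<in>K. w k = i}" using inj by (rule inj_on_subset) auto
    ultimately show "len i * real (card {k\<in>K. w k = i}) = len i * real (card (control_points len w i \<inter> {-r..r}))"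
      by (simp add: card_image)
  qed
  finally show ?thesis using bound by simp
qed


section \<open>Letter frequencies\<close>

definition limsup_le :: "(real \<Rightarrow> real) \<Rightarrow> real \<Rightarrow> bool" where
  "limsup_le F h \<longleftrightarrow> (\<forall>h'>h. eventually (\<lambda>r. F r \<le> h') at_top)"

lemma limsup_le_add:
  assumes "limsup_le F a" "limsup_le G b"
  shows "limsup_le (\<lambda>r. F r + G r) (a + b)"
  unfolding limsup_le_def
proof (intro allI impI)
  fix h assume "a + b < h"
  define e where "e = (h - (a + b)) / 2"
  have "e > 0" using \<open>a + b < h\<close> by (simp add: e_def)
  then have "eventually (\<lambda>r. F r \<le> a + e) at_top" "eventually (\<lambda>r. G r \<le> b + e) at_top"
    using assms by (auto simp: limsup_le_def)
  then show "eventually (\<lambda>r. F r + G r \<le> h) at_top"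
    by eventually_elim (simp add: e_def field_simps)
qed

lemma limsup_le_0: "limsup_le (\<lambda>r. 0) 0"
  by (simp add: limsup_le_def)

lemma limsup_le_sum:
  assumes "\<And>k. k \<in> A \<Longrightarrow> limsup_le (F k) (a k)"
  shows "limsup_le (\<lambda>r. \<Sum>k\<in>A. F k r) (\<Sum>k\<in>A. a k)"
  using assms
  by (induction A rule: infinite_finite_induct) (auto simp: limsup_le_0 intro: limsup_le_add)

lemma limsup_le_cmult:
  assumes "limsup_le F a" "c > 0"
  shows "limsup_le (\<lambda>r. c * F r) (c * a)"
  unfolding limsup_le_def
proof (intro allI impI)
  fix h assume "c * a < h"
  then have "a < h / c" using assms(2) by (simp add: field_simps)
  then have "eventually (\<lambda>r. F r \<le> h / c) at_top" using assms(1) by (simp add: limsup_le_def)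
  then show "eventually (\<lambda>r. c * F r \<le> h) at_top"
    by eventually_elim (use assms(2) in \<open>simp add: field_simps\<close>)
qed

lemma limsup_le_mono:
  assumes "limsup_le G b" "eventually (\<lambda>r. F r \<le> G r) at_top" "b \<le> a"
  shows "limsup_le F a"
  unfolding limsup_le_def
proof (intro allI impI)
  fix h assume "a < h"
  then have "eventually (\<lambda>r. G r \<le> h) at_top" using assms(1,3) by (simp add: limsup_le_def)
  with assms(2) show "eventually (\<lambda>r. F r \<le> h) at_top" by eventually_elim simp
qed

lemma tendsto_limsup_le: "(F \<longlongrightarrow> a) at_top \<Longrightarrow> limsup_le F a"
  unfolding limsup_le_def by (metis (mono_tags, lifting) order_tendstoD(2) eventually_mono less_imp_le)

text \<open>The recursion controls a function at radius \<open>c * r\<close> through radius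
  \<open>r\<close>. Since \<open>r\<close> runs through all reals, every large radius has the form
  \<open>c * r\<close>.\<close>

lemma limsup_le_rescale:
  assumes "limsup_le (\<lambda>r. F (c * r)) a" "c > 0"
  shows "limsup_le F a"
  unfolding limsup_le_def
proof (intro allI impI)
  fix h assume "a < h"
  then have "eventually (\<lambda>r. F (c * r) \<le> h) at_top" using assms(1) by (simp add: limsup_le_def)
  then obtain R where R: "\<And>r. r \<ge> R \<Longrightarrow> F (c * r) \<le> h" by (auto simp: eventually_at_top_linorder)
  have "F r \<le> h" if "r \<ge> c * R" for r
    using R[of "r / c"] that assms(2) by (simp add: field_simps)
  then show "eventually (\<lambda>r. F r \<le> h) at_top" by (auto simp: eventually_at_top_linorder)
qed

lemma limsup_le_tendsto_0:
  assumes "\<And>e. e > 0 \<Longrightarrow> limsup_le (\<lambda>r. \<bar>F r\<bar>) e"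
  shows "(F \<longlongrightarrow> (0::real)) at_top"
proof (rule tendstoI)
  fix e :: real assume "e > 0"
  then have "limsup_le (\<lambda>r. \<bar>F r\<bar>) (e / 3)" "e / 3 < e / 2" using assms by auto
  then have "eventually (\<lambda>r. \<bar>F r\<bar> \<le> e / 2) at_top" unfolding limsup_le_def by blast
  then show "eventually (\<lambda>r. dist (F r) 0 < e) at_top"
    by eventually_elim (use \<open>e > 0\<close> in simp)
qed

text \<open>Every row gives weight at least \<open>\<delta>\<close> to the place \<open>q\<close> of
  the minimum, so each average stays below the maximum by \<open>\<delta>\<close> times the spread,
  while no average falls below the minimum.\<close>

lemma stochastic_contraction:
  fixes A :: "'a::finite \<Rightarrow> 'a \<Rightarrow> real"
  assumes A: "\<And>i j. \<delta> \<le> A i j" "\<delta> > 0" "\<And>i. (\<Sum>j\<in>UNIV. A i j) = 1"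
    and osc: "\<And>i k. x i - x k \<le> h"
  shows "(\<Sum>j\<in>UNIV. A i j * x j) - (\<Sum>j\<in>UNIV. A k j * x j) \<le> (1 - \<delta>) * h"
proof -
  obtain p where p: "\<And>j. x j \<le> x p"
    using Max_in[of "range x"] Max_ge[of "range x"] by fastforce
  obtain q where q: "\<And>j. x q \<le> x j"
    using Min_in[of "range x"] Min_le[of "range x"] by fastforce
  have "\<delta> * (x p - x q) \<le> A i q * (x p - x q)" using A p by (intro mult_right_mono) auto
  also have "\<dots> \<le> (\<Sum>j\<in>UNIV. A i j * (x p - x j))"
    using less_imp_le[OF less_le_trans[OF A(2) A(1)]] p
    by (intro member_le_sum[of q UNIV "\<lambda>j. A i j * (x p - x j)"]) simp_all
  also have "\<dots> = x p - (\<Sum>j\<in>UNIV. A i j * x j)"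
    using A(3)[of i] by (simp add: right_diff_distrib sum_subtractf flip: sum_distrib_right)
  finally have 1: "(\<Sum>j\<in>UNIV. A i j * x j) \<le> x p - \<delta> * (x p - x q)" by simp
  have "0 \<le> (\<Sum>j\<in>UNIV. A k j * (x j - x q))"
    using less_imp_le[OF less_le_trans[OF A(2) A(1)]] q by (intro sum_nonneg mult_nonneg_nonneg) simp_all
  also have "\<dots> = (\<Sum>j\<in>UNIV. A k j * x j) - x q"
    using A(3)[of k] by (simp add: right_diff_distrib sum_subtractf flip: sum_distrib_right)
  finally have 2: "x q \<le> (\<Sum>j\<in>UNIV. A k j * x j)" by simp
  \<comment> \<open>Makes the factor \<open>1 - \<delta>\<close> non-negative, so that the spread
    may be replaced by its bound \<open>h\<close>.\<close>
  have "\<delta> \<le> 1"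
    using A(3)[of i] A(1)[of i i] member_le_sum[of i UNIV "A i"] less_imp_le[OF less_le_trans[OF A(2) A(1)]]
    by simp
  then have "(1 - \<delta>) * (x p - x q) \<le> (1 - \<delta>) * h" using osc by (intro mult_left_mono) auto
  then show ?thesis using 1 2 by (simp add: algebra_simps)
qed

section \<open>Powers of a primitive matrix and their eigenvectors\<close>

fun iterated :: "('a::finite \<Rightarrow> 'a \<Rightarrow> real) \<Rightarrow> nat \<Rightarrow> 'a \<Rightarrow> 'a \<Rightarrow> real" where
  "iterated M 0 i j = of_bool (i = j)"
| "iterated M (Suc n) i j = (\<Sum>k\<in>UNIV. M i k * iterated M n k j)"

lemma iterated_eigenvector:
  assumes "\<And>i. (\<Sum>j\<in>UNIV. M i j * v j) = lam * v i"
  shows "(\<Sum>j\<in>UNIV. iterated M n i j * v j) = lam ^ n * v i"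
proof (induction n arbitrary: i)
  case 0
  then show ?case by simp
next
  case (Suc n)
  have "(\<Sum>j\<in>UNIV. iterated M (Suc n) i j * v j) = (\<Sum>j\<in>UNIV. \<Sum>k\<in>UNIV. M i k * (iterated M n k j * v j))"
    by (simp add: sum_distrib_right mult.assoc)
  also have "\<dots> = (\<Sum>k\<in>UNIV. M i k * (\<Sum>j\<in>UNIV. iterated M n k j * v j))"
    by (subst sum.swap) (simp add: sum_distrib_left)
  also have "\<dots> = lam ^ n * (\<Sum>k\<in>UNIV. M i k * v k)"
    unfolding Suc sum_distrib_left by (simp add: mult_ac)
  finally show ?case using assms by simp
qed

text \<open>Conjugation with the diagonal matrix of the positive eigenvector \<open>v\<close>, and
  division by \<open>lam ^ n\<close>, make the positive power row-stochastic;
  \<open>\<delta>\<close> is its smallest entry.\<close>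

lemma normalised_stochastic:
  fixes v :: "'a::finite \<Rightarrow> real"
  assumes pos: "\<And>i j :: 'a. iterated M n i j > 0" and v: "\<And>i. v i > 0" and "lam > 0"
    and ev: "\<And>i. (\<Sum>j\<in>UNIV. M i j * v j) = lam * v i"
  obtains \<delta> where "\<delta> > 0" "\<And>i j. \<delta> \<le> iterated M n i j * v j / (lam ^ n * v i)"
    "\<And>i. (\<Sum>j\<in>UNIV. iterated M n i j * v j / (lam ^ n * v i)) = 1"
proof -
  define A where "A i j = iterated M n i j * v j / (lam ^ n * v i)" for i j
  define \<delta> where "\<delta> = Min (range (\<lambda>(i, j). A i j))"
  have "A i j > 0" for i j using assms by (simp add: A_def)
  then have "\<delta> > 0" by (auto simp: \<delta>_def)
  moreover have "\<delta> \<le> A i j" for i j unfolding \<delta>_def by (rule Min_le) (auto intro: rev_image_eqI)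
  moreover have "(\<Sum>j\<in>UNIV. A i j) = 1" for i
    using iterated_eigenvector[OF ev, of n i] v[of i] \<open>lam > 0\<close>
    by (simp add: A_def flip: sum_divide_distrib)
  ultimately show ?thesis using that unfolding A_def by blast
qed

text \<open>The quotients \<open>w i / v i\<close> form a fixed vector of the stochastic matrix, so
  their spread \<open>h\<close> satisfies \<open>h \<le> (1 - \<delta>) * h\<close> and
  vanishes.\<close>

lemma eigenvector_proportional:
  fixes v :: "'a::finite \<Rightarrow> real"
  assumes pos: "\<And>i j :: 'a. iterated M n i j > 0" and v: "\<And>i. v i > 0" and "lam > 0"
    and ev: "\<And>i. (\<Sum>j\<in>UNIV. M i j * v j) = lam * v i"
    and ew: "\<And>i. (\<Sum>j\<in>UNIV. M i j * w j) = lam * w i"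
  shows "w i / v i = w k / v k"
proof -
  obtain \<delta> where \<delta>: "\<delta> > 0" "\<And>i j. \<delta> \<le> iterated M n i j * v j / (lam ^ n * v i)"
    "\<And>i. (\<Sum>j\<in>UNIV. iterated M n i j * v j / (lam ^ n * v i)) = 1"
    using normalised_stochastic[OF pos v \<open>lam > 0\<close> ev] by blast
  define x where "x i = w i / v i" for i
  define h where "h = Max (range (\<lambda>(i, k). x i - x k))"
  have h: "x i - x k \<le> h" for i k unfolding h_def by (rule Max_ge) (auto intro: rev_image_eqI)
  have fix_x: "(\<Sum>j\<in>UNIV. iterated M n i j * v j / (lam ^ n * v i) * x j) = x i" for i
  proof -
    have "iterated M n i j * v j / (lam ^ n * v i) * x j = iterated M n i j * w j / (lam ^ n * v i)" for j
      using v[of j] by (simp add: x_def)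
    then show ?thesis
      using iterated_eigenvector[OF ew, of n i] \<open>lam > 0\<close>
      by (simp add: x_def flip: sum_divide_distrib)
  qed
  have le: "x i - x k \<le> (1 - \<delta>) * h" for i k
    using stochastic_contraction[where x = x and i = i and k = k, OF \<delta>(2,1,3) h] by (simp only: fix_x)
  have "h \<in> range (\<lambda>(i, k). x i - x k)" unfolding h_def by (rule Max_in) auto
  then have "h \<le> (1 - \<delta>) * h" using le by auto
  then have "h \<le> 0" using \<delta>(1) by (simp add: algebra_simps mult_le_0_iff)
  then have "x i \<le> x k" for i k using h[of i k] by linarith
  then show ?thesis by (metis antisym x_def)
qed

text \<open>Collects the data in physical space only, so that densities are settled before internal
  space enters. \<open>B\<close> bounds the boundary error of the covered length, and
  \<open>n\<close> is an exponent for which the power of the substitution matrix is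
  positive.\<close>

locale inflation_points =
  fixes \<Lambda> :: "'a::finite \<Rightarrow> real set" and T :: "'a \<Rightarrow> 'a \<Rightarrow> real set" and lam B :: real
    and len v :: "'a \<Rightarrow> real" and n :: nat
  assumes lam: "lam > 1" and len_pos: "\<And>i. len i > 0" and v_pos: "\<And>i. v i > 0"
    and gap: "\<And>x y i j. x \<in> \<Lambda> i \<Longrightarrow> y \<in> \<Lambda> j \<Longrightarrow> x < y \<Longrightarrow> x + len i \<le> y"
    and T_finite: "\<And>i j. finite (T i j)"
    and T_bounds: "\<And>i j t. t \<in> T i j \<Longrightarrow> 0 \<le> t \<and> t < lam * len j"
    and inflation: "\<And>i. \<Lambda> i = (\<Union>j. inflate_from lam T \<Lambda> i j)"
    and disjoint: "\<And>i. disjoint_family (inflate_from lam T \<Lambda> i)"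
    and length_sum: "\<And>r. r \<ge> 0 \<Longrightarrow> \<bar>(\<Sum>i\<in>UNIV. len i * real (card (\<Lambda> i \<inter> {-r..r}))) - 2 * r\<bar> \<le> B"
    and ev: "\<And>i. (\<Sum>j\<in>UNIV. real (card (T i j)) * v j) = lam * v i"
    and prim: "\<And>i j. iterated (\<lambda>i j. real (card (T i j))) n i j > 0"
begin

lemma card_interval: "finite (\<Lambda> i \<inter> {a..b})" "a \<le> b \<Longrightarrow> real (card (\<Lambda> i \<inter> {a..b})) \<le> (b - a) / len i + 1"
proof -
  show "a \<le> b \<Longrightarrow> real (card (\<Lambda> i \<inter> {a..b})) \<le> (b - a) / len i + 1"
    using card_separated_le[of "\<Lambda> i" "len i" a b] gap len_pos by blast
  show "finite (\<Lambda> i \<inter> {a..b})"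
    using card_separated_le[of "\<Lambda> i" "len i" a b] gap len_pos by (cases "a \<le> b") auto
qed

text \<open>Each offset in \<open>T i j\<close> causes at most 4 boundary points
  (\<open>boundary_term\<close>); the sum over \<open>i\<close> makes the constant uniform in the
  type.\<close>

definition K :: real where "K = (\<Sum>i\<in>UNIV. \<Sum>j\<in>UNIV. 4 * real (card (T i j)))"

text \<open>As \<open>0 \<le> t < lam * len j\<close>, the two cut-offs disagree only for
  \<open>y\<close> within distance \<open>len j\<close> to the left of \<open>-r\<close> or of
  \<open>r\<close>. Control points of type \<open>j\<close> are at least \<open>len j\<close> apart,
  so each of the two intervals contains at most 2 of them.\<close>

lemma boundary_term:
  fixes b :: real
  assumes t: "t \<in> T i j" and "b \<ge> 0" and g: "\<And>x. x \<in> \<Lambda> i \<Longrightarrow> \<bar>g x\<bar> \<le> b"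
  shows "\<bar>(\<Sum>y\<in>{y\<in>\<Lambda> j. \<bar>lam * y + t\<bar> \<le> lam * r}. g (lam * y + t)) - (\<Sum>y\<in>\<Lambda> j \<inter> {-r..r}. g (lam * y + t))\<bar> \<le> 4 * b"
    (is "\<bar>sum ?g ?A - sum ?g ?B\<bar> \<le> _")
proof -
  have t: "0 \<le> t" "t < lam * len j" "t \<in> T i j" using T_bounds[OF t] t by auto
  have gb: "\<bar>?g y\<bar> \<le> b" if "y \<in> \<Lambda> j" for y
    using g[of "lam * y + t"] that t(3) inflation[of i] by (auto simp: inflate_from_def)
  have AB: "?A - ?B \<subseteq> \<Lambda> j \<inter> {- r - len j..- r}"
  proof
    fix y assume y: "y \<in> ?A - ?B"
    then have "lam * y \<le> lam * r" "lam * (- r - len j) \<le> lam * y" using t(1,2) by (auto simp: algebra_simps abs_le_iff)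
    then have "y \<le> r" "- r - len j \<le> y" using lam by auto
    then show "y \<in> \<Lambda> j \<inter> {- r - len j..- r}" using y by auto
  qed
  have BA: "?B - ?A \<subseteq> \<Lambda> j \<inter> {r - len j..r}"
  proof
    fix y assume y: "y \<in> ?B - ?A"
    then have "lam * (- r) \<le> lam * y" using lam by (intro mult_left_mono) auto
    then have "lam * r < lam * y + t" using y t(1) by (auto simp: not_le abs_if split: if_splits)
    then have "lam * (r - len j) \<le> lam * y" using t(2) by (simp add: algebra_simps)
    then have "r - len j \<le> y" using lam by simp
    then show "y \<in> \<Lambda> j \<inter> {r - len j..r}" using y by auto
  qed
  have "?A \<subseteq> (\<Lambda> j \<inter> {- r - len j..- r}) \<union> ?B" using AB by blast
  then have fin: "finite ?A" "finite ?B" using card_interval(1) by (auto intro: finite_subset)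
  have small: "\<bar>sum ?g D\<bar> \<le> 2 * b" if "D \<subseteq> \<Lambda> j \<inter> {a..a + len j}" for D a
  proof -
    have "\<bar>sum ?g D\<bar> \<le> (\<Sum>y\<in>D. b)"
      by (intro order_trans[OF sum_abs] sum_mono gb) (use that in blast)
    also have "\<dots> = real (card D) * b" by simp
    also have "real (card D) * b \<le> 2 * b"
    proof -
      have "real (card D) \<le> 2"
        using card_mono[OF card_interval(1) that] card_interval(2)[of a "a + len j" j] len_pos[of j] by simp
      then show ?thesis using \<open>b \<ge> 0\<close> by (intro mult_right_mono) auto
    qed
    finally show ?thesis .
  qed
  have "sum ?g ?A - sum ?g ?B = sum ?g (?A - ?B) - sum ?g (?B - ?A)"
    using sum.Int_Diff[OF fin(1), of ?g ?B] sum.Int_Diff[OF fin(2), of ?g ?A] by (simp add: Int_commute)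
  moreover have "\<bar>sum ?g (?A - ?B)\<bar> \<le> 2 * b" by (rule small[of _ "- r - len j"]) (use AB in simp)
  moreover have "\<bar>sum ?g (?B - ?A)\<bar> \<le> 2 * b" by (rule small[of _ "r - len j"]) (use BA in simp)
  ultimately show ?thesis by linarith
qed

text \<open>Every point of type \<open>i\<close> has exactly one address: a supertile, given by
  \<open>j\<close> and \<open>y\<close>, and an offset \<open>t\<close> in it. Summation by
  addresses is exact; the error comes only from cutting off at \<open>\<bar>y\<bar> \<le> r\<close>
  instead of at the inflated point.\<close>

lemma renormalisation:
  fixes b :: real
  assumes "b \<ge> 0" and g: "\<And>x. x \<in> \<Lambda> i \<Longrightarrow> \<bar>g x\<bar> \<le> b"
  shows "\<bar>(\<Sum>x\<in>\<Lambda> i \<inter> {-(lam * r)..lam * r}. g x) -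
    (\<Sum>j\<in>UNIV. \<Sum>t\<in>T i j. \<Sum>y\<in>\<Lambda> j \<inter> {-r..r}. g (lam * y + t))\<bar> \<le> K * b"
proof -
  define A where "A j t = {y\<in>\<Lambda> j. \<bar>lam * y + t\<bar> \<le> lam * r}" for j t
  define P where "P = (SIGMA j:UNIV. SIGMA t:T i j. A j t)"
  define h where "h = (\<lambda>(j::'a, t, y). lam * y + t)"
  have finA: "finite (A j t)" for j t
  proof (rule finite_subset[OF _ card_interval(1)])
    show "A j t \<subseteq> \<Lambda> j \<inter> {(- (lam * r) - t) / lam..(lam * r - t) / lam}"
      using lam by (auto simp: A_def field_simps abs_le_iff)
  qed
  have "inj_on h P"
  proof (rule inj_onI)
    fix p p' assume pp: "p \<in> P" "p' \<in> P" "h p = h p'"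
    obtain j t y j' t' y' where eqs: "p = (j, t, y)" "p' = (j', t', y')" by (cases p, cases p')
    have m: "t \<in> T i j" "y \<in> \<Lambda> j" "t' \<in> T i j'" "y' \<in> \<Lambda> j'" "lam * y + t = lam * y' + t'"
      using pp by (auto simp: eqs P_def A_def h_def)
    have "lam * y + t \<in> inflate_from lam T \<Lambda> i j" using m(1,2) by (auto simp: inflate_from_def)
    moreover have "lam * y' + t' \<in> inflate_from lam T \<Lambda> i j'" using m(3,4) by (auto simp: inflate_from_def)
    ultimately have j: "j = j'" using disjoint[of i] m(5) by (auto simp: disjoint_family_on_def)
    \<comment> \<open>The hypothesis \<open>disjoint\<close> separates different \<open>j\<close>
      only. For equal \<open>j\<close>, two supertiles start at least \<open>lam * len j\<close>
      apart, which exceeds every offset.\<close>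
    have no: False if "y1 \<in> \<Lambda> j" "y2 \<in> \<Lambda> j" "t1 \<in> T i j" "t2 \<in> T i j" "lam * y1 + t1 = lam * y2 + t2" "y1 < y2"
      for y1 y2 t1 t2
    proof -
      have "lam * (y1 + len j) \<le> lam * y2" using gap[OF that(1,2,6)] lam by (intro mult_left_mono) auto
      moreover have "t1 < lam * len j" "0 \<le> t2" using T_bounds that by auto
      ultimately show False using that(5) by (simp add: algebra_simps)
    qed
    have "y = y'" using no[of y y' t t'] no[of y' y t' t] m j by (metis linorder_neqE)
    then show "p = p'" using m j eqs by simp
  qed
  moreover have "h ` P = \<Lambda> i \<inter> {-(lam * r)..lam * r}"
  proof
    show "h ` P \<subseteq> \<Lambda> i \<inter> {-(lam * r)..lam * r}"
      by (subst inflation) (auto simp: h_def P_def A_def inflate_from_def abs_le_iff)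
    show "\<Lambda> i \<inter> {-(lam * r)..lam * r} \<subseteq> h ` P"
    proof
      fix x assume x: "x \<in> \<Lambda> i \<inter> {-(lam * r)..lam * r}"
      then obtain j y t where "x = lam * y + t" "y \<in> \<Lambda> j" "t \<in> T i j"
        using inflation[of i] by (auto simp: inflate_from_def)
      then show "x \<in> h ` P" using x by (intro image_eqI[of _ _ "(j, t, y)"]) (auto simp: h_def P_def A_def)
    qed
  qed
  ultimately have "(\<Sum>x\<in>\<Lambda> i \<inter> {-(lam * r)..lam * r}. g x) = (\<Sum>p\<in>P. g (h p))"
    by (metis (mono_tags, lifting) sum.reindex_cong)
  also have "\<dots> = (\<Sum>j\<in>UNIV. \<Sum>t\<in>T i j. \<Sum>y\<in>A j t. g (lam * y + t))"
    using T_finite finA by (simp add: P_def h_def sum.Sigma split_def)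
  finally have "\<bar>(\<Sum>x\<in>\<Lambda> i \<inter> {-(lam * r)..lam * r}. g x) -
      (\<Sum>j\<in>UNIV. \<Sum>t\<in>T i j. \<Sum>y\<in>\<Lambda> j \<inter> {-r..r}. g (lam * y + t))\<bar> =
    \<bar>\<Sum>j\<in>UNIV. \<Sum>t\<in>T i j. (\<Sum>y\<in>A j t. g (lam * y + t)) - (\<Sum>y\<in>\<Lambda> j \<inter> {-r..r}. g (lam * y + t))\<bar>"
    by (simp add: sum_subtractf)
  also have "\<dots> \<le> (\<Sum>j\<in>UNIV. \<Sum>t\<in>T i j. 4 * b)"
    unfolding A_def
    by (intro order_trans[OF sum_abs] sum_mono boundary_term[where i = i] assms)
  also have "\<dots> = (\<Sum>j\<in>UNIV. 4 * real (card (T i j))) * b"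
    unfolding sum_distrib_right by (simp add: mult_ac)
  also have "\<dots> \<le> K * b"
    unfolding K_def using \<open>b \<ge> 0\<close>
    by (intro mult_right_mono member_le_sum[of i UNIV "\<lambda>i. \<Sum>j\<in>UNIV. 4 * real (card (T i j))"]) (auto intro: sum_nonneg)
  finally show ?thesis .
qed

section \<open>Letter densities\<close>

abbreviation N where "N i r \<equiv> real (card (\<Lambda> i \<inter> {-r..r}))"

lemma card_inflated:
  "\<bar>N i (lam * r) - (\<Sum>j\<in>UNIV. real (card (T i j)) * N j r)\<bar> \<le> K"
  using renormalisation[of 1 i "\<lambda>x. 1" r] by simp

text \<open>The constant \<open>C\<close> depends on \<open>m\<close> but not on \<open>r\<close>,
  so it disappears after division by \<open>r\<close>.\<close>

lemma card_inflated_iter: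
  "\<exists>C. \<forall>i r. \<bar>N i (lam ^ m * r) - (\<Sum>j\<in>UNIV. iterated (\<lambda>i j. real (card (T i j))) m i j * N j r)\<bar> \<le> C"
proof (induction m)
  case 0
  show ?case by (intro exI[of _ 0]) simp
next
  case (Suc m)
  let ?I = "iterated (\<lambda>i j. real (card (T i j)))"
  obtain C where C: "\<And>i r. \<bar>N i (lam ^ m * r) - (\<Sum>j\<in>UNIV. ?I m i j * N j r)\<bar> \<le> C"
    using Suc by blast
  have "\<bar>N i (lam ^ Suc m * r) - (\<Sum>j\<in>UNIV. ?I (Suc m) i j * N j r)\<bar>
      \<le> K + (\<Sum>i\<in>UNIV. \<Sum>k\<in>UNIV. real (card (T i k)) * \<bar>C\<bar>)" for i r
  proof -
    have "(\<Sum>j\<in>UNIV. ?I (Suc m) i j * N j r) = (\<Sum>k\<in>UNIV. real (card (T i k)) * (\<Sum>j\<in>UNIV. ?I m k j * N j r))"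
      by (subst sum_distrib_left, subst sum.swap) (simp add: sum_distrib_right mult.assoc)
    moreover have "\<bar>(\<Sum>k\<in>UNIV. real (card (T i k)) * N k (lam ^ m * r)) -
        (\<Sum>k\<in>UNIV. real (card (T i k)) * (\<Sum>j\<in>UNIV. ?I m k j * N j r))\<bar>
        \<le> (\<Sum>k\<in>UNIV. real (card (T i k)) * \<bar>C\<bar>)"
      unfolding sum_subtractf[symmetric] right_diff_distrib[symmetric]
      by (rule order_trans[OF sum_abs], intro sum_mono)
        (auto simp: abs_mult intro!: mult_left_mono order_trans[OF C])
    moreover have "(\<Sum>k\<in>UNIV. real (card (T i k)) * \<bar>C\<bar>) \<le> (\<Sum>i\<in>UNIV. \<Sum>k\<in>UNIV. real (card (T i k)) * \<bar>C\<bar>)"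
      by (rule member_le_sum[of i UNIV "\<lambda>i. \<Sum>k\<in>UNIV. real (card (T i k)) * \<bar>C\<bar>"]) (auto intro: sum_nonneg)
    ultimately show ?thesis
      using card_inflated[of i "lam ^ m * r"] by (simp add: mult.assoc)
  qed
  then show ?case by blast
qed

text \<open>Division by \<open>v i\<close> makes the recursion stochastic and the expected limit
  independent of \<open>i\<close>.\<close>

definition freq where "freq i r = N i r / (2 * r * v i)"

lemma const_over_tendsto_0: "((\<lambda>r::real. C / r) \<longlongrightarrow> 0) at_top"
  by (intro tendsto_divide_0[OF tendsto_const] filterlim_at_top_imp_at_infinity filterlim_ident)

text \<open>A common bound \<open>h\<close> for the upper limits of all differences improves to
  \<open>(1 - \<delta>) * h\<close>, since passing from \<open>r\<close> to
  \<open>lam ^ n * r\<close> applies the stochastic matrix up to \<open>O(1/r)\<close>. Repetition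
  drives any initial bound to 0.\<close>

lemma freq_oscillation: "limsup_le (\<lambda>r. freq i r - freq k r) 0"
proof -
  let ?I = "iterated (\<lambda>i j. real (card (T i j)))"
  have "lam > 0" using lam by simp
  then obtain \<delta> where \<delta>: "\<delta> > 0" "\<And>i j. \<delta> \<le> ?I n i j * v j / (lam ^ n * v i)"
    "\<And>i. (\<Sum>j\<in>UNIV. ?I n i j * v j / (lam ^ n * v i)) = 1"
    using normalised_stochastic[OF prim v_pos _ ev] by blast
  define A where "A i j = ?I n i j * v j / (lam ^ n * v i)" for i j
  obtain C where C: "\<And>i r. \<bar>N i (lam ^ n * r) - (\<Sum>j\<in>UNIV. ?I n i j * N j r)\<bar> \<le> C"
    using card_inflated_iter by blast
  have lamn: "lam ^ n > 0" "lam ^ n \<ge> 1" using lam by auto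
  define D where "D = (\<Sum>i\<in>UNIV. C / (2 * lam ^ n * v i))"
  have "0 \<le> C" by (rule order_trans[OF abs_ge_zero C])
  have step: "\<bar>freq i (lam ^ n * r) - (\<Sum>j\<in>UNIV. A i j * freq j r)\<bar> \<le> D / r" if "r > 0" for i r
  proof -
    have "(\<Sum>j\<in>UNIV. A i j * freq j r) = (\<Sum>j\<in>UNIV. ?I n i j * N j r) / (2 * (lam ^ n * r) * v i)"
      unfolding sum_divide_distrib
    proof (intro sum.cong refl)
      fix j show "A i j * freq j r = ?I n i j * N j r / (2 * (lam ^ n * r) * v i)"
        using v_pos[of j] by (simp add: A_def freq_def)
    qed
    then have "\<bar>freq i (lam ^ n * r) - (\<Sum>j\<in>UNIV. A i j * freq j r)\<bar> =
        \<bar>N i (lam ^ n * r) - (\<Sum>j\<in>UNIV. ?I n i j * N j r)\<bar> / (2 * (lam ^ n * r) * v i)"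
      using that lamn v_pos[of i] by (simp add: freq_def abs_mult flip: diff_divide_distrib)
    also have "\<dots> \<le> C / (2 * (lam ^ n * r) * v i)"
      using C that lamn v_pos[of i] by (intro divide_right_mono) auto
    also have "\<dots> = C / (2 * lam ^ n * v i) / r" by (simp add: mult_ac)
    also have "C / (2 * lam ^ n * v i) \<le> D" unfolding D_def
      using lamn v_pos \<open>0 \<le> C\<close> by (intro member_le_sum[of i UNIV "\<lambda>i. C / (2 * lam ^ n * v i)"])
        (auto intro!: divide_nonneg_nonneg mult_nonneg_nonneg less_imp_le[OF v_pos])
    finally show ?thesis using that by (simp add: divide_right_mono)
  qed
  have contract: "\<forall>i k. limsup_le (\<lambda>r. freq i r - freq k r) ((1 - \<delta>) * h)"
    if h: "\<forall>i k. limsup_le (\<lambda>r. freq i r - freq k r) h" for h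
  proof (intro allI)
    fix i k
    have "limsup_le (\<lambda>r. freq i (lam ^ n * r) - freq k (lam ^ n * r)) ((1 - \<delta>) * h)"
      unfolding limsup_le_def
    proof (intro allI impI)
      fix h' assume h': "(1 - \<delta>) * h < h'"
      \<comment> \<open>Of the three thirds of the slack, one absorbs the excess over
        \<open>h\<close> at finite \<open>r\<close>, one the two errors \<open>D / r\<close>, and
        one is left over.\<close>
      define e where "e = (h' - (1 - \<delta>) * h) / 3"
      have e: "e > 0" using h' by (simp add: e_def)
      have "\<forall>\<^sub>F r in at_top. \<forall>(i, k)\<in>UNIV. freq i r - freq k r \<le> h + e"
        using h e by (intro eventually_ball_finite) (auto simp: limsup_le_def)
      moreover have "\<forall>\<^sub>F r in at_top. 2 * D / r < e"
        using order_tendstoD(2)[OF const_over_tendsto_0 e] .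
      ultimately show "\<forall>\<^sub>F r in at_top. freq i (lam ^ n * r) - freq k (lam ^ n * r) \<le> h'"
        using eventually_gt_at_top[of 0]
      proof eventually_elim
        case (elim r)
        have "(\<Sum>j\<in>UNIV. A i j * freq j r) - (\<Sum>j\<in>UNIV. A k j * freq j r) \<le> (1 - \<delta>) * (h + e)"
          by (rule stochastic_contraction[where x = "\<lambda>j. freq j r"]) (use \<delta> elim(1) in \<open>auto simp: A_def\<close>)
        moreover have "(1 - \<delta>) * (h + e) \<le> (1 - \<delta>) * h + e"
          using \<delta>(1) e by (simp add: algebra_simps)
        moreover have "2 * D / r = D / r + D / r" by simp
        moreover have "3 * e = h' - (1 - \<delta>) * h" by (simp add: e_def)
        ultimately show ?case using step[OF elim(3), of i] step[OF elim(3), of k] elim(2) e by linarith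
      qed
    qed
    then show "limsup_le (\<lambda>r. freq i r - freq k r) ((1 - \<delta>) * h)"
      by (rule limsup_le_rescale) (use lamn in simp)
  qed
  \<comment> \<open>An initial bound from the separation of the points alone: for
    \<open>r \<ge> 1\<close> there are at most \<open>r * (2 / len i + 1)\<close> points of type
    \<open>i\<close>.\<close>
  define h0 where "h0 = (\<Sum>i\<in>UNIV. (2 / len i + 1) / (2 * v i))"
  have start: "freq i r \<le> h0" "0 \<le> freq i r" if "r \<ge> 1" for i r
  proof -
    have "N i r \<le> 2 * r / len i + 1" using card_interval(2)[of "-r" r i] that by simp
    also have "\<dots> \<le> r * (2 / len i + 1)" using that by (simp add: algebra_simps)
    finally have "freq i r \<le> r * (2 / len i + 1) / (2 * r * v i)"
      unfolding freq_def using that v_pos[of i] by (intro divide_right_mono) auto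
    also have "\<dots> = (2 / len i + 1) / (2 * v i)" using that by simp
    also have "\<dots> \<le> h0" unfolding h0_def
      using len_pos v_pos by (intro member_le_sum[of i UNIV "\<lambda>i. (2 / len i + 1) / (2 * v i)"])
        (auto intro!: divide_nonneg_nonneg add_nonneg_nonneg less_imp_le[OF v_pos] less_imp_le[OF len_pos])
    finally show "freq i r \<le> h0" .
    show "0 \<le> freq i r" using that v_pos[of i] by (simp add: freq_def)
  qed
  have \<delta>1: "\<delta> \<le> 1"
  proof -
    have "A i i \<le> (\<Sum>j\<in>UNIV. A i j)"
      using \<delta>(1,2) by (intro member_le_sum) (auto simp: A_def intro: order_trans[OF less_imp_le])
    then show ?thesis using \<delta>(2)[of i i] \<delta>(3)[of i] by (simp add: A_def)
  qed
  have all: "\<forall>i k. limsup_le (\<lambda>r. freq i r - freq k r) ((1 - \<delta>) ^ m * h0)" for m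
  proof (induction m)
    case 0
    show ?case unfolding limsup_le_def
    proof (intro allI impI)
      fix i k h' assume "(1 - \<delta>) ^ 0 * h0 < h'"
      then have "freq i r - freq k r \<le> h'" if "r \<ge> 1" for r
        using start(1)[OF that, of i] start(2)[OF that, of k] by simp
      then show "\<forall>\<^sub>F r in at_top. freq i r - freq k r \<le> h'"
        unfolding eventually_at_top_linorder by blast
    qed
  next
    case (Suc m)
    then show ?case using contract[of "(1 - \<delta>) ^ m * h0"] by (simp add: mult.assoc)
  qed
  show ?thesis unfolding limsup_le_def
  proof (intro allI impI)
    fix h' :: real assume "0 < h'"
    have "(\<lambda>m. (1 - \<delta>) ^ m * h0) \<longlonglongrightarrow> 0"
      using \<delta>(1) \<delta>1 by (intro tendsto_mult_left_zero LIMSEQ_realpow_zero) auto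
    then have "\<forall>\<^sub>F m in sequentially. (1 - \<delta>) ^ m * h0 < h'" using \<open>0 < h'\<close> by (rule order_tendstoD)
    then obtain m where "(1 - \<delta>) ^ m * h0 < h'" by (auto simp: eventually_sequentially)
    then show "\<forall>\<^sub>F r in at_top. freq i r - freq k r \<le> h'" using all unfolding limsup_le_def by blast
  qed
qed

text \<open>All normalised frequencies have asymptotically vanishing differences. Their sum with
  weights \<open>len k * v k\<close> is the covered length over \<open>2 * r\<close> and tends to 1,
  which determines the common limit.\<close>

lemma density: "((\<lambda>r. N i r / (2 * r)) \<longlongrightarrow> v i / (\<Sum>k\<in>UNIV. len k * v k)) at_top"
proof -
  define c where "c = (\<Sum>k\<in>UNIV. len k * v k)"
  have c: "c > 0" unfolding c_def using len_pos v_pos by (intro sum_pos) auto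
  have diff: "((\<lambda>r. freq i r - freq k r) \<longlongrightarrow> 0) at_top" for k
  proof (rule limsup_le_tendsto_0)
    fix e :: real assume "e > 0"
    show "limsup_le (\<lambda>r. \<bar>freq i r - freq k r\<bar>) e"
      unfolding limsup_le_def
    proof (intro allI impI)
      fix h assume "e < h"
      then have "h > 0" using \<open>e > 0\<close> by simp
      then have "\<forall>\<^sub>F r in at_top. freq i r - freq k r \<le> h" "\<forall>\<^sub>F r in at_top. freq k r - freq i r \<le> h"
        using freq_oscillation unfolding limsup_le_def by blast+
      then show "\<forall>\<^sub>F r in at_top. \<bar>freq i r - freq k r\<bar> \<le> h" by eventually_elim auto
    qed
  qed
  have total: "((\<lambda>r. \<Sum>k\<in>UNIV. len k * v k * freq k r) \<longlongrightarrow> 1) at_top"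
  proof -
    have "((\<lambda>r. (\<Sum>k\<in>UNIV. len k * v k * freq k r) - 1) \<longlongrightarrow> 0) at_top"
    proof (rule Lim_null_comparison[OF _ const_over_tendsto_0])
      show "\<forall>\<^sub>F r in at_top. norm ((\<Sum>k\<in>UNIV. len k * v k * freq k r) - 1) \<le> (B / 2) / r"
        using eventually_gt_at_top[of 0]
      proof eventually_elim
        case (elim r)
        have "len k * v k * freq k r = len k * N k r / (2 * r)" for k
          using v_pos[of k] elim by (simp add: freq_def)
        then have "(\<Sum>k\<in>UNIV. len k * v k * freq k r) - 1 = ((\<Sum>k\<in>UNIV. len k * N k r) - 2 * r) / (2 * r)"
          using elim by (simp add: sum_divide_distrib diff_divide_distrib)
        then have "norm ((\<Sum>k\<in>UNIV. len k * v k * freq k r) - 1) = \<bar>(\<Sum>k\<in>UNIV. len k * N k r) - 2 * r\<bar> / (2 * r)"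
          using elim by (simp add: abs_divide)
        also have "\<dots> \<le> B / (2 * r)" using length_sum[of r] elim by (intro divide_right_mono) auto
        finally show ?case by simp
      qed
    qed
    then show ?thesis by (simp add: LIM_zero_cancel)
  qed
  \<comment> \<open>Adding null sequences exchanges every \<open>freq k\<close> for
    \<open>freq i\<close>, after which the weights sum up to \<open>c\<close>.\<close>
  have "((\<lambda>r. (\<Sum>k\<in>UNIV. len k * v k * freq k r) + (\<Sum>k\<in>UNIV. len k * v k * (freq i r - freq k r)))
      \<longlongrightarrow> 1 + (\<Sum>k\<in>UNIV. len k * v k * 0)) at_top"
    by (intro tendsto_intros total diff)
  then have "((\<lambda>r. c * freq i r) \<longlongrightarrow> 1) at_top"
    by (simp add: c_def right_diff_distrib sum_subtractf sum_distrib_right)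
  then have "((\<lambda>r. v i / c * (c * freq i r)) \<longlongrightarrow> v i / c * 1) at_top" by (intro tendsto_intros)
  moreover have "v i / c * (c * freq i r) = N i r / (2 * r)" for r
    using c v_pos[of i] by (simp add: freq_def)
  ultimately show ?thesis by (simp add: c_def)
qed

end


section \<open>Embeddings of the number field of a unit\<close>

lemma map_poly_of_int_mult:
  "map_poly (of_int :: int \<Rightarrow> 'b::{comm_ring_1,ring_char_0}) (p * q) = map_poly of_int p * map_poly of_int q"
  by (intro poly_eqI) (simp add: coeff_map_poly coeff_mult)

lemma map_poly_of_rat_add:
  "map_poly (of_rat :: rat \<Rightarrow> 'b::field_char_0) (p + q) = map_poly of_rat p + map_poly of_rat q"
  by (intro poly_eqI) (simp add: coeff_map_poly of_rat_add)

lemma map_poly_of_rat_mult: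
  "map_poly (of_rat :: rat \<Rightarrow> 'b::field_char_0) (p * q) = map_poly of_rat p * map_poly of_rat q"
  by (intro poly_eqI) (simp add: coeff_map_poly coeff_mult of_rat_sum of_rat_mult)

lemma map_poly_of_rat_of_int:
  "map_poly (of_rat :: rat \<Rightarrow> 'b::field_char_0) (map_poly of_int p) = map_poly of_int p"
  by (intro poly_eqI) (simp add: coeff_map_poly)

lemma clear_denominators:
  obtains c q where "c \<noteq> 0" "smult (rat_of_int c) p = map_poly of_int q"
proof -
  have "\<exists>c q. c \<noteq> 0 \<and> smult (rat_of_int c) p = map_poly of_int q"
  proof (induction p)
    case 0
    show ?case by (rule exI[of _ 1], rule exI[of _ 0]) simp
  next
    case (pCons a p)
    then obtain c q where cq: "c \<noteq> 0" "smult (rat_of_int c) p = map_poly of_int q" by blast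
    obtain m n where mn: "a = of_int m / of_int n" "n > 0"
      by (metis quotient_of_div quotient_of_denom_pos surj_pair)
    have "smult (rat_of_int (c * n)) (pCons a p) = pCons (of_int (c * m)) (smult (of_int n) (smult (rat_of_int c) p))"
      using mn by (simp add: mult.commute)
    also have "\<dots> = map_poly of_int (pCons (c * m) (smult n q))"
      unfolding cq(2) by (simp add: map_poly_pCons map_poly_smult)
    finally show ?case using cq(1) mn(2) by (intro exI[of _ "c * n"] exI conjI) auto
  qed
  then show ?thesis using that by blast
qed

text \<open>Gauss's lemma. An integer polynomial of least degree is made primitive; pseudo-division
  of \<open>g\<close> leaves no remainder by minimality, so a multiple \<open>c\<close> of
  \<open>g\<close> is \<open>p * q\<close>. As \<open>p\<close> has content 1, \<open>c\<close>
  divides the content of \<open>q\<close> and cancels. Divisibility over the integers is what lets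
  coefficients be compared later.\<close>

lemma primitive_minimal_poly:
  assumes "p0 \<noteq> 0" "poly (map_poly of_int p0) (x::real) = 0"
  obtains p :: "int poly" where "p \<noteq> 0" "poly (map_poly of_int p) x = 0"
    "\<And>g. poly (map_poly of_int g) x = 0 \<Longrightarrow> p dvd g"
proof -
  define S where "S = {g :: int poly. g \<noteq> 0 \<and> poly (map_poly of_int g) x = 0}"
  have "p0 \<in> S" using assms by (simp add: S_def)
  then obtain p1 where p1: "p1 \<in> S" "\<And>g. g \<in> S \<Longrightarrow> degree p1 \<le> degree g"
    using ex_has_least_nat[of "\<lambda>g. g \<in> S" p0 degree] by blast
  define p where "p = primitive_part p1"
  have p1_eq: "p1 = [:content p1:] * p" by (simp add: p_def)
  have p: "p \<noteq> 0" "content p = 1" "degree p = degree p1"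
    using p1(1) by (auto simp: p_def S_def)
  have "of_int (content p1) * poly (map_poly of_int p) x = poly (map_poly of_int p1) x"
    by (subst p1_eq, subst map_poly_of_int_mult) (simp add: map_poly_pCons)
  then have px: "poly (map_poly of_int p) x = 0" using p1(1) by (simp add: S_def)
  show ?thesis
  proof (rule that[OF p(1) px])
    fix g :: "int poly" assume g: "poly (map_poly of_int g) x = 0"
    obtain q r where qr: "pseudo_divmod g p = (q, r)" by fastforce
    define c where "c = lead_coeff p ^ (Suc (degree g) - degree p)"
    have c: "c \<noteq> 0" using p(1) by (simp add: c_def)
    have eq: "smult c g = p * q + r" and r: "r = 0 \<or> degree r < degree p"
      using pseudo_divmod[OF p(1) qr] by (auto simp: c_def)
    have "[:c:] * g - p * q = r" using eq by simp
    then have "map_poly (of_int :: int \<Rightarrow> real) r = map_poly of_int ([:c:] * g) - map_poly of_int (p * q)"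
      by (intro poly_eqI) (auto simp: coeff_map_poly)
    then have "poly (map_poly of_int r) x = 0"
      using g px by (simp only: map_poly_of_int_mult) simp
    then have "r \<noteq> 0 \<Longrightarrow> degree p1 \<le> degree r" using p1(2)[of r] by (simp add: S_def)
    then have r0: "r = 0" using r p(3) by force
    then have "c dvd content q"
      using arg_cong[OF eq, of content] p(2) by (simp add: content_mult) (metis abs_dvd_iff dvd_triv_left)
    then obtain q' where q': "q = [:c:] * q'" by (metis const_poly_dvd_iff_dvd_content dvdE)
    have "smult c g = smult c (p * q')" using eq r0 q' by simp
    then have "g = p * q'" using c by (simp add: smult_cancel)
    then show "p dvd g" by simp
  qed
qed

text \<open>Divisibility over the integers passes to leading and constant coefficients:
  \<open>p\<close> divides a monic polynomial of \<open>x\<close>, and also the reflection of a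
  monic polynomial of \<open>inverse x\<close>, whose constant coefficient is 1.\<close>

lemma unit_minimal_poly:
  assumes "algebraic_int (x::real)" "algebraic_int (inverse x)" "x \<noteq> 0"
  obtains p :: "int poly" where "p \<noteq> 0" "poly (map_poly of_int p) x = 0"
    "\<And>g. poly (map_poly of_int g) x = 0 \<Longrightarrow> p dvd g" "\<bar>lead_coeff p\<bar> = 1" "\<bar>coeff p 0\<bar> = 1"
proof -
  obtain g where g: "poly (map_poly of_int g) x = 0" "lead_coeff g = 1"
    using assms(1) by (auto simp: algebraic_int_altdef_ipoly)
  obtain h where h: "poly (map_poly of_int h) (inverse x) = 0" "lead_coeff h = 1"
    using assms(2) by (auto simp: algebraic_int_altdef_ipoly)
  have "g \<noteq> 0" using g by auto
  then obtain p where p: "p \<noteq> 0" "poly (map_poly of_int p) x = 0"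
    "\<And>g. poly (map_poly of_int g) x = 0 \<Longrightarrow> p dvd g"
    using primitive_minimal_poly[OF _ g(1)] by blast
  obtain k where "g = p * k" using p(3)[OF g(1)] by blast
  then have "lead_coeff p * lead_coeff k = 1" using g(2) by (metis lead_coeff_mult)
  then have l: "\<bar>lead_coeff p\<bar> = 1" by (metis abs_mult abs_zmult_eq_1 abs_1)
  have "map_poly (of_int :: int \<Rightarrow> real) (reflect_poly h) = reflect_poly (map_poly of_int h)"
    by (intro poly_eqI) (simp add: coeff_map_poly coeff_reflect_poly degree_map_poly)
  then have "poly (map_poly of_int (reflect_poly h)) x = 0"
    using h(1) assms(3) by (simp add: poly_reflect_poly_nz)
  then obtain k' where "reflect_poly h = p * k'" using p(3) by blast
  then have "coeff p 0 * coeff k' 0 = 1" using h(2) by (metis coeff_0_reflect_poly coeff_mult_0)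
  then have "\<bar>coeff p 0\<bar> = 1" by (metis abs_mult abs_zmult_eq_1 abs_1)
  with p l show ?thesis using that by blast
qed

section \<open>The number field of a unit and the roots of its minimal polynomial\<close>

locale algebraic_unit =
  fixes lam :: real and p :: "int poly"
  assumes p_nz: "p \<noteq> 0" and p_root: "poly (map_poly of_int p) lam = 0"
    and p_min: "\<And>g. poly (map_poly of_int g) lam = 0 \<Longrightarrow> p dvd g"
    and p_lead: "\<bar>lead_coeff p\<bar> = 1" and p_const: "\<bar>coeff p 0\<bar> = 1"
begin

abbreviation ev :: "'b::field_char_0 \<Rightarrow> rat poly \<Rightarrow> 'b" where
  "ev z P \<equiv> poly (map_poly of_rat P) z"

definition pr :: "rat poly" where "pr = map_poly of_int p"

definition rts :: "complex set" where "rts = {z. poly (map_poly of_int p) z = 0}"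

lemma ev_pr: "ev z pr = poly (map_poly of_int p) z"
  by (simp add: pr_def map_poly_of_rat_of_int)

lemma ev_simps: "ev z (P + Q) = ev z P + ev z Q" "ev z (P * Q) = ev z P * ev z Q"
  "ev z 1 = 1" "ev z 0 = 0" "ev z [:a:] = of_rat a" "ev z [:0, 1:] = z"
  "ev z (pCons a P) = of_rat a + z * ev z P"
  by (simp_all add: map_poly_of_rat_add map_poly_of_rat_mult map_poly_pCons)

lemma pr_nz: "pr \<noteq> 0" using p_nz by (auto simp: pr_def map_poly_eq_0_iff)

lemma pr_dvd: assumes "ev lam P = 0" shows "pr dvd P"
proof -
  obtain c q where cq: "c \<noteq> 0" "smult (rat_of_int c) P = map_poly of_int q" by (rule clear_denominators)
  have "poly (map_poly of_int q) lam = ev lam ([:of_int c:] * P)"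
    using map_poly_of_rat_of_int[of q, where 'b = real] by (simp flip: cq(2))
  also have "\<dots> = 0" using assms by (simp only: ev_simps mult_zero_right)
  finally obtain k where "q = p * k" using p_min by blast
  then have "smult (of_int c) P = pr * map_poly of_int k"
    using cq(2) by (simp add: pr_def map_poly_of_int_mult)
  then have "pr dvd smult (of_int c) P" by simp
  then show ?thesis using cq(1) by (simp add: dvd_smult_iff)
qed

lemma pr_irreducible: "irreducible pr"
proof (rule irreducibleI)
  show "pr \<noteq> 0" by (rule pr_nz)
  show "\<not> is_unit pr"
  proof
    assume "is_unit pr"
    then obtain k where "1 = pr * k" by blast
    then have "ev lam 1 = ev lam pr * ev lam k" by (metis ev_simps(2))
    then show False using p_root by (simp add: ev_simps ev_pr)
  qed
  fix a b assume ab: "pr = a * b"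
  then have "ev lam a = 0 \<or> ev lam b = 0"
    using p_root by (metis ev_pr ev_simps(2) mult_eq_0_iff)
  moreover have "is_unit y" if "pr = x * y" "ev lam x = 0" for x y
  proof -
    have nz: "x \<noteq> 0" "y \<noteq> 0" using pr_nz that by auto
    then have "degree pr \<le> degree x" using pr_dvd[OF that(2)] by (simp add: dvd_imp_degree_le)
    then have "degree y = 0" using that(1) nz by (simp add: degree_mult_eq)
    then show ?thesis using nz(2) by (simp add: is_unit_iff_degree)
  qed
  ultimately show "is_unit a \<or> is_unit b" using ab by (metis mult.commute)
qed

text \<open>If the irreducible \<open>pr\<close> did not divide \<open>P\<close>, a Bezout identity
  evaluated at the common root would read 0 = 1. Thus all roots satisfy the same rational relations
  as \<open>lam\<close>.\<close>

lemma common_root: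
  assumes "z \<in> rts" "ev z P = 0" shows "pr dvd P"
proof (rule ccontr)
  assume "\<not> pr dvd P"
  then have "coprime pr P" using pr_irreducible by (intro prime_elem_imp_coprime irreducible_imp_prime_elem)
  then have "fst (bezout_coefficients pr P) * pr + snd (bezout_coefficients pr P) * P = 1"
    by (simp add: bezout_coefficients_fst_snd)
  then have "ev z (fst (bezout_coefficients pr P) * pr + snd (bezout_coefficients pr P) * P) = ev z 1" by simp
  then show False using assms by (simp add: ev_simps ev_pr rts_def)
qed

lemma ev_eq_0_iff: assumes "z \<in> rts" shows "ev z P = 0 \<longleftrightarrow> ev lam P = 0"
proof
  assume "ev z P = 0"
  then obtain k where "P = pr * k" using common_root[OF assms] by blast
  then show "ev lam P = 0" using p_root by (simp add: ev_simps ev_pr)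
next
  assume "ev lam P = 0"
  then obtain k where "P = pr * k" using pr_dvd by blast
  then show "ev z P = 0" using assms by (simp add: ev_simps ev_pr rts_def)
qed

text \<open>Vieta's formula for the constant coefficient. The product over the set of roots counts
  each root once, so simplicity matters: a double root would make \<open>pr\<close> divide its own
  derivative.\<close>

lemma rts_prod: "(\<Prod>z\<in>rts. cmod z) = 1" and rts_finite: "finite rts"
proof -
  let ?pc = "map_poly of_int p :: complex poly"
  have nz: "?pc \<noteq> 0" using p_nz by (auto simp: map_poly_eq_0_iff)
  then show "finite rts" by (simp add: rts_def poly_roots_finite)
  have "rsquarefree ?pc"
  proof (unfold rsquarefree_roots, intro allI notI)
    fix a assume a: "poly ?pc a = 0 \<and> poly (pderiv ?pc) a = 0"
    have "pderiv ?pc = map_poly of_rat (pderiv pr)"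
      by (intro poly_eqI) (simp add: coeff_map_poly coeff_pderiv pr_def of_rat_mult of_rat_add)
    then have "pr dvd pderiv pr" using common_root[of a "pderiv pr"] a by (simp add: rts_def)
    then have "degree pr = 0"
      using dvd_imp_degree_le[of pr "pderiv pr"] by (auto simp: pderiv_eq_0_iff degree_pderiv)
    then show False using pr_nz pr_irreducible by (simp add: irreducible_def is_unit_iff_degree)
  qed
  then have "smult (lead_coeff ?pc) (\<Prod>z\<in>rts. [:-z, 1:]) = ?pc"
    unfolding rts_def by (rule complex_poly_decompose_rsquarefree)
  then have "poly ?pc 0 = lead_coeff ?pc * (\<Prod>z\<in>rts. - z)"
    by (metis (no_types, lifting) poly_smult poly_prod prod.cong poly_pCons poly_0 mult_zero_left add.right_neutral)
  moreover have "poly ?pc 0 = of_int (coeff p 0)" by (simp add: poly_0_coeff_0 coeff_map_poly)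
  moreover have "lead_coeff ?pc = of_int (lead_coeff p)" by (simp add: coeff_map_poly degree_map_poly)
  ultimately have "of_int \<bar>coeff p 0\<bar> = of_int \<bar>lead_coeff p\<bar> * (\<Prod>z\<in>rts. cmod z)"
    by (metis (no_types, lifting) norm_mult norm_of_int prod_norm norm_minus_cancel prod.cong of_int_abs)
  then show "(\<Prod>z\<in>rts. cmod z) = 1" using p_lead p_const by simp
qed

lemma nf_memI: "ev lam Q \<noteq> 0 \<Longrightarrow> ev lam P / ev lam Q \<in> number_field lam"
  unfolding number_field_def by blast

lemma nf_cases:
  assumes "x \<in> number_field lam"
  obtains P Q where "x = ev lam P / ev lam Q" "ev lam Q \<noteq> 0"
  using assms unfolding number_field_def by blast

lemma nf_poly: "ev lam P \<in> number_field lam"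
  using nf_memI[of 1 P] by (simp add: ev_simps)

lemma nf_basic: "of_rat a \<in> number_field lam" "lam \<in> number_field lam" "0 \<in> number_field lam" "1 \<in> number_field lam"
  using nf_poly[of "[:a:]"] nf_poly[of "[:0,1:]"] nf_poly[of 0] nf_poly[of 1] by (simp_all add: ev_simps)

lemma nf_closed: assumes "x \<in> number_field lam" "y \<in> number_field lam"
  shows "x + y \<in> number_field lam" "x * y \<in> number_field lam"
proof -
  obtain P Q R S where *: "x = ev lam P / ev lam Q" "ev lam Q \<noteq> 0" "y = ev lam R / ev lam S" "ev lam S \<noteq> 0"
    using assms by (metis nf_cases)
  have "x + y = ev lam (P * S + R * Q) / ev lam (Q * S)" "x * y = ev lam (P * R) / ev lam (Q * S)"
    using *(2,4) unfolding *(1,3) ev_simps by (simp_all add: add_frac_eq)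
  moreover have "ev lam (Q * S) \<noteq> 0" using *(2,4) by (simp add: ev_simps)
  ultimately show "x + y \<in> number_field lam" "x * y \<in> number_field lam"
    by (metis nf_memI)+
qed

lemma nf_inverse: assumes "x \<in> number_field lam" shows "inverse x \<in> number_field lam"
proof (cases "x = 0")
  case False
  obtain P Q where *: "x = ev lam P / ev lam Q" "ev lam Q \<noteq> 0" using assms by (rule nf_cases)
  then show ?thesis using nf_memI[of P Q] False by simp
qed (simp add: nf_basic)

lemma nf_uminus: "x \<in> number_field lam \<Longrightarrow> - x \<in> number_field lam"
  using nf_closed(2)[of "of_rat (-1)" x] nf_basic(1)[of "-1"] by (simp add: of_rat_minus)

lemma nf_int_ring: "int_ring lam \<subseteq> number_field lam"
proof
  fix x assume "x \<in> int_ring lam"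
  then obtain g :: "int poly" where "x = poly (map_poly of_int g) lam" by (auto simp: int_ring_def)
  then have "x = ev lam (map_poly of_int g)" by (simp add: map_poly_of_rat_of_int)
  then show "x \<in> number_field lam" using nf_poly by simp
qed

context
  fixes \<phi> assumes \<phi>: "\<phi> \<in> embeddings lam"
begin

lemma emb_add: "x \<in> number_field lam \<Longrightarrow> y \<in> number_field lam \<Longrightarrow> \<phi> (x + y) = \<phi> x + \<phi> y"
  and emb_mult: "x \<in> number_field lam \<Longrightarrow> y \<in> number_field lam \<Longrightarrow> \<phi> (x * y) = \<phi> x * \<phi> y"
  and emb_1: "\<phi> 1 = 1"
  using \<phi> by (auto simp: embeddings_def)

lemma emb_0: "\<phi> 0 = 0" using emb_add[of 0 0] nf_basic by simp

lemma emb_uminus: "x \<in> number_field lam \<Longrightarrow> \<phi> (- x) = - \<phi> x"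
  using emb_add[of x "- x"] emb_0 nf_uminus by (simp add: add_eq_0_iff)

lemma emb_nz: "x \<in> number_field lam \<Longrightarrow> x \<noteq> 0 \<Longrightarrow> \<phi> x \<noteq> 0"
  using emb_mult[of x "inverse x"] nf_inverse emb_1 by force

lemma emb_nat: "\<phi> (of_nat n) = of_nat n"
proof (induction n)
  case (Suc n)
  then show ?case using emb_add[of "of_nat n" 1] emb_1 nf_basic(1)[of "of_nat n"] nf_basic(4)
    by (simp add: add.commute)
qed (simp add: emb_0)

lemma emb_int: "\<phi> (of_int k) = of_int k"
proof (cases "k \<ge> 0")
  case True then show ?thesis using emb_nat[of "nat k"] by simp
next
  case False
  then show ?thesis
    using emb_nat[of "nat (-k)"] emb_uminus[of "real_of_int k"] nf_basic(1)[of "of_int k"] by simp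
qed

lemma emb_rat: "\<phi> (of_rat a) = of_rat a"
proof -
  obtain m n where mn: "a = of_int m / of_int n" "n > 0"
    by (metis quotient_of_div quotient_of_denom_pos surj_pair)
  have "of_rat a * real_of_int n = of_int m" using mn by (simp add: of_rat_divide)
  then have "\<phi> (of_rat a) * of_int n = of_int m"
    using emb_mult[of "of_rat a" "of_int n"] nf_basic(1)[of a] nf_basic(1)[of "of_int n"] emb_int by simp
  then show ?thesis using mn(2) unfolding mn(1) by (simp add: of_rat_divide eq_divide_eq)
qed

lemma emb_ev: "\<phi> (ev lam P) = ev (\<phi> lam) P"
proof (induction P)
  case (pCons a P)
  then show ?case
    using emb_add[of "of_rat a" "lam * ev lam P"] emb_mult[of lam "ev lam P"] nf_closed(2)[of lam "ev lam P"]
      nf_basic nf_poly[of P] emb_rat by (simp add: ev_simps)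
qed (simp add: emb_0)

lemma emb_root: "\<phi> lam \<in> rts"
  using emb_ev[of pr] ev_pr[of lam] p_root emb_0 ev_pr[of "\<phi> lam"] by (simp add: rts_def)

lemma emb_div: assumes "ev lam Q \<noteq> 0"
  shows "\<phi> (ev lam P / ev lam Q) = ev (\<phi> lam) P / ev (\<phi> lam) Q"
proof -
  have "\<phi> (ev lam P / ev lam Q) * \<phi> (ev lam Q) = \<phi> (ev lam P)"
    using emb_mult[of "ev lam P / ev lam Q" "ev lam Q"] nf_memI[OF assms, of P] nf_poly[of Q] assms by simp
  moreover have "\<phi> (ev lam Q) \<noteq> 0" using emb_nz nf_poly assms by blast
  ultimately show ?thesis by (simp add: emb_ev field_simps)
qed

lemma conj_embedding_lam: "cmod (conj_embedding lam \<phi> lam) = cmod (\<phi> lam)"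
  by (simp add: conj_embedding_def nf_basic)

end

lemma emb_inj: "inj_on (\<lambda>\<phi>. \<phi> lam) (embeddings lam)"
proof (rule inj_onI)
  fix \<phi> \<psi> assume *: "\<phi> \<in> embeddings lam" "\<psi> \<in> embeddings lam" "\<phi> lam = \<psi> lam"
  have "\<phi> \<in> extensional (number_field lam)" "\<psi> \<in> extensional (number_field lam)"
    using * by (auto simp: embeddings_def)
  then show "\<phi> = \<psi>"
  proof (rule extensionalityI)
    fix x assume "x \<in> number_field lam"
    then obtain P Q where "x = ev lam P / ev lam Q" "ev lam Q \<noteq> 0" by (rule nf_cases)
    then show "\<phi> x = \<psi> x" using emb_div[of \<phi> Q P] emb_div[of \<psi> Q P] * by simp
  qed
qed

text \<open>The embedding substitutes \<open>z\<close> for \<open>lam\<close> in a fraction. A field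
  element has many such fractions, hence the relation \<open>f\<close>; it is single-valued because
  \<open>z\<close> and \<open>lam\<close> annihilate the same rational polynomials.\<close>

lemma emb_surj: assumes z: "z \<in> rts" shows "\<exists>\<phi>\<in>embeddings lam. \<phi> lam = z"
proof -
  define f where "f x y \<longleftrightarrow> (\<exists>P Q. x = ev lam P / ev lam Q \<and> ev lam Q \<noteq> 0 \<and> y = ev z P / ev z Q)" for x y
  have uniq: "y = y'" if fy: "f x y" "f x y'" for x y y'
  proof -
    obtain P Q P' Q' where *: "x = ev lam P / ev lam Q" "ev lam Q \<noteq> 0" "y = ev z P / ev z Q"
      "x = ev lam P' / ev lam Q'" "ev lam Q' \<noteq> 0" "y' = ev z P' / ev z Q'"
      using fy unfolding f_def by blast
    have "ev lam (P * Q' + [:-1:] * (P' * Q)) = 0"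
      unfolding ev_simps using * by (simp add: field_simps)
    then have "ev z (P * Q' + [:-1:] * (P' * Q)) = 0" using z ev_eq_0_iff by blast
    then have "ev z P * ev z Q' = ev z P' * ev z Q" unfolding ev_simps by (simp add: of_rat_minus)
    moreover have "ev z Q \<noteq> 0" "ev z Q' \<noteq> 0" using * z ev_eq_0_iff by auto
    ultimately show ?thesis unfolding *(3,6) by (simp add: frac_eq_eq)
  qed
  define \<phi> where "\<phi> = restrict (\<lambda>x. THE y. f x y) (number_field lam)"
  have val: "\<phi> x = y" if "f x y" for x y
  proof -
    have "x \<in> number_field lam" using that nf_memI unfolding f_def by blast
    then show ?thesis using that uniq by (auto simp: \<phi>_def intro!: the_equality)
  qed
  have fI: "f (ev lam P / ev lam Q) (ev z P / ev z Q)" if "ev lam Q \<noteq> 0" for P Q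
    using that unfolding f_def by blast
  have "f 1 1" "f lam z" using fI[of 1 1] fI[of 1 "[:0, 1:]"] by (simp_all add: ev_simps)
  moreover have "\<phi> (x + y) = \<phi> x + \<phi> y \<and> \<phi> (x * y) = \<phi> x * \<phi> y"
    if xy: "x \<in> number_field lam" "y \<in> number_field lam" for x y
  proof -
    obtain P Q P' Q' where *: "x = ev lam P / ev lam Q" "ev lam Q \<noteq> 0"
      "y = ev lam P' / ev lam Q'" "ev lam Q' \<noteq> 0"
      using xy by (metis nf_cases)
    have nz: "ev z Q \<noteq> 0" "ev z Q' \<noteq> 0" using * z ev_eq_0_iff by auto
    have "x + y = ev lam (P * Q' + P' * Q) / ev lam (Q * Q')" "x * y = ev lam (P * P') / ev lam (Q * Q')"
      using *(2,4) unfolding *(1,3) ev_simps by (simp_all add: add_frac_eq)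
    moreover have "ev lam (Q * Q') \<noteq> 0" using * by (simp add: ev_simps)
    ultimately have "\<phi> (x + y) = ev z (P * Q' + P' * Q) / ev z (Q * Q')"
      "\<phi> (x * y) = ev z (P * P') / ev z (Q * Q')" using val fI by metis+
    moreover have "\<phi> x = ev z P / ev z Q" "\<phi> y = ev z P' / ev z Q'" using val fI * by auto
    ultimately show ?thesis using nz unfolding ev_simps by (simp add: add_frac_eq)
  qed
  ultimately have "\<phi> \<in> embeddings lam" "\<phi> lam = z"
    using val unfolding embeddings_def by (auto simp: \<phi>_def)
  then show ?thesis by blast
qed

lemma emb_bij: "bij_betw (\<lambda>\<phi>. \<phi> lam) (embeddings lam) rts"
  unfolding bij_betw_def using emb_inj emb_root emb_surj by blast

lemma emb_finite: "finite (embeddings lam)"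
  using emb_bij rts_finite bij_betw_finite by blast

lemma emb_prod: "(\<Prod>\<phi>\<in>embeddings lam. cmod (\<phi> lam)) = 1"
  using prod.reindex_bij_betw[OF emb_bij, of cmod] rts_prod by simp

lemma id_embedding_in: "id_embedding lam \<in> real_embeddings lam"
  using nf_closed nf_basic by (auto simp: id_embedding_def real_embeddings_def embeddings_def)

lemma emb_conjugate: assumes "\<phi> \<in> embeddings lam" shows "\<phi> lam \<in> conjugates lam"
  using emb_root[OF assms] pr_irreducible p_root unfolding conjugates_def
  by (auto simp: rts_def ev_pr intro!: exI[of _ pr])

lemma emb_id: assumes "\<phi> \<in> embeddings lam" "\<phi> lam = of_real lam" shows "\<phi> = id_embedding lam"
proof -
  have "id_embedding lam \<in> embeddings lam" using id_embedding_in by (simp add: real_embeddings_def)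
  moreover have "id_embedding lam lam = of_real lam" by (simp add: id_embedding_def nf_basic)
  ultimately show ?thesis using emb_inj assms by (metis (mono_tags, lifting) inj_onD)
qed

end


section \<open>Lebesgue measure under linear maps\<close>

lemma nn_integral_lborel_translate:
  fixes h :: "'a::euclidean_space \<Rightarrow> ennreal"
  assumes [measurable]: "h \<in> borel_measurable borel"
  shows "(\<integral>\<^sup>+y. h (a + y) \<partial>lborel) = (\<integral>\<^sup>+y. h y \<partial>lborel)"
proof -
  have "(\<integral>\<^sup>+y. h y \<partial>lborel) = (\<integral>\<^sup>+y. h y \<partial>distr lborel borel ((+) a))"
    by (simp only: lborel_distr_plus)
  also have "\<dots> = (\<integral>\<^sup>+y. h (a + y) \<partial>lborel)" by (subst nn_integral_distr) auto
  finally show ?thesis by simp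
qed

text \<open>The double integral of \<open>1\<^sub>A(x) 1\<^sub>B(x + f y)\<close>, with \<open>A\<close> the unit ball, is
  the volume of \<open>A\<close> times the volume of the preimage of \<open>B\<close> in one order of integration, and
  the volume of \<open>A\<close> times the volume of \<open>B\<close> in the other. (The change of
  variables formula of the library requires a well-ordered index type.)\<close>

lemma lborel_distr_isometry:
  fixes f :: "'a::euclidean_space \<Rightarrow> 'a"
  assumes lin: "linear f" and iso: "\<And>x. norm (f x) = norm x"
  shows "distr lborel borel f = lborel"
proof (rule measure_eqI)
  fix B assume "B \<in> sets (distr lborel borel f)"
  then have B[measurable]: "B \<in> sets borel" by simp
  have "inj f" using iso lin by (metis linear_injective_0 norm_eq_zero)
  then obtain g where "linear g" and fg: "\<And>x. f (g x) = x"
    using linear_injective_isomorphism[OF lin] by metis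
  have isog: "norm (x - f y) = norm (g x - y)" for x y
    by (metis fg iso lin linear_diff)
  have [measurable]: "f \<in> borel_measurable borel"
    using lin by (simp add: borel_measurable_continuous_onI linear_continuous_on linear_linear)
  interpret lborel_pair: pair_sigma_finite "lborel :: 'a measure" "lborel :: 'a measure" ..
  define A :: "'a set" where "A = ball 0 1"
  have Am[measurable]: "A \<in> sets borel" by (simp add: A_def)
  let ?\<mu> = "emeasure (lborel :: 'a measure)"
  have A: "?\<mu> A \<noteq> 0" "?\<mu> A \<noteq> \<infinity>"
    using emeasure_lborel_ball_finite[of 0 1] content_ball_pos[of 1 "0::'a"]
    by (auto simp: A_def measure_def)
  have "(\<integral>\<^sup>+x. \<integral>\<^sup>+y. indicator A x * indicator B (x + f y) \<partial>lborel \<partial>lborel) =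
      (\<integral>\<^sup>+x. indicator A x * ?\<mu> (f -` B) \<partial>lborel)"
  proof (rule nn_integral_cong)
    fix x
    \<comment> \<open>Surjectivity moves the shift inside: \<open>x = f (g x)\<close>, and
      translation invariance applies to the argument of \<open>f\<close>.\<close>
    have "(\<integral>\<^sup>+y. indicator B (x + f y) \<partial>lborel) = (\<integral>\<^sup>+y. indicator B (f (g x + y)) \<partial>lborel)"
      using lin fg by (simp add: linear_add)
    also have "\<dots> = (\<integral>\<^sup>+y. indicator B (f y) \<partial>lborel)"
      by (rule nn_integral_lborel_translate[of "\<lambda>y. indicator B (f y)"]) measurable
    also have "\<dots> = (\<integral>\<^sup>+y. indicator (f -` B) y \<partial>lborel)" by (simp add: indicator_vimage comp_def)
    also have "\<dots> = ?\<mu> (f -` B)"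
      using measurable_sets[OF \<open>f \<in> borel_measurable borel\<close> B] by (intro nn_integral_indicator) simp
    finally show "(\<integral>\<^sup>+y. indicator A x * indicator B (x + f y) \<partial>lborel) = indicator A x * ?\<mu> (f -` B)"
      by (simp add: nn_integral_cmult)
  qed
  also have "\<dots> = (\<integral>\<^sup>+x. indicator A x \<partial>lborel) * ?\<mu> (f -` B)"
    by (intro nn_integral_multc borel_measurable_indicator) simp
  also have "\<dots> = ?\<mu> A * ?\<mu> (f -` B)" by simp
  finally have 1: "(\<integral>\<^sup>+x. \<integral>\<^sup>+y. indicator A x * indicator B (x + f y) \<partial>lborel \<partial>lborel) =
      ?\<mu> A * ?\<mu> (f -` B)" .
  have "(\<integral>\<^sup>+x. \<integral>\<^sup>+y. indicator A x * indicator B (x + f y) \<partial>lborel \<partial>lborel) =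
      (\<integral>\<^sup>+y. \<integral>\<^sup>+x. indicator A x * indicator B (x + f y) \<partial>lborel \<partial>lborel)"
    by (rule lborel_pair.Fubini'[symmetric]) measurable
  also have "\<dots> = (\<integral>\<^sup>+y. \<integral>\<^sup>+x. indicator A (x - f y) * indicator B x \<partial>lborel \<partial>lborel)"
  proof (rule nn_integral_cong)
    fix y
    show "(\<integral>\<^sup>+x. indicator A x * indicator B (x + f y) \<partial>lborel) =
        (\<integral>\<^sup>+x. indicator A (x - f y) * indicator B x \<partial>lborel)"
      using nn_integral_lborel_translate[of "\<lambda>x. indicator A (x - f y) * indicator B x" "f y"]
      by (simp add: add.commute)
  qed
  also have "\<dots> = (\<integral>\<^sup>+x. \<integral>\<^sup>+y. indicator A (x - f y) * indicator B x \<partial>lborel \<partial>lborel)"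
    by (rule lborel_pair.Fubini') measurable
  also have "\<dots> = (\<integral>\<^sup>+x. ?\<mu> A * indicator B x \<partial>lborel)"
  proof (rule nn_integral_cong)
    fix x
    \<comment> \<open>The isometry pulls the unit ball about \<open>x\<close> back to the unit ball
      about \<open>g x\<close>, which has the volume of \<open>A\<close>.\<close>
    have "(\<integral>\<^sup>+y. indicator A (x - f y) \<partial>lborel) = (\<integral>\<^sup>+y. indicator (ball (g x) 1) y \<partial>lborel)"
      by (intro nn_integral_cong) (simp add: A_def indicator_def dist_norm isog norm_minus_commute[of "f _" x])
    also have "\<dots> = ?\<mu> (ball (g x) 1)" by simp
    also have "\<dots> = ?\<mu> A" by (simp add: A_def emeasure_ball)
    finally show "(\<integral>\<^sup>+y. indicator A (x - f y) * indicator B x \<partial>lborel) = ?\<mu> A * indicator B x"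
      by (simp add: nn_integral_multc)
  qed
  also have "\<dots> = ?\<mu> A * ?\<mu> B" by (simp add: nn_integral_cmult)
  finally have "?\<mu> A * ?\<mu> (f -` B) = ?\<mu> A * ?\<mu> B" using 1 by simp
  then have "?\<mu> (f -` B) = ?\<mu> B" using A by (simp add: ennreal_mult_cancel_left)
  then show "emeasure (distr lborel borel f) B = emeasure lborel B" by (simp add: emeasure_distr)
qed simp

text \<open>Orthogonal images of the basis vectors make \<open>f\<close> a diagonal scaling
  \<open>D\<close> followed by an isometry; only \<open>D\<close> changes the volume, by the product
  of the norms.\<close>

lemma lborel_integral_orthogonal_linear:
  fixes f :: "'a::euclidean_space \<Rightarrow> 'a" and h :: "'a \<Rightarrow> real"
  assumes lin: "linear f" and nz: "\<And>j. j \<in> Basis \<Longrightarrow> f j \<noteq> 0"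
    and orth: "\<And>i j. i \<in> Basis \<Longrightarrow> j \<in> Basis \<Longrightarrow> i \<noteq> j \<Longrightarrow> f i \<bullet> f j = 0"
    and [measurable]: "h \<in> borel_measurable borel"
  shows "integral\<^sup>L lborel h = (\<Prod>j\<in>Basis. norm (f j)) * (\<integral>y. h (f y + t) \<partial>lborel)"
proof -
  \<comment> \<open>The summand 0 is the translation part in the form of affine map that
    \<open>lborel_affine_euclidean\<close> expects.\<close>
  define D where "D y = (0::'a) + (\<Sum>j\<in>Basis. (norm (f j) * (y \<bullet> j)) *\<^sub>R j)" for y
  define iso where "iso z = (\<Sum>j\<in>Basis. (z \<bullet> j) *\<^sub>R (f j /\<^sub>R norm (f j)))" for z
  define c where "c = (\<Prod>j\<in>Basis. \<bar>norm (f j)\<bar>)"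
  have f_eq: "f y = iso (D y)" for y
  proof -
    have "f y = f (\<Sum>j\<in>Basis. (y \<bullet> j) *\<^sub>R j)" by (simp add: euclidean_representation)
    also have "\<dots> = (\<Sum>j\<in>Basis. (y \<bullet> j) *\<^sub>R f j)" using lin by (simp add: linear_sum linear_scale)
    also have "\<dots> = iso (D y)" unfolding iso_def D_def
      using nz by (intro sum.cong) (simp_all add: inner_sum_left inner_Basis if_distrib cong: if_cong)
    finally show ?thesis .
  qed
  have iso_lin: "linear iso"
    unfolding iso_def by (intro linearI) (simp_all add: inner_add_left scaleR_add_left sum.distrib scaleR_sum_right distrib_right mult.assoc)
  have "(norm (iso z))\<^sup>2 = (norm z)\<^sup>2" for z
  proof -
    have "(norm (iso z))\<^sup>2 = (\<Sum>i\<in>Basis. \<Sum>j\<in>Basis. (z \<bullet> i) * (z \<bullet> j) * ((f i /\<^sub>R norm (f i)) \<bullet> (f j /\<^sub>R norm (f j))))"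
      unfolding power2_norm_eq_inner iso_def inner_sum_left inner_sum_right
      by (subst sum.swap) (simp add: sum_distrib_left mult_ac)
    also have "\<dots> = (\<Sum>i\<in>Basis. \<Sum>j\<in>Basis. if j = i then (z \<bullet> i)\<^sup>2 else 0)"
    proof (intro sum.cong refl)
      fix i j :: 'a assume ij: "i \<in> Basis" "j \<in> Basis"
      show "(z \<bullet> i) * (z \<bullet> j) * ((f i /\<^sub>R norm (f i)) \<bullet> (f j /\<^sub>R norm (f j))) =
          (if j = i then (z \<bullet> i)\<^sup>2 else 0)"
        using nz[OF ij(1)] orth[OF ij]
        by (auto simp: power2_eq_square dot_square_norm inverse_eq_divide)
    qed
    also have "\<dots> = (norm z)\<^sup>2"
      unfolding power2_norm_eq_inner by (simp add: euclidean_inner[of z z] power2_eq_square)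
    finally show ?thesis .
  qed
  then have iso_norm: "norm (iso z) = norm z" for z by (simp add: power2_eq_iff_nonneg)
  have [measurable]: "iso \<in> borel_measurable borel"
    using iso_lin by (simp add: borel_measurable_continuous_onI linear_continuous_on linear_linear)
  have [measurable]: "D \<in> borel_measurable borel" unfolding D_def by measurable
  have lb: "lborel = density (distr lborel borel D) (\<lambda>_. ennreal c)"
    unfolding c_def D_def using nz by (subst lborel_affine_euclidean[of "\<lambda>j. norm (f j)" 0]) auto
  have "integral\<^sup>L lborel h = integral\<^sup>L (distr lborel borel ((+) t)) h" by (simp only: lborel_distr_plus)
  also have "\<dots> = (\<integral>z. h (t + z) \<partial>lborel)" by (subst integral_distr) auto
  also have "\<dots> = (\<integral>z. h (t + z) \<partial>distr lborel borel iso)"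
    by (simp only: lborel_distr_isometry[OF iso_lin iso_norm])
  also have "\<dots> = (\<integral>z. h (t + iso z) \<partial>lborel)" by (subst integral_distr) auto
  also have "\<dots> = (\<integral>z. h (t + iso z) \<partial>density (distr lborel borel D) (\<lambda>_. ennreal c))"
    by (simp only: lb[symmetric])
  also have "\<dots> = (\<integral>z. c *\<^sub>R h (t + iso z) \<partial>distr lborel borel D)"
    by (subst integral_density) (auto simp: c_def prod_nonneg)
  also have "\<dots> = (\<integral>y. c *\<^sub>R h (t + iso (D y)) \<partial>lborel)" by (subst integral_distr) auto
  also have "\<dots> = c * (\<integral>y. h (f y + t) \<partial>lborel)" by (simp add: f_eq add.commute)
  finally show ?thesis by (simp add: c_def)
qed


section \<open>The Minkowski embedding\<close>

locale minkowski_embedding = algebraic_unit lam p for lam p +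
  fixes cd :: "'m::finite \<Rightarrow> coordinate" and S :: "(real \<Rightarrow> complex) set"
  assumes S_un: "S \<union> conj_embedding lam ` S = complex_embeddings lam"
    and S_int: "S \<inter> conj_embedding lam ` S = {}"
    and cd_bij: "bij_betw cd UNIV
       (Re_of ` (real_embeddings lam - {id_embedding lam}) \<union> Re_of ` S \<union> Im_of ` S)"
    and pisot: "\<And>\<mu>. \<mu> \<in> conjugates lam - {complex_of_real lam} \<Longrightarrow> cmod \<mu> < 1"
    and lam_gt_1: "lam > 1"
begin

abbreviation Q where "Q \<equiv> Q_matrix lam cd"

definition RE where "RE = real_embeddings lam - {id_embedding lam}"

lemma S_sub: "S \<subseteq> complex_embeddings lam" using S_un by blast

lemma RE_S: "RE \<inter> S = {}" "finite RE" "finite S" "RE \<subseteq> embeddings lam" "S \<subseteq> embeddings lam"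
proof -
  show *: "RE \<subseteq> embeddings lam" "S \<subseteq> embeddings lam"
    using S_sub by (auto simp: RE_def real_embeddings_def complex_embeddings_def)
  show "finite RE" "finite S" using * emb_finite finite_subset by blast+
  show "RE \<inter> S = {}" using S_sub by (auto simp: RE_def complex_embeddings_def)
qed

lemma cd_range: "range cd = Re_of ` (RE \<union> S) \<union> Im_of ` S"
  using cd_bij by (auto simp: bij_betw_def RE_def)

lemma inj_cd: "inj cd" using cd_bij by (simp add: bij_betw_def)

text \<open>Replaces the labelling by sums over embeddings: a real embedding owns one axis, a
  complex representative two.\<close>

lemma sum_coordinates:
  "(\<Sum>l\<in>UNIV. g (cd l)) = (\<Sum>\<phi>\<in>RE \<union> S. g (Re_of \<phi>)) + (\<Sum>\<phi>\<in>S. g (Im_of \<phi>))"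
proof -
  have "(\<Sum>l\<in>UNIV. g (cd l)) = sum g (range cd)" using inj_cd by (simp add: sum.reindex)
  also have "\<dots> = sum g (Re_of ` (RE \<union> S)) + sum g (Im_of ` S)"
    unfolding cd_range using RE_S by (intro sum.union_disjoint) auto
  also have "\<dots> = (\<Sum>\<phi>\<in>RE \<union> S. g (Re_of \<phi>)) + (\<Sum>\<phi>\<in>S. g (Im_of \<phi>))"
    by (simp add: sum.reindex inj_on_def)
  finally show ?thesis .
qed

lemma prod_coordinates:
  "(\<Prod>l\<in>UNIV. g (cd l)) = (\<Prod>\<phi>\<in>RE \<union> S. g (Re_of \<phi>)) * (\<Prod>\<phi>\<in>S. g (Im_of \<phi>))"
proof -
  have "(\<Prod>l\<in>UNIV. g (cd l)) = prod g (range cd)" using inj_cd by (simp add: prod.reindex)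
  also have "\<dots> = prod g (Re_of ` (RE \<union> S)) * prod g (Im_of ` S)"
    unfolding cd_range using RE_S by (intro prod.union_disjoint) auto
  also have "\<dots> = (\<Prod>\<phi>\<in>RE \<union> S. g (Re_of \<phi>)) * (\<Prod>\<phi>\<in>S. g (Im_of \<phi>))"
    by (simp add: prod.reindex inj_on_def)
  finally show ?thesis .
qed

lemma coordinate_cases:
  obtains \<phi> where "cd k = Re_of \<phi>" "\<phi> \<in> RE \<union> S" | \<phi> where "cd k = Im_of \<phi>" "\<phi> \<in> S"
proof -
  have "cd k \<in> Re_of ` (RE \<union> S) \<union> Im_of ` S" using cd_range by blast
  then show ?thesis using that by blast
qed

lemma Im_RE: "\<phi> \<in> RE \<Longrightarrow> x \<in> number_field lam \<Longrightarrow> Im (\<phi> x) = 0"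
  by (auto simp: RE_def real_embeddings_def complex_is_Real_iff)

text \<open>The factor by which \<open>Q\<close> stretches along an axis. Both axes of a complex
  embedding get the same value, as \<open>Q\<close> acts on their plane by a rotation and a
  scaling.\<close>

definition modulus :: "coordinate \<Rightarrow> real" where
  "modulus c = (case c of Re_of \<phi> \<Rightarrow> cmod (\<phi> lam) | Im_of \<phi> \<Rightarrow> cmod (\<phi> lam))"

lemma star_add:
  assumes "x \<in> number_field lam" "y \<in> number_field lam"
  shows "star cd (x + y) = star cd x + star cd y"
proof -
  have "star cd (x + y) $ k = star cd x $ k + star cd y $ k" for k
  proof (cases rule: coordinate_cases[of k])
    case (1 \<phi>)
    then have "\<phi> \<in> embeddings lam" using RE_S by blast
    then show ?thesis using 1 assms by (simp add: star_def emb_add)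
  next
    case (2 \<phi>)
    then have "\<phi> \<in> embeddings lam" using RE_S by blast
    then show ?thesis using 2 assms by (simp add: star_def emb_add)
  qed
  then show ?thesis by (simp add: vec_eq_iff)
qed

text \<open>An embedding is multiplicative, and each block of \<open>Q\<close> is multiplication by
  \<open>\<phi> lam\<close> written in real and imaginary parts.\<close>

lemma star_mult:
  assumes x: "x \<in> number_field lam"
  shows "star cd (lam * x) = Q *v star cd x"
proof -
  have eq: "\<phi> (lam * x) = \<phi> lam * \<phi> x" if "\<phi> \<in> embeddings lam" for \<phi>
    using emb_mult[OF that nf_basic(2) x] .
  have "star cd (lam * x) $ k = (Q *v star cd x) $ k" for k
  proof -
    define g where "g c d = (case (c, d) of
       (Re_of \<phi>, Re_of \<psi>) \<Rightarrow> (if \<phi> = \<psi> then Re (\<phi> lam) else 0)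
     | (Re_of \<phi>, Im_of \<psi>) \<Rightarrow> (if \<phi> = \<psi> then - Im (\<phi> lam) else 0)
     | (Im_of \<phi>, Re_of \<psi>) \<Rightarrow> (if \<phi> = \<psi> then Im (\<phi> lam) else 0)
     | (Im_of \<phi>, Im_of \<psi>) \<Rightarrow> (if \<phi> = \<psi> then Re (\<phi> lam) else 0)) *
       (case d of Re_of \<phi> \<Rightarrow> Re (\<phi> x) | Im_of \<phi> \<Rightarrow> Im (\<phi> x))" for c d
    have sum: "(Q *v star cd x) $ k = (\<Sum>\<psi>\<in>RE \<union> S. g (cd k) (Re_of \<psi>)) + (\<Sum>\<psi>\<in>S. g (cd k) (Im_of \<psi>))"
      unfolding sum_coordinates[symmetric]
      by (simp add: matrix_vector_mult_def Q_matrix_def star_def g_def)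
    show ?thesis
    proof (cases rule: coordinate_cases[of k])
      case (1 \<phi>)
      then have "\<phi> \<in> embeddings lam" using RE_S by blast
      from eq[OF this] have "star cd (lam * x) $ k = Re (\<phi> lam) * Re (\<phi> x) - Im (\<phi> lam) * Im (\<phi> x)"
        using 1 by (simp add: star_def)
      moreover have "(\<Sum>\<psi>\<in>RE \<union> S. g (cd k) (Re_of \<psi>)) = Re (\<phi> lam) * Re (\<phi> x)"
        using 1 RE_S(2,3) by (simp add: g_def if_distrib[of "\<lambda>y. y * _"] sum.delta' cong: if_cong)
      \<comment> \<open>A real embedding has no axis \<open>Im_of \<phi>\<close>, so the sum is 0;
        the right-hand side is 0 as well, since then \<open>Im (\<phi> lam) = 0\<close>.\<close>
      moreover have "(\<Sum>\<psi>\<in>S. g (cd k) (Im_of \<psi>)) = - Im (\<phi> lam) * Im (\<phi> x)"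
        using 1 RE_S(2,3) Im_RE[of \<phi> lam] nf_basic(2)
        by (auto simp: g_def if_distrib[of "\<lambda>y. y * _"] sum.delta' cong: if_cong)
      ultimately show ?thesis using sum by simp
    next
      case (2 \<phi>)
      then have "\<phi> \<in> embeddings lam" using RE_S by blast
      from eq[OF this] have "star cd (lam * x) $ k = Re (\<phi> lam) * Im (\<phi> x) + Im (\<phi> lam) * Re (\<phi> x)"
        using 2 by (simp add: star_def)
      moreover have "(\<Sum>\<psi>\<in>RE \<union> S. g (cd k) (Re_of \<psi>)) = Im (\<phi> lam) * Re (\<phi> x)"
        using 2 RE_S(2,3) by (simp add: g_def if_distrib[of "\<lambda>y. y * _"] sum.delta' cong: if_cong)
      moreover have "(\<Sum>\<psi>\<in>S. g (cd k) (Im_of \<psi>)) = Re (\<phi> lam) * Im (\<phi> x)"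
        using 2 RE_S(2,3) by (simp add: g_def if_distrib[of "\<lambda>y. y * _"] sum.delta' cong: if_cong)
      ultimately show ?thesis using sum by simp
    qed
  qed
  then show ?thesis by (simp add: vec_eq_iff)
qed

text \<open>A single embedding among the coordinates suffices, since field homomorphisms are
  injective. One exists because the index type \<open>'m\<close> is inhabited.\<close>

lemma star_inj: "inj_on (star cd) (number_field lam)"
proof (rule inj_onI)
  fix x y assume x: "x \<in> number_field lam" and y: "y \<in> number_field lam" and eq: "star cd x = star cd y"
  have comp: "(case c of Re_of \<phi> \<Rightarrow> Re (\<phi> x) | Im_of \<phi> \<Rightarrow> Im (\<phi> x)) =
              (case c of Re_of \<phi> \<Rightarrow> Re (\<phi> y) | Im_of \<phi> \<Rightarrow> Im (\<phi> y))" if "c \<in> range cd" for c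
    using that eq by (auto simp: star_def vec_eq_iff)
  have Re_eq: "Re (\<phi> x) = Re (\<phi> y)" if "\<phi> \<in> RE \<union> S" for \<phi>
    using comp[of "Re_of \<phi>"] that cd_range by auto
  have Im_eq: "Im (\<phi> x) = Im (\<phi> y)" if "\<phi> \<in> RE \<union> S" for \<phi>
    using comp[of "Im_of \<phi>"] that cd_range Im_RE x y by auto
  obtain \<phi> where \<phi>: "\<phi> \<in> RE \<union> S" using coordinate_cases[of undefined] by (metis UnI2)
  then have "\<phi> x = \<phi> y" using Re_eq Im_eq by (simp add: complex_eq_iff)
  moreover have e: "\<phi> \<in> embeddings lam" using \<phi> RE_S by blast
  ultimately have "\<phi> (x + - y) = 0"
    using emb_add[OF e x nf_uminus[OF y]] emb_uminus[OF e y] by simp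
  then show "x = y" using emb_nz[OF e nf_closed(1)[OF x nf_uminus[OF y]]] by force
qed

text \<open>A block with rows \<open>(a, -b)\<close> and \<open>(b, a)\<close> times its transpose
  is \<open>a^2 + b^2\<close> times the identity. Contraction, injectivity and volume factor of
  \<open>Q\<close> are all read off from this.\<close>

lemma Q_transpose_Q: "(transpose Q ** Q) $ k $ l = (if k = l then (modulus (cd k))\<^sup>2 else 0)"
proof -
  define g where "g c d = (case (c, d) of
       (Re_of \<phi>, Re_of \<psi>) \<Rightarrow> (if \<phi> = \<psi> then Re (\<phi> lam) else 0)
     | (Re_of \<phi>, Im_of \<psi>) \<Rightarrow> (if \<phi> = \<psi> then - Im (\<phi> lam) else 0)
     | (Im_of \<phi>, Re_of \<psi>) \<Rightarrow> (if \<phi> = \<psi> then Im (\<phi> lam) else 0)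
     | (Im_of \<phi>, Im_of \<psi>) \<Rightarrow> (if \<phi> = \<psi> then Re (\<phi> lam) else 0))" for c d
  have "(transpose Q ** Q) $ k $ l = (\<Sum>m\<in>UNIV. g (cd m) (cd k) * g (cd m) (cd l))"
    by (simp add: transpose_def matrix_matrix_mult_def Q_matrix_def g_def)
  also have "\<dots> = (\<Sum>\<psi>\<in>RE \<union> S. g (Re_of \<psi>) (cd k) * g (Re_of \<psi>) (cd l)) +
      (\<Sum>\<psi>\<in>S. g (Im_of \<psi>) (cd k) * g (Im_of \<psi>) (cd l))"
    by (rule sum_coordinates)
  also have "\<dots> = (if cd k = cd l then (modulus (cd k))\<^sup>2 else 0)"
  proof -
    have R: "(\<Sum>\<psi>\<in>RE \<union> S. (if \<psi> = \<phi> then a \<psi> else 0) * (if \<psi> = \<phi>' then b \<psi> else (0::real))) =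
        (if \<phi> = \<phi>' then a \<phi> * b \<phi> else 0)" if "\<phi> \<in> RE \<union> S" for \<phi> \<phi>' a b
      using that RE_S(2,3) by (simp add: if_distrib[of "\<lambda>y. y * _"] cong: if_cong)
    have I: "(\<Sum>\<psi>\<in>S. (if \<psi> = \<phi> then a \<psi> else 0) * (if \<psi> = \<phi>' then b \<psi> else (0::real))) =
        (if \<phi> = \<phi>' \<and> \<phi> \<in> S then a \<phi> * b \<phi> else 0)" for \<phi> \<phi>' a b
      using RE_S(3) by (simp add: if_distrib[of "\<lambda>y. y * _"] cong: if_cong)
    have im0: "Im (\<phi> lam) = 0" if "\<phi> \<in> RE \<union> S" "\<phi> \<notin> S" for \<phi> using that Im_RE nf_basic(2) by blast
    have cm: "cmod z * cmod z = Re z * Re z + Im z * Im z" for z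
      using cmod_power2[of z] by (simp add: power2_eq_square)
    show ?thesis
      by (cases rule: coordinate_cases[of k]; cases rule: coordinate_cases[of l])
        (auto simp: g_def R I modulus_def cm im0 power2_eq_square)
  qed
  also have "\<dots> = (if k = l then (modulus (cd k))\<^sup>2 else 0)" using inj_cd by (simp add: inj_eq)
  finally show ?thesis .
qed

text \<open>Conjugate embeddings have equal modulus at \<open>lam\<close>, so the second axis of a
  representative in \<open>S\<close> stands for its conjugate. Together with the factor
  \<open>lam\<close> of the identity, the product runs over all embeddings and is the absolute norm
  of a unit.\<close>

lemma modulus_prod: "lam * (\<Prod>k\<in>UNIV. modulus (cd k)) = 1"
proof -
  have "(\<Prod>k\<in>UNIV. modulus (cd k)) = (\<Prod>\<phi>\<in>RE \<union> S. cmod (\<phi> lam)) * (\<Prod>\<phi>\<in>S. cmod (\<phi> lam))"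
    by (subst prod_coordinates) (simp add: modulus_def)
  also have "\<dots> = (\<Prod>\<phi>\<in>RE. cmod (\<phi> lam)) * (\<Prod>\<phi>\<in>S. cmod (\<phi> lam)) * (\<Prod>\<phi>\<in>S. cmod (\<phi> lam))"
    using RE_S by (simp add: prod.union_disjoint)
  finally have prod: "(\<Prod>k\<in>UNIV. modulus (cd k)) = \<dots>" .
  have inj: "inj_on (conj_embedding lam) S"
  proof (rule inj_onI)
    fix \<phi> \<psi> assume *: "\<phi> \<in> S" "\<psi> \<in> S" "conj_embedding lam \<phi> = conj_embedding lam \<psi>"
    have "\<phi> \<in> extensional (number_field lam)" "\<psi> \<in> extensional (number_field lam)"
      using * RE_S(5) by (auto simp: embeddings_def)
    then show "\<phi> = \<psi>"
      by (rule extensionalityI) (metis *(3) conj_embedding_def restrict_apply' complex_cnj_cancel_iff)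
  qed
  have "embeddings lam = insert (id_embedding lam) (RE \<union> (S \<union> conj_embedding lam ` S))"
    unfolding S_un RE_def using id_embedding_in by (auto simp: complex_embeddings_def real_embeddings_def)
  moreover have "id_embedding lam \<notin> RE \<union> (S \<union> conj_embedding lam ` S)"
    unfolding S_un RE_def using id_embedding_in by (auto simp: complex_embeddings_def)
  ultimately have "1 = cmod (id_embedding lam lam) * (\<Prod>\<phi>\<in>RE \<union> (S \<union> conj_embedding lam ` S). cmod (\<phi> lam))"
    using emb_prod RE_S(2,3) by simp
  also have "(\<Prod>\<phi>\<in>RE \<union> (S \<union> conj_embedding lam ` S). cmod (\<phi> lam)) =
      (\<Prod>\<phi>\<in>RE. cmod (\<phi> lam)) * (\<Prod>\<phi>\<in>S \<union> conj_embedding lam ` S. cmod (\<phi> lam))"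
    unfolding S_un using RE_S(2) emb_finite
    by (intro prod.union_disjoint) (auto simp: RE_def complex_embeddings_def)
  also have "(\<Prod>\<phi>\<in>S \<union> conj_embedding lam ` S. cmod (\<phi> lam)) =
      (\<Prod>\<phi>\<in>S. cmod (\<phi> lam)) * (\<Prod>\<phi>\<in>conj_embedding lam ` S. cmod (\<phi> lam))"
    using RE_S(3) S_int by (intro prod.union_disjoint) auto
  also have "(\<Prod>\<phi>\<in>conj_embedding lam ` S. cmod (\<phi> lam)) = (\<Prod>\<phi>\<in>S. cmod (\<phi> lam))"
    unfolding prod.reindex[OF inj] using RE_S(5) by (intro prod.cong) (auto simp: conj_embedding_lam)
  finally show ?thesis using prod lam_gt_1 by (simp add: id_embedding_def nf_basic mult.assoc)
qed

lemma modulus_nonzero: "modulus (cd k) \<noteq> 0"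
proof
  assume "modulus (cd k) = 0"
  then have "(\<Prod>k\<in>UNIV. modulus (cd k)) = 0" by (intro prod_zero) auto
  then show False using modulus_prod by (metis mult_zero_right zero_neq_one)
qed

lemma modulus_less_1: "modulus (cd k) < 1"
proof -
  have "cmod (\<phi> lam) < 1" if "\<phi> \<in> RE \<union> S" for \<phi>
  proof -
    have "\<phi> \<in> embeddings lam" "\<phi> \<noteq> id_embedding lam"
      using that RE_S S_sub id_embedding_in by (auto simp: RE_def complex_embeddings_def)
    then show ?thesis using emb_id emb_conjugate pisot by blast
  qed
  then show ?thesis by (cases rule: coordinate_cases[of k]) (auto simp: modulus_def)
qed

lemma norm_Q: "(norm (Q *v y))\<^sup>2 = (\<Sum>k\<in>UNIV. (modulus (cd k))\<^sup>2 * (y $ k)\<^sup>2)"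
proof -
  have "(norm (Q *v y))\<^sup>2 = y \<bullet> ((transpose Q ** Q) *v y)"
    by (simp add: power2_norm_eq_inner dot_lmul_matrix[symmetric] matrix_vector_mul_assoc[symmetric]
        vector_transpose_matrix flip: transpose_matrix_vector)
  also have "\<dots> = (\<Sum>k\<in>UNIV. (modulus (cd k))\<^sup>2 * (y $ k)\<^sup>2)"
    by (simp add: inner_vec_def matrix_vector_mult_def Q_transpose_Q if_distrib[of "\<lambda>y. y * _"]
        power2_eq_square mult.left_commute cong: if_cong)
  finally show ?thesis .
qed

lemma Q_inj: "inj ((*v) Q)"
proof (rule injI)
  fix x y assume "Q *v x = Q *v y"
  then have "(\<Sum>k\<in>UNIV. (modulus (cd k))\<^sup>2 * ((x - y) $ k)\<^sup>2) = 0"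
    using norm_Q[of "x - y"] by (simp add: matrix_vector_mult_diff_distrib)
  then have "(modulus (cd k))\<^sup>2 * ((x - y) $ k)\<^sup>2 = 0" for k
    by (subst (asm) sum_nonneg_eq_0_iff) auto
  moreover note modulus_nonzero
  ultimately show "x = y" by (simp add: vec_eq_iff)
qed

lemma inner_Q_axis: "(Q *v axis k 1) \<bullet> (Q *v axis l 1) = (if k = l then (modulus (cd k))\<^sup>2 else 0)"
proof -
  have "(Q *v axis k 1) \<bullet> (Q *v axis l 1) = (transpose Q ** Q) $ k $ l"
    by (simp add: matrix_vector_mult_basis column_def inner_vec_def transpose_def matrix_matrix_mult_def)
  then show ?thesis by (simp add: Q_transpose_Q)
qed

text \<open>The columns of \<open>Q\<close> are orthogonal with the moduli as norms, so the volume
  factor is their product.\<close>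

lemma substitution_Q:
  fixes h :: "real ^ 'm \<Rightarrow> real"
  assumes "h \<in> borel_measurable borel"
  shows "integral\<^sup>L lborel h = (1 / lam) * (\<integral>y. h (Q *v y + t) \<partial>lborel)"
proof -
  have norm: "norm (Q *v axis k 1) = modulus (cd k)" for k
    using inner_Q_axis[of k k] by (simp add: norm_eq_sqrt_inner modulus_def split: coordinate.split)
  have Basis: "(Basis :: (real ^ 'm) set) = range (\<lambda>k. axis k 1)" by (auto simp: Basis_vec_def)
  have inj: "inj (\<lambda>k :: 'm. axis k (1 :: real))" by (simp add: inj_def axis_eq_axis)
  have "integral\<^sup>L lborel h = (\<Prod>j\<in>Basis. norm (Q *v j)) * (\<integral>y. h (Q *v y + t) \<partial>lborel)"
  proof (rule lborel_integral_orthogonal_linear[OF matrix_vector_mul_linear _ _ assms])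
    fix i j :: "real ^ 'm" assume "i \<in> Basis"
    then obtain k where k: "i = axis k 1" using Basis by auto
    show "Q *v i \<noteq> 0" using norm[of k] modulus_nonzero[of k] k by auto
    assume "j \<in> Basis" "i \<noteq> j"
    moreover then obtain l where "j = axis l 1" using Basis by auto
    ultimately show "(Q *v i) \<bullet> (Q *v j) = 0" using inner_Q_axis[of k l] k by auto
  qed
  also have "(\<Prod>j\<in>Basis. norm (Q *v j)) = (\<Prod>k\<in>UNIV. modulus (cd k))"
    unfolding Basis prod.reindex[OF inj] by (simp add: norm)
  also have "\<dots> = 1 / lam" using modulus_prod lam_gt_1 by (simp add: field_simps)
  finally show ?thesis .
qed

lemma Q_contraction:
  obtains q where "0 < q" "q < 1" "\<And>y. norm (Q *v y) \<le> q * norm y"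
proof -
  \<comment> \<open>The entry 1/2 makes \<open>0 < q\<close> immediate.\<close>
  define q where "q = Max (insert (1/2) (range (\<lambda>k. modulus (cd k))))"
  have q: "0 < q" "q < 1" using modulus_less_1 by (auto simp: q_def Max_gr_iff)
  have le: "modulus (cd k) \<le> q" for k unfolding q_def by (intro Max_ge) auto
  have "norm (Q *v y) \<le> q * norm y" for y
  proof -
    have "(norm (Q *v y))\<^sup>2 = (\<Sum>k\<in>UNIV. (modulus (cd k))\<^sup>2 * (y $ k)\<^sup>2)" by (rule norm_Q)
    also have "\<dots> \<le> (\<Sum>k\<in>UNIV. q\<^sup>2 * (y $ k)\<^sup>2)"
      using le by (intro sum_mono mult_right_mono power_mono)
        (auto simp: modulus_def split: coordinate.split)
    also have "\<dots> = (q * norm y)\<^sup>2"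
    proof -
      have "(norm y)\<^sup>2 = (\<Sum>k\<in>UNIV. (y $ k)\<^sup>2)"
        by (simp add: norm_vec_def L2_set_def sum_nonneg)
      then show ?thesis by (simp only: power_mult_distrib sum_distrib_left)
    qed
    finally show ?thesis by (rule power2_le_imp_le) (use q(1) in simp)
  qed
  with q show ?thesis using that by blast
qed

end

lemma pisot_minkowski_embedding:
  assumes "PV_unit lam" "minkowski_coordinates lam cd"
  obtains p S where "minkowski_embedding lam p cd S"
proof -
  have l: "lam > 1" "algebraic_int lam" "algebraic_int (inverse lam)"
    "\<forall>\<mu>\<in>conjugates lam - {complex_of_real lam}. cmod \<mu> < 1"
    using assms(1) by (auto simp: PV_unit_def)
  then obtain p where p: "p \<noteq> 0" "poly (map_poly of_int p) lam = 0"
    "\<And>g. poly (map_poly of_int g) lam = 0 \<Longrightarrow> p dvd g" "\<bar>lead_coeff p\<bar> = 1" "\<bar>coeff p 0\<bar> = 1"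
    using unit_minimal_poly[of lam] by (metis less_irrefl not_one_less_zero)
  obtain S where "S \<union> conj_embedding lam ` S = complex_embeddings lam"
     "S \<inter> conj_embedding lam ` S = {}" "bij_betw cd UNIV
       (Re_of ` (real_embeddings lam - {id_embedding lam}) \<union> Re_of ` S \<union> Im_of ` S)"
    using assms(2) unfolding minkowski_coordinates_def by blast
  with l p have "minkowski_embedding lam p cd S" by unfold_locales auto
  then show ?thesis using that by blast
qed


section \<open>Averages over the point sets and integrals over the windows\<close>

text \<open>Internal space is reduced to what the convergence proof uses: \<open>f\<close> stands
  for \<open>Q\<close>, \<open>st\<close> for the star map, and \<open>X\<close> is the seed,
  through which boundedness of the star images is reached by induction. The left eigenvector is made
  of the tile lengths.\<close>

locale window_ifs = inflation_points \<Lambda> T lam B len v n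
  for \<Lambda> :: "'a::finite \<Rightarrow> real set" and T lam B len v n +
  fixes f :: "'b::euclidean_space \<Rightarrow> 'b" and st :: "real \<Rightarrow> 'b" and W :: "'a \<Rightarrow> 'b set"
    and q :: real and X :: "'a \<Rightarrow> real set"
  assumes st_affine: "\<And>i j x t. x \<in> \<Lambda> j \<Longrightarrow> t \<in> T i j \<Longrightarrow> st (lam * x + t) = f (st x) + st t"
    and contraction: "\<And>x y. dist (f x) (f y) \<le> q * dist x y" "f 0 = 0" "0 < q" "q < 1"
    and f_inj: "inj f"
    and substitution: "\<And>h t. h \<in> borel_measurable borel \<Longrightarrow>
      integral\<^sup>L lborel (h :: 'b \<Rightarrow> real) = (1 / lam) * (\<integral>y. h (f y + t) \<partial>lborel)"
    and W_compact: "\<And>i. compact (W i)"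
    and W_eq: "\<And>i. W i = (\<Union>j. \<Union>t\<in>T i j. (\<lambda>y. f y + st t) ` W j)"
    and W_pos: "\<And>i. measure lborel (W i) > 0"
    and left_ev: "\<And>j. (\<Sum>i\<in>UNIV. len i * real (card (T i j))) = lam * len j"
    and seed: "\<And>i. finite (X i)" "\<And>i. \<Lambda> i = (\<Union>n. (inflate lam T ^^ n) X i)"
begin

lemma f_continuous: "continuous_on UNIV f"
proof (rule lipschitz_on_continuous_on)
  show "q-lipschitz_on UNIV f" using contraction by (intro lipschitz_onI) auto
qed

lemma W_sets[measurable]: "W i \<in> sets borel" using W_compact by (simp add: borel_compact)

definition vint :: "'a \<Rightarrow> ('b \<Rightarrow> real) \<Rightarrow> real" where
  "vint i g = (\<integral>y. indicator (W i) y * g y \<partial>lborel)"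

lemma vint_integrable:
  assumes "continuous_on UNIV g" "compact C"
  shows "integrable lborel (\<lambda>y. indicator C y * g y :: real)"
proof -
  have "set_integrable lborel C g"
    using borel_integrable_compact[of C g, OF assms(2)] continuous_on_subset[OF assms(1)]
    by (simp add: set_integrable_def)
  then show ?thesis by (simp add: set_integrable_def)
qed

lemma vint_1: "vint i (\<lambda>y. 1) = measure lborel (W i)"
  unfolding vint_def mult_1_right by (simp only: Bochner_Integration.integral_indicator space_lborel space_borel Int_UNIV_right)

lemma piece_compact: "compact ((\<lambda>y. f y + t) ` W j)"
proof (rule compact_continuous_image[OF _ W_compact])
  show "continuous_on (W j) (\<lambda>y. f y + t)"
    using continuous_on_subset[OF f_continuous subset_UNIV] by (intro continuous_on_add continuous_on_const)
qed

lemma piece_integral: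
  assumes g: "continuous_on UNIV g"
  shows "(\<integral>y. indicator ((\<lambda>y. f y + t) ` W j) y * g y \<partial>lborel) = (1 / lam) * vint j (\<lambda>y. g (f y + t))"
proof -
  have [measurable]: "g \<in> borel_measurable borel" using g by (rule borel_measurable_continuous_onI)
  have [measurable]: "(\<lambda>y. f y + t) ` W j \<in> sets borel" using piece_compact by (rule borel_compact)
  have "indicator ((\<lambda>y. f y + t) ` W j) (f y + t) = (indicator (W j) y :: real)" for y
    using f_inj by (auto simp: indicator_def inj_eq)
  then show ?thesis
    by (subst substitution[of _ t]) (simp_all add: vint_def)
qed

text \<open>The sum \<open>P i\<close> of the indicators of the pieces is at least the indicator of
  \<open>W i\<close>. Weighted with \<open>len\<close>, the integrals of the differences add up to
  0, because the eigenvalue \<open>lam\<close> cancels the volume factor \<open>1 / lam\<close>.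
  Being non-negative, every difference vanishes almost everywhere.\<close>

lemma W_overlap: "AE y in lborel. (\<Sum>j\<in>UNIV. \<Sum>t\<in>T i j. indicator ((\<lambda>y. f y + st t) ` W j) y) = (indicator (W i) y :: real)"
proof -
  define P where "P i y = (\<Sum>j\<in>UNIV. \<Sum>t\<in>T i j. indicator ((\<lambda>y. f y + st t) ` W j) y :: real)" for i y
  have int: "integrable lborel (P i)" for i
    unfolding P_def using vint_integrable[where g = "\<lambda>_. 1", OF continuous_on_const piece_compact]
    by (intro Bochner_Integration.integrable_sum) simp
  have int_eq: "integral\<^sup>L lborel (P i) = (1 / lam) * (\<Sum>j\<in>UNIV. real (card (T i j)) * measure lborel (W j))" for i
    unfolding P_def using vint_integrable[where g = "\<lambda>_. 1", OF continuous_on_const piece_compact]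
      piece_integral[where g = "\<lambda>_. 1", OF continuous_on_const] vint_1
    by (simp add: Bochner_Integration.integral_sum sum_distrib_left)
  have W_int: "integrable lborel (indicator (W i) :: _ \<Rightarrow> real)" for i
    using vint_integrable[where g = "\<lambda>_. 1", OF continuous_on_const W_compact] by simp
  have ge: "indicator (W i) y \<le> P i y" for i y
  proof (cases "y \<in> W i")
    case True
    then obtain j t where jt: "t \<in> T i j" "y \<in> (\<lambda>y. f y + st t) ` W j" using W_eq[of i] by blast
    have "1 \<le> (\<Sum>t\<in>T i j. indicator ((\<lambda>y. f y + st t) ` W j) y :: real)"
      using member_le_sum[of t "T i j" "\<lambda>t. indicator ((\<lambda>y. f y + st t) ` W j) y :: real"] jt T_finite by simp
    also have "\<dots> \<le> P i y" unfolding P_def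
      by (rule member_le_sum[of j UNIV "\<lambda>j. \<Sum>t\<in>T i j. indicator ((\<lambda>y. f y + st t) ` W j) y :: real"])
        (auto intro: sum_nonneg)
    finally show ?thesis by (simp add: True)
  qed (auto simp: P_def intro!: sum_nonneg)
  have le: "measure lborel (W i) \<le> integral\<^sup>L lborel (P i)" for i
    using integral_mono[OF W_int int ge] by simp
  have "(\<Sum>i\<in>UNIV. len i * integral\<^sup>L lborel (P i)) =
      (1 / lam) * (\<Sum>i\<in>UNIV. \<Sum>j\<in>UNIV. len i * real (card (T i j)) * measure lborel (W j))"
    by (simp add: int_eq sum_distrib_left mult_ac)
  also have "\<dots> = (1 / lam) * (\<Sum>j\<in>UNIV. (\<Sum>i\<in>UNIV. len i * real (card (T i j))) * measure lborel (W j))"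
    by (subst sum.swap) (simp add: sum_distrib_right)
  also have "\<dots> = (\<Sum>i\<in>UNIV. len i * measure lborel (W i))"
    unfolding left_ev using lam by (simp add: sum_distrib_left)
  finally have "(\<Sum>i\<in>UNIV. len i * (integral\<^sup>L lborel (P i) - measure lborel (W i))) = 0"
    by (simp add: right_diff_distrib sum_subtractf)
  then have "len i * (integral\<^sup>L lborel (P i) - measure lborel (W i)) = 0"
    using le len_pos by (subst (asm) sum_nonneg_eq_0_iff) (auto intro!: mult_nonneg_nonneg less_imp_le[OF len_pos])
  then have "integral\<^sup>L lborel (\<lambda>y. P i y - indicator (W i) y) = 0"
    using len_pos[of i] int W_int by (simp add: Bochner_Integration.integral_diff)
  then have "AE y in lborel. P i y - indicator (W i) y = 0"
    using ge by (subst (asm) integral_nonneg_eq_0_iff_AE) (auto intro: int W_int)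
  then show ?thesis by (simp add: P_def)
qed

lemma vint_ifs:
  assumes g: "continuous_on UNIV g"
  shows "vint i g = (1 / lam) * (\<Sum>j\<in>UNIV. \<Sum>t\<in>T i j. vint j (\<lambda>y. g (f y + st t)))"
proof -
  have [measurable]: "g \<in> borel_measurable borel" using g by (rule borel_measurable_continuous_onI)
  have [measurable]: "(\<lambda>y. f y + t) ` W j \<in> sets borel" for t j using piece_compact by (rule borel_compact)
  have "vint i g = (\<integral>y. (\<Sum>j\<in>UNIV. \<Sum>t\<in>T i j. indicator ((\<lambda>y. f y + st t) ` W j) y) * g y \<partial>lborel)"
    unfolding vint_def
  proof (rule integral_cong_AE)
    show "AE y in lborel. indicator (W i) y * g y =
        (\<Sum>j\<in>UNIV. \<Sum>t\<in>T i j. indicator ((\<lambda>y. f y + st t) ` W j) y) * g y"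
      using W_overlap[of i] by eventually_elim simp
  qed measurable
  also have "\<dots> = (\<Sum>j\<in>UNIV. \<Sum>t\<in>T i j. \<integral>y. indicator ((\<lambda>y. f y + st t) ` W j) y * g y \<partial>lborel)"
    unfolding sum_distrib_right using vint_integrable[OF g piece_compact]
    by (simp add: Bochner_Integration.integral_sum)
  finally show ?thesis by (simp add: piece_integral[OF g] sum_distrib_left)
qed

lemma bounding_radius:
  obtains R where "R > 0" "\<And>i. W i \<subseteq> cball 0 R" "\<And>i x. x \<in> \<Lambda> i \<Longrightarrow> st x \<in> cball 0 R"
    "\<And>i j t y. t \<in> T i j \<Longrightarrow> y \<in> cball 0 R \<Longrightarrow> f y + st t \<in> cball 0 R"
proof -
  \<comment> \<open>The vectors \<open>st t /\<^sub>R (1 - q)\<close> are included so that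
    \<open>norm (st t) \<le> (1 - q) * R\<close>; then \<open>q * R + (1 - q) * R = R\<close> makes
    the ball invariant.\<close>
  define A where "A = insert 0 ((\<Union>i. W i) \<union> (\<Union>i. st ` X i) \<union> (\<Union>i j. (\<lambda>t. st t /\<^sub>R (1 - q)) ` T i j))"
  have "bounded (\<Union>i. W i)" by (intro bounded_UN) (auto intro: compact_imp_bounded W_compact)
  moreover have "finite ((\<Union>i. st ` X i) \<union> (\<Union>i j. (\<lambda>t. st t /\<^sub>R (1 - q)) ` T i j))"
    using T_finite seed(1) by simp
  ultimately have "bounded A" unfolding A_def by (simp add: Un_assoc finite_imp_bounded)
  then obtain R where "R > 0" "\<forall>a\<in>A. norm a \<le> R" unfolding bounded_pos by blast
  then have R: "R > 0" "\<And>a. a \<in> A \<Longrightarrow> norm a \<le> R" by blast+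
  have tR: "norm (st t) \<le> (1 - q) * R" if "t \<in> T i j" for t i j
  proof -
    have "st t /\<^sub>R (1 - q) \<in> A" unfolding A_def by (intro insertI2 UnI2 UN_I[OF UNIV_I] imageI) (rule that)
    from R(2)[OF this] show ?thesis using contraction by (simp add: field_simps)
  qed
  have step: "f y + st t \<in> cball 0 R" if "t \<in> T i j" "y \<in> cball 0 R" for i j t y
  proof -
    have "norm (f y) \<le> q * norm y" using contraction(1)[of y 0] contraction(2) by simp
    also have "\<dots> \<le> q * R" using that contraction by (intro mult_left_mono) auto
    finally have "norm (f y + st t) \<le> q * R + (1 - q) * R"
      using norm_triangle_ineq[of "f y" "st t"] tR[OF that(1)] by linarith
    then show ?thesis by (simp add: algebra_simps)
  qed
  have pts: "\<forall>i. \<forall>x\<in>(inflate lam T ^^ m) X i. st x \<in> cball 0 R" for m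
  proof (induction m)
    case 0
    show ?case using R(2) by (auto simp: A_def)
  next
    case (Suc m)
    show ?case
    proof (intro allI ballI)
      fix i x assume "x \<in> (inflate lam T ^^ Suc m) X i"
      then obtain j y t where *: "x = lam * y + t" "y \<in> (inflate lam T ^^ m) X j" "t \<in> T i j"
        by (auto simp: inflate_def inflate_from_def)
      \<comment> \<open>The relation \<open>st_affine\<close> is assumed at points of the tiling
        only, and the iterates of the seed are such points.\<close>
      then have "y \<in> \<Lambda> j" using seed(2) by blast
      then show "st x \<in> cball 0 R" using * st_affine step Suc by metis
    qed
  qed
  show ?thesis
  proof (rule that[OF R(1)])
    show "W i \<subseteq> cball 0 R" for i
    proof
      fix y assume "y \<in> W i"
      then have "y \<in> A" unfolding A_def by (intro insertI2 UnI1 UN_I[OF UNIV_I])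
      then show "y \<in> cball 0 R" using R(2) by simp
    qed
    show "st x \<in> cball 0 R" if "x \<in> \<Lambda> i" for i x using that pts seed(2) by blast
  qed (rule step)
qed

section \<open>Proportionality of densities and window volumes\<close>

definition dns where "dns i = v i / (\<Sum>k\<in>UNIV. len k * v k)"

lemma dns_pos: "dns i > 0"
  unfolding dns_def using v_pos len_pos by (intro divide_pos_pos sum_pos) auto

lemma dns_ev: "(\<Sum>j\<in>UNIV. real (card (T i j)) * dns j) = lam * dns i"
  by (simp add: dns_def ev flip: sum_divide_distrib)

definition \<kappa> where "\<kappa> i = dns i / measure lborel (W i)"

text \<open>With the constant function 1, \<open>vint_ifs\<close> says that the volumes are an
  eigenvector for \<open>lam\<close>; the densities are a positive one.\<close>

lemma \<kappa>_const: "\<kappa> i = \<kappa> j"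
proof -
  have "(\<Sum>j\<in>UNIV. real (card (T i j)) * measure lborel (W j)) = lam * measure lborel (W i)" for i
    using vint_ifs[of "\<lambda>y. 1" i] lam by (simp add: vint_1 field_simps)
  moreover have "lam > 0" using lam by simp
  ultimately have "measure lborel (W i) / dns i = measure lborel (W j) / dns j"
    by (intro eigenvector_proportional[OF prim dns_pos _ dns_ev]) auto
  then show ?thesis using dns_pos[of i] dns_pos[of j] W_pos[of i] W_pos[of j]
    by (simp add: \<kappa>_def field_simps)
qed

section \<open>Averages compared with window integrals\<close>

definition avg where "avg i g r = (\<Sum>x\<in>\<Lambda> i \<inter> {-r..r}. g (st x)) / (2 * r)"

lemma avg_bound:
  assumes "\<And>x. x \<in> \<Lambda> i \<Longrightarrow> \<bar>g (st x)\<bar> \<le> e" "r > 0"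
  shows "\<bar>avg i g r\<bar> \<le> e * (N i r / (2 * r))"
proof -
  have "\<bar>\<Sum>x\<in>\<Lambda> i \<inter> {-r..r}. g (st x)\<bar> \<le> (\<Sum>x\<in>\<Lambda> i \<inter> {-r..r}. e)"
    by (intro order_trans[OF sum_abs] sum_mono assms) auto
  then have "\<bar>\<Sum>x\<in>\<Lambda> i \<inter> {-r..r}. g (st x)\<bar> / (2 * r) \<le> (\<Sum>x\<in>\<Lambda> i \<inter> {-r..r}. e) / (2 * r)"
    using assms(2) by (intro divide_right_mono) auto
  then show ?thesis using assms(2) by (simp add: avg_def mult.commute)
qed

lemma vint_bound:
  assumes g: "continuous_on UNIV g" and "\<And>y. y \<in> W i \<Longrightarrow> \<bar>g y\<bar> \<le> e"
  shows "\<bar>vint i g\<bar> \<le> e * measure lborel (W i)"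
proof -
  have W_int: "integrable lborel (\<lambda>y. indicator (W i) y * e)"
    using vint_integrable[OF continuous_on_const W_compact] .
  have "norm (vint i g) \<le> (\<integral>y. indicator (W i) y * e \<partial>lborel)"
    unfolding vint_def
    by (rule Bochner_Integration.integral_norm_bound_integral[OF vint_integrable[OF g W_compact] W_int])
      (use assms(2) in \<open>auto simp: indicator_def\<close>)
  then show ?thesis using vint_1[of i] by (simp add: vint_def mult.commute)
qed

text \<open>Subtracting the constant \<open>g 0\<close> leaves a function bounded by
  \<open>e\<close> on the ball. The constant itself has the same limit \<open>g 0 * dns i\<close> on
  both sides. The remainder counts once in the average and once in the integral, hence the factor
  2.\<close>

lemma defect_oscillation:
  assumes g: "continuous_on UNIV g" and R: "R > 0" "W i \<subseteq> cball 0 R" "\<And>x. x \<in> \<Lambda> i \<Longrightarrow> st x \<in> cball 0 R"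
    and osc: "\<And>x y. x \<in> cball 0 R \<Longrightarrow> y \<in> cball 0 R \<Longrightarrow> \<bar>g x - g y\<bar> \<le> e"
  shows "limsup_le (\<lambda>r. \<bar>avg i g r - \<kappa> i * vint i g\<bar>) (2 * dns i * e)"
proof -
  define h where "h y = g y - g 0" for y
  have h: "continuous_on UNIV h" unfolding h_def by (intro continuous_intros g)
  have he: "\<bar>h y\<bar> \<le> e" if "y \<in> cball 0 R" for y
    using osc[OF that, of 0] R(1) by (simp add: h_def)
  have dens: "((\<lambda>r. N i r / (2 * r)) \<longlongrightarrow> dns i) at_top" unfolding dns_def by (rule density)
  have avg_split: "avg i g r = g 0 * (N i r / (2 * r)) + avg i h r" for r
    by (simp add: avg_def h_def sum_subtractf diff_divide_distrib)
  have vint_split: "vint i g = g 0 * measure lborel (W i) + vint i h"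
  proof -
    have "vint i h = (\<integral>y. indicator (W i) y * g y - indicator (W i) y * g 0 \<partial>lborel)"
      by (simp add: vint_def h_def right_diff_distrib)
    also have "\<dots> = vint i g - g 0 * measure lborel (W i)"
      using vint_integrable[OF g W_compact] vint_integrable[OF continuous_on_const W_compact] vint_1[of i]
      by (subst Bochner_Integration.integral_diff) (auto simp: vint_def mult.commute)
    finally show ?thesis by simp
  qed
  have k1: "\<kappa> i * vint i g = g 0 * dns i + \<kappa> i * vint i h"
    using W_pos[of i] unfolding vint_split by (simp add: \<kappa>_def distrib_left)
  have k2: "\<bar>\<kappa> i * vint i h\<bar> \<le> \<kappa> i * (e * measure lborel (W i))"
  proof -
    have "\<bar>vint i h\<bar> \<le> e * measure lborel (W i)" by (rule vint_bound[OF h]) (use he R(2) in blast)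
    then show ?thesis unfolding abs_mult using dns_pos[of i] W_pos[of i]
      by (intro mult_mono) (auto simp: \<kappa>_def)
  qed
  have k3: "\<kappa> i * (e * measure lborel (W i)) = dns i * e"
    using W_pos[of i] by (simp add: \<kappa>_def)
  have lim: "\<forall>\<^sub>F r in at_top. \<bar>avg i g r - \<kappa> i * vint i g\<bar> \<le>
      \<bar>g 0 * (N i r / (2 * r)) - g 0 * dns i\<bar> + (e * (N i r / (2 * r)) + dns i * e)"
    using eventually_gt_at_top[of 0]
  proof eventually_elim
    case (elim r)
    then have "\<bar>avg i h r\<bar> \<le> e * (N i r / (2 * r))" using he R(3) by (intro avg_bound) auto
    then show ?case using k1 k2 k3 unfolding avg_split[of r] by linarith
  qed
  have "((\<lambda>r. \<bar>g 0 * (N i r / (2 * r)) - g 0 * dns i\<bar> + (e * (N i r / (2 * r)) + dns i * e)) \<longlongrightarrow>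
      \<bar>g 0 * dns i - g 0 * dns i\<bar> + (e * dns i + dns i * e)) at_top"
    by (intro tendsto_intros dens)
  then have "((\<lambda>r. \<bar>g 0 * (N i r / (2 * r)) - g 0 * dns i\<bar> + (e * (N i r / (2 * r)) + dns i * e)) \<longlongrightarrow>
      2 * dns i * e) at_top" by (simp add: mult_ac)
  then show ?thesis using lim by (intro limsup_le_mono[OF tendsto_limsup_le]) auto
qed

text \<open>Since \<open>st\<close> is affine along the inflation, evaluating \<open>g\<close> at an
  inflated point is evaluating \<open>g\<close> composed with a contraction at the original point.
  The factor \<open>1 / lam\<close> comes from normalising by the radius
  \<open>lam * r\<close>.\<close>

lemma avg_renormalisation:
  assumes b: "\<And>x. x \<in> \<Lambda> i \<Longrightarrow> \<bar>g (st x)\<bar> \<le> b" "b \<ge> 0" and "r > 0"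
  shows "\<bar>avg i g (lam * r) - (1 / lam) * (\<Sum>j\<in>UNIV. \<Sum>t\<in>T i j. avg j (\<lambda>y. g (f y + st t)) r)\<bar> \<le> K * b / (2 * lam) / r"
proof -
  define s where "s = (\<Sum>j\<in>UNIV. \<Sum>t\<in>T i j. \<Sum>y\<in>\<Lambda> j \<inter> {-r..r}. g (st (lam * y + t)))"
  have "(\<Sum>j\<in>UNIV. \<Sum>t\<in>T i j. avg j (\<lambda>y. g (f y + st t)) r) = s / (2 * r)"
    unfolding s_def avg_def sum_divide_distrib
    by (intro sum.cong refl) (auto simp: st_affine)
  then have "avg i g (lam * r) - (1 / lam) * (\<Sum>j\<in>UNIV. \<Sum>t\<in>T i j. avg j (\<lambda>y. g (f y + st t)) r)
      = ((\<Sum>x\<in>\<Lambda> i \<inter> {-(lam * r)..lam * r}. g (st x)) - s) / (2 * (lam * r))"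
    by (simp add: avg_def diff_divide_distrib)
  moreover have "\<bar>(\<Sum>x\<in>\<Lambda> i \<inter> {-(lam * r)..lam * r}. g (st x)) - s\<bar> / (2 * (lam * r)) \<le> K * b / (2 * (lam * r))"
    unfolding s_def using lam assms by (intro divide_right_mono renormalisation) auto
  ultimately show ?thesis using lam \<open>r > 0\<close> by (simp add: abs_mult mult.assoc)
qed

text \<open>Each inflation step contracts internal space by \<open>q\<close>, so a function whose
  oscillation is small on sets of diameter \<open>q ^ m * 2 * R\<close> has small oscillation on the whole ball
  after \<open>m\<close> steps.\<close>

lemma defect_bound:
  assumes R: "R > 0" "\<And>i. W i \<subseteq> cball 0 R" "\<And>i x. x \<in> \<Lambda> i \<Longrightarrow> st x \<in> cball 0 R"
    "\<And>i j t y. t \<in> T i j \<Longrightarrow> y \<in> cball 0 R \<Longrightarrow> f y + st t \<in> cball 0 R"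
    and g: "continuous_on UNIV g"
    and osc: "\<And>x y. x \<in> cball 0 R \<Longrightarrow> y \<in> cball 0 R \<Longrightarrow> dist x y \<le> q ^ m * (2 * R) \<Longrightarrow> \<bar>g x - g y\<bar> \<le> e"
  shows "limsup_le (\<lambda>r. \<bar>avg i g r - \<kappa> i * vint i g\<bar>) (2 * dns i * e)"
  using g osc
proof (induction m arbitrary: g i)
  case 0
  show ?case
  proof (rule defect_oscillation[OF 0(1) R(1,2,3)])
    fix x y :: 'b assume xy: "x \<in> cball 0 R" "y \<in> cball 0 R"
    then have "dist x y \<le> 2 * R" using dist_triangle[of x y 0] by (simp add: dist_commute)
    then show "\<bar>g x - g y\<bar> \<le> e" using 0(2) xy by simp
  qed
next
  case (Suc m)
  have cont: "continuous_on UNIV (\<lambda>y. g (f y + t))" for t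
    by (rule continuous_on_compose2[OF Suc.prems(1)]) (auto intro: continuous_on_add f_continuous)
  have IH: "limsup_le (\<lambda>r. \<bar>avg j (\<lambda>y. g (f y + st t)) r - \<kappa> j * vint j (\<lambda>y. g (f y + st t))\<bar>) (2 * dns j * e)"
    if t: "t \<in> T i j" for t j
  proof (rule Suc.IH[OF cont])
    fix x y :: 'b assume xy: "x \<in> cball 0 R" "y \<in> cball 0 R" "dist x y \<le> q ^ m * (2 * R)"
    have "dist (f x + st t) (f y + st t) \<le> q * dist x y" using contraction(1) by simp
    also have "\<dots> \<le> q * (q ^ m * (2 * R))" using xy contraction by (intro mult_left_mono) auto
    finally show "\<bar>g (f x + st t) - g (f y + st t)\<bar> \<le> e"
      using Suc.prems(2) R(4)[OF t] xy by (simp add: mult.assoc)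
  qed
  \<comment> \<open>Continuity bounds \<open>g\<close> on the ball with all star images, which
    controls the boundary error of the recursion.\<close>
  have "compact (g ` cball 0 R)"
    by (intro compact_continuous_image continuous_on_subset[OF Suc.prems(1)]) auto
  then obtain b where b: "b > 0" "\<And>y. y \<in> cball 0 R \<Longrightarrow> \<bar>g y\<bar> \<le> b"
    using compact_imp_bounded bounded_pos by (metis imageI real_norm_def)
  have ev_le: "\<forall>\<^sub>F r in at_top. \<bar>avg i g (lam * r) - \<kappa> i * vint i g\<bar> \<le>
     (1 / lam) * (\<Sum>j\<in>UNIV. \<Sum>t\<in>T i j. \<bar>avg j (\<lambda>y. g (f y + st t)) r - \<kappa> j * vint j (\<lambda>y. g (f y + st t))\<bar>)
       + K * b / (2 * lam) / r"
    using eventually_gt_at_top[of 0]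
  proof eventually_elim
    case (elim r)
    have "\<kappa> i * vint i g = (1 / lam) * (\<Sum>j\<in>UNIV. \<Sum>t\<in>T i j. \<kappa> j * vint j (\<lambda>y. g (f y + st t)))"
    proof -
      have "(\<Sum>j\<in>UNIV. \<Sum>t\<in>T i j. \<kappa> j * vint j (\<lambda>y. g (f y + st t))) =
          (\<Sum>j\<in>UNIV. \<Sum>t\<in>T i j. \<kappa> i * vint j (\<lambda>y. g (f y + st t)))"
        by (intro sum.cong refl arg_cong2[where f = "(*)"] \<kappa>_const)
      then show ?thesis by (simp add: vint_ifs[OF Suc.prems(1), of i] sum_distrib_left mult.left_commute)
    qed
    then have eq: "(1 / lam) * (\<Sum>j\<in>UNIV. \<Sum>t\<in>T i j. avg j (\<lambda>y. g (f y + st t)) r) - \<kappa> i * vint i g =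
       (1 / lam) * (\<Sum>j\<in>UNIV. \<Sum>t\<in>T i j. avg j (\<lambda>y. g (f y + st t)) r - \<kappa> j * vint j (\<lambda>y. g (f y + st t)))"
      by (simp add: sum_subtractf diff_divide_distrib)
    have "\<bar>(1 / lam) * (\<Sum>j\<in>UNIV. \<Sum>t\<in>T i j. avg j (\<lambda>y. g (f y + st t)) r) - \<kappa> i * vint i g\<bar> \<le>
       (1 / lam) * (\<Sum>j\<in>UNIV. \<Sum>t\<in>T i j. \<bar>avg j (\<lambda>y. g (f y + st t)) r - \<kappa> j * vint j (\<lambda>y. g (f y + st t))\<bar>)"
      unfolding eq abs_mult using lam
      by (intro mult_mono order_trans[OF sum_abs] sum_mono order_trans[OF sum_abs]) auto
    moreover have "\<bar>avg i g (lam * r) - (1 / lam) * (\<Sum>j\<in>UNIV. \<Sum>t\<in>T i j. avg j (\<lambda>y. g (f y + st t)) r)\<bar> \<le> K * b / (2 * lam) / r"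
      using b R(3) elim by (intro avg_renormalisation) auto
    ultimately show ?case by linarith
  qed
  have "limsup_le (\<lambda>r. (1 / lam) * (\<Sum>j\<in>UNIV. \<Sum>t\<in>T i j. \<bar>avg j (\<lambda>y. g (f y + st t)) r - \<kappa> j * vint j (\<lambda>y. g (f y + st t))\<bar>)
       + K * b / (2 * lam) / r) ((1 / lam) * (\<Sum>j\<in>UNIV. \<Sum>t\<in>T i j. 2 * dns j * e) + 0)"
    using lam by (intro limsup_le_add limsup_le_cmult limsup_le_sum IH tendsto_limsup_le const_over_tendsto_0) auto
  \<comment> \<open>The bound reproduces itself: the eigenvector equation of the densities cancels
    \<open>1 / lam\<close>, so the constant does not grow with \<open>m\<close>.\<close>
  moreover have "(1 / lam) * (\<Sum>j\<in>UNIV. \<Sum>t\<in>T i j. 2 * dns j * e) + 0 = 2 * dns i * e"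
  proof -
    have "(\<Sum>j\<in>UNIV. \<Sum>t\<in>T i j. 2 * dns j * e) = 2 * e * (\<Sum>j\<in>UNIV. real (card (T i j)) * dns j)"
      unfolding sum_distrib_left by (simp add: mult_ac)
    then show ?thesis using lam by (simp add: dns_ev)
  qed
  ultimately have "limsup_le (\<lambda>r. \<bar>avg i g (lam * r) - \<kappa> i * vint i g\<bar>) (2 * dns i * e)"
    using ev_le by (auto intro: limsup_le_mono)
  then show ?case by (rule limsup_le_rescale) (use lam in simp)
qed

text \<open>On the compact ball \<open>g\<close> is uniformly continuous, so for large
  \<open>m\<close> the diameter \<open>q ^ m * (2 * R)\<close> is small enough for any prescribed
  oscillation, while the factor \<open>2 * dns i\<close> does not depend on
  \<open>m\<close>.\<close>

lemma avg_tendsto: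
  assumes g: "continuous_on UNIV g"
  shows "(avg i g \<longlongrightarrow> dns i / measure lborel (W i) * vint i g) at_top"
proof -
  obtain R where R: "R > 0" "\<And>i. W i \<subseteq> cball 0 R" "\<And>i x. x \<in> \<Lambda> i \<Longrightarrow> st x \<in> cball 0 R"
    "\<And>i j t y. t \<in> T i j \<Longrightarrow> y \<in> cball 0 R \<Longrightarrow> f y + st t \<in> cball 0 R"
    by (rule bounding_radius) (rule that, assumption+)
  have "((\<lambda>r. avg i g r - \<kappa> i * vint i g) \<longlongrightarrow> 0) at_top"
  proof (rule limsup_le_tendsto_0)
    fix e :: real assume "e > 0"
    define e' where "e' = e / (2 * dns i)"
    have e': "e' > 0" "2 * dns i * e' = e" using \<open>e > 0\<close> dns_pos[of i] by (auto simp: e'_def)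
    have "uniformly_continuous_on (cball 0 R) g"
      by (intro compact_uniformly_continuous continuous_on_subset[OF g]) auto
    then obtain d where d: "d > 0"
      "\<And>x y. x \<in> cball 0 R \<Longrightarrow> y \<in> cball 0 R \<Longrightarrow> dist x y < d \<Longrightarrow> dist (g x) (g y) < e'"
      using e'(1) unfolding uniformly_continuous_on_def by metis
    have "(\<lambda>m. q ^ m * (2 * R)) \<longlonglongrightarrow> 0"
      using contraction by (intro tendsto_mult_left_zero LIMSEQ_realpow_zero) auto
    then have "\<forall>\<^sub>F m in sequentially. q ^ m * (2 * R) < d" using d(1) by (rule order_tendstoD)
    then obtain m where m: "q ^ m * (2 * R) < d" by (auto simp: eventually_sequentially)
    have "limsup_le (\<lambda>r. \<bar>avg i g r - \<kappa> i * vint i g\<bar>) (2 * dns i * e')"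
    proof (rule defect_bound[OF R g])
      fix x y :: 'b assume "x \<in> cball 0 R" "y \<in> cball 0 R" "dist x y \<le> q ^ m * (2 * R)"
      then show "\<bar>g x - g y\<bar> \<le> e'" using d(2)[of x y] m by (auto simp: dist_real_def)
    qed
    then show "limsup_le (\<lambda>r. \<bar>avg i g r - \<kappa> i * vint i g\<bar>) e" using e'(2) by simp
  qed
  then show ?thesis by (simp add: LIM_zero_cancel \<kappa>_def)
qed

end

context window_ifs
begin

lemma avg_sequence:
  assumes "continuous_on UNIV g"
  shows "(\<lambda>n. (\<Sum>x | x \<in> \<Lambda> i \<and> \<bar>x\<bar> \<le> real n. g (st x)) / (2 * real n)) \<longlonglongrightarrow>
    dns i / measure lborel (W i) * vint i g"
proof -
  have "(\<lambda>n. avg i g (real n)) \<longlonglongrightarrow> dns i / measure lborel (W i) * vint i g"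
    by (rule filterlim_compose[OF avg_tendsto[OF assms] filterlim_real_sequentially])
  moreover have "{x. x \<in> \<Lambda> i \<and> \<bar>x\<bar> \<le> r} = \<Lambda> i \<inter> {-r..r}" for r by auto
  ultimately show ?thesis by (simp add: avg_def)
qed

lemma points_finite: "finite {x. x \<in> \<Lambda> i \<and> \<bar>x\<bar> \<le> r}"
  by (rule finite_subset[OF _ card_interval(1)[of i "-r" r]]) auto

lemma normalised_avg:
  assumes "continuous_on UNIV g"
  shows "(\<lambda>n. (\<Sum>x | x \<in> \<Lambda> i \<and> \<bar>x\<bar> \<le> real n. g (st x)) / real (card {x. x \<in> \<Lambda> i \<and> \<bar>x\<bar> \<le> real n})) \<longlonglongrightarrow>
    1 / measure lborel (W i) * vint i g"
proof -
  let ?X = "\<lambda>n. {x. x \<in> \<Lambda> i \<and> \<bar>x\<bar> \<le> real n}"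
  have "(\<lambda>n. real (card (?X n)) / (2 * real n)) \<longlonglongrightarrow> dns i"
    using avg_sequence[of "\<lambda>y. 1" i] W_pos[of i] by (simp add: vint_1)
  then have "(\<lambda>n. ((\<Sum>x\<in>?X n. g (st x)) / (2 * real n)) / (real (card (?X n)) / (2 * real n))) \<longlonglongrightarrow>
      dns i / measure lborel (W i) * vint i g / dns i"
    using avg_sequence[OF assms] dns_pos[of i] by (intro tendsto_divide) auto
  moreover have "\<forall>\<^sub>F n in sequentially. ((\<Sum>x\<in>?X n. g (st x)) / (2 * real n)) / (real (card (?X n)) / (2 * real n)) =
      (\<Sum>x\<in>?X n. g (st x)) / real (card (?X n))"
    using eventually_gt_at_top[of 0] by eventually_elim simp
  ultimately have "(\<lambda>n. (\<Sum>x\<in>?X n. g (st x)) / real (card (?X n))) \<longlonglongrightarrow>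
      dns i / measure lborel (W i) * vint i g / dns i" by (rule Lim_transform_eventually)
  then show ?thesis using dns_pos[of i] by simp
qed

end


section \<open>Weak convergence\<close>

lemma density_const_integral:
  fixes f :: "'b::euclidean_space \<Rightarrow> real"
  assumes "c \<ge> 0" "K \<in> sets borel" "continuous_on UNIV f"
  shows "integral\<^sup>L (density lborel (\<lambda>y. ennreal (c * indicator K y))) f = c * (\<integral>y. indicator K y * f y \<partial>lborel)"
proof -
  have [measurable]: "f \<in> borel_measurable borel" "K \<in> sets borel"
    using assms by (auto intro: borel_measurable_continuous_onI)
  show ?thesis using assms(1) by (subst integral_density) (auto simp: mult.assoc)
qed

text \<open>The distance to a closed set is positive off the set. The empty set is excluded because
  \<open>infdist x {}\<close> is 0 by convention and the limit would be 1.\<close>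

lemma closed_indicator_limit:
  assumes "closed C" "C \<noteq> {}"
  shows "(\<lambda>n. max 0 (1 - real n * infdist x C)) \<longlonglongrightarrow> indicator C x"
proof (cases "x \<in> C")
  case True
  then show ?thesis by simp
next
  case False
  then have d: "infdist x C > 0"
    using assms in_closed_iff_infdist_zero infdist_nonneg[of x C] by (metis less_eq_real_def)
  then obtain m :: nat where m: "1 < real m * infdist x C" using reals_Archimedean3 by blast
  have "max 0 (1 - real n * infdist x C) = 0" if "n \<ge> m" for n
  proof -
    have "real m * infdist x C \<le> real n * infdist x C" using that d by (intro mult_right_mono) auto
    then show ?thesis using m by simp
  qed
  then have "\<forall>\<^sub>F n in sequentially. max 0 (1 - real n * infdist x C) = indicator C x"
    using False by (auto simp: eventually_sequentially)
  then show ?thesis by (rule tendsto_eventually)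
qed

text \<open>Closed sets generate the Borel sets and are stable under intersection, and their
  measures are limits of integrals of bounded continuous functions; both measures are finite by the
  definition of weak convergence.\<close>

lemma weak_limit_unique:
  assumes "weakly_converges M \<mu>" "weakly_converges M \<nu>"
  shows "\<mu> = (\<nu> :: 'b::euclidean_space measure)"
proof -
  have eq: "integral\<^sup>L \<mu> f = integral\<^sup>L \<nu> f" if "continuous_on UNIV f" "bounded (range f)" for f :: "'b \<Rightarrow> real"
    using assms that unfolding weakly_converges_def by (meson LIMSEQ_unique)
  have sets: "sets \<mu> = sets borel" "sets \<nu> = sets borel" and fin: "finite_measure \<mu>" "finite_measure \<nu>"
    using assms by (auto simp: weakly_converges_def)
  have lim: "(\<lambda>n. integral\<^sup>L \<rho> (\<lambda>x. max 0 (1 - real n * infdist x C))) \<longlonglongrightarrow> measure \<rho> C"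
    if \<rho>: "sets \<rho> = sets borel" "finite_measure \<rho>" and C: "closed C" "C \<noteq> {}" for \<rho> :: "'b measure" and C
  proof -
    interpret finite_measure \<rho> by fact
    have [measurable]: "(\<lambda>x. max 0 (1 - real n * infdist x C)) \<in> borel_measurable \<rho>" for n
      unfolding measurable_cong_sets[OF \<rho>(1) refl]
      by (intro borel_measurable_continuous_onI continuous_intros)
    have [measurable]: "C \<in> sets \<rho>" using C \<rho> by simp
    have "(\<lambda>n. integral\<^sup>L \<rho> (\<lambda>x. max 0 (1 - real n * infdist x C))) \<longlonglongrightarrow> integral\<^sup>L \<rho> (indicator C)"
    proof (rule integral_dominated_convergence[where w = "\<lambda>x. 1"])
      show "AE x in \<rho>. (\<lambda>n. max 0 (1 - real n * infdist x C)) \<longlonglongrightarrow> indicator C x"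
        using closed_indicator_limit[OF C] by simp
    qed (auto simp: infdist_nonneg)
    then show ?thesis by (simp add: Int_absorb2 sets.sets_into_space)
  qed
  have closed_eq: "emeasure \<mu> C = emeasure \<nu> C" if C: "closed C" for C
  proof (cases "C = {}")
    case False
    have "continuous_on UNIV (\<lambda>x. max 0 (1 - real n * infdist x C))" for n
      by (intro continuous_intros)
    moreover have "bounded (range (\<lambda>x. max 0 (1 - real n * infdist x C)))" for n
      by (rule boundedI[of _ 1]) (auto simp: infdist_nonneg)
    ultimately have "integral\<^sup>L \<mu> (\<lambda>x. max 0 (1 - real n * infdist x C)) =
        integral\<^sup>L \<nu> (\<lambda>x. max 0 (1 - real n * infdist x C))" for n
      using eq by blast
    then have "measure \<mu> C = measure \<nu> C"
      using lim[OF sets(1) fin(1) C False] lim[OF sets(2) fin(2) C False] LIMSEQ_unique by force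
    then show ?thesis using fin by (simp add: finite_measure.emeasure_eq_measure)
  qed simp
  show ?thesis
  proof (rule measure_eqI_generator_eq[where E = "Collect closed" and \<Omega> = UNIV and A = "\<lambda>_. UNIV"])
    show "Int_stable (Collect closed)" by (auto simp: Int_stable_def)
    show "sets \<mu> = sigma_sets UNIV (Collect closed)" "sets \<nu> = sigma_sets UNIV (Collect closed)"
      using sets by (simp_all add: borel_eq_closed)
    show "emeasure \<mu> UNIV \<noteq> \<infinity>"
      using finite_measure.emeasure_finite[OF fin(1)] by (simp add: infinity_ennreal_def)
  qed (use closed_eq in auto)
qed

lemma point_measures_integral:
  assumes "finite {x \<in> X. \<bar>x\<bar> \<le> real n}" "continuous_on UNIV (g :: real ^ 'm::finite \<Rightarrow> real)"
  shows "integral\<^sup>L (point_measures cd X n) g = (\<Sum>x | x \<in> X \<and> \<bar>x\<bar> \<le> real n. g (star cd x)) / (2 * real n)"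
proof -
  let ?D = "distr (count_space {x \<in> X. \<bar>x\<bar> \<le> real n}) borel (star cd)"
  have [measurable]: "g \<in> borel_measurable borel" using assms(2) by (rule borel_measurable_continuous_onI)
  \<comment> \<open>A scaled measure is a density with constant weight. For \<open>n = 0\<close>
    both sides of the claim are 0, since division by 0 yields 0.\<close>
  have "point_measures cd X n = density ?D (\<lambda>_. ennreal (1 / (2 * real n)))"
    unfolding point_measures_def by (rule measure_eqI) (auto simp: emeasure_density_const)
  then have "integral\<^sup>L (point_measures cd X n) g = (\<integral>y. (1 / (2 * real n)) *\<^sub>R g y \<partial>?D)"
    by (simp only:) (subst integral_density, auto)
  also have "\<dots> = (1 / (2 * real n)) * integral\<^sup>L ?D g" by simp
  also have "integral\<^sup>L ?D g = (\<Sum>x | x \<in> X \<and> \<bar>x\<bar> \<le> real n. g (star cd x))"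
    using assms(1) by (subst integral_distr) (auto simp: lebesgue_integral_count_space_finite)
  finally show ?thesis by simp
qed

lemma uniform_count_integral:
  assumes "finite A" "continuous_on UNIV (g :: 'b::euclidean_space \<Rightarrow> real)"
  shows "integral\<^sup>L (distr (uniform_count_measure A) borel (\<lambda>y. y)) g = sum g A / card A"
proof -
  have [measurable]: "g \<in> borel_measurable borel" using assms(2) by (rule borel_measurable_continuous_onI)
  have "(\<lambda>y. y) \<in> measurable (uniform_count_measure A) borel"
    by (auto simp: measurable_def space_uniform_count_measure sets_uniform_count_measure)
  then show ?thesis using assms(1) by (subst integral_distr) (auto simp: integral_uniform_count_measure)
qed

lemma density_finite_measure:
  assumes "c \<ge> 0" "compact (K :: 'b::euclidean_space set)"
  shows "finite_measure (density lborel (\<lambda>y. ennreal (c * indicator K y)))"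
proof (rule finite_measureI)
  have [measurable]: "K \<in> sets borel" using assms(2) by (rule borel_compact)
  have "emeasure (density lborel (\<lambda>y. ennreal (c * indicator K y))) UNIV = (\<integral>\<^sup>+y. ennreal c * indicator K y \<partial>lborel)"
    by (subst emeasure_density) (auto intro!: nn_integral_cong simp: indicator_def)
  also have "\<dots> = ennreal c * emeasure lborel K" by (simp add: nn_integral_cmult)
  also have "\<dots> < \<infinity>"
    using emeasure_bounded_finite[OF compact_imp_bounded[OF assms(2)]] by (simp add: ennreal_mult_less_top)
  finally show "emeasure (density lborel (\<lambda>y. ennreal (c * indicator K y)))
      (space (density lborel (\<lambda>y. ennreal (c * indicator K y)))) \<noteq> \<infinity>" by simp
qed

lemma uniform_measure_density:
  assumes "compact (K :: 'b::euclidean_space set)" "measure lborel K > 0"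
  shows "uniform_measure lborel K = density lborel (\<lambda>y. ennreal (1 / measure lborel K * indicator K y))"
proof -
  have "emeasure lborel K = ennreal (measure lborel K)"
    using emeasure_bounded_finite[OF compact_imp_bounded[OF assms(1)]]
    by (intro emeasure_eq_ennreal_measure) auto
  then have "indicator K y / emeasure lborel K = ennreal (1 / measure lborel K * indicator K y)" for y
    using assms(2) by (simp add: indicator_def divide_ennreal flip: ennreal_1)
  then show ?thesis unfolding uniform_measure_def by simp
qed


section \<open>Counting letters and tiles\<close>

lemma count_list_subst_word:
  "real (count_list (subst_word \<rho> w) i) = (\<Sum>k\<in>(UNIV :: 'a::finite set). real (count_list (\<rho> k) i) * real (count_list w k))"
proof (induction w)
  case Nil
  then show ?case by (simp add: subst_word_def)
next
  case (Cons a w)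
  have "(\<Sum>k\<in>UNIV. real (count_list (\<rho> k) i) * real (count_list (a # w) k)) =
      (\<Sum>k\<in>UNIV. (if k = a then real (count_list (\<rho> k) i) else 0) + real (count_list (\<rho> k) i) * real (count_list w k))"
    by (intro sum.cong) (auto simp: algebra_simps)
  also have "\<dots> = real (count_list (\<rho> a) i) + real (count_list (subst_word \<rho> w) i)"
    by (simp add: sum.distrib Cons)
  finally show ?case by (simp add: subst_word_def)
qed

text \<open>Turns primitivity, which is stated through the letters of iterated words, into
  positivity of a matrix power.\<close>

lemma iterated_count_list:
  "iterated (\<lambda>i j. real (count_list (\<rho> j) i)) n i j = real (count_list ((subst_word \<rho> ^^ n) [j]) i)"
  by (induction n arbitrary: i) (simp_all add: count_list_subst_word)

text \<open>Positive lengths make the partial sums strictly increasing, so different occurrences of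
  a letter have different positions.\<close>

lemma tile_positions_card:
  assumes "\<And>i. len i > 0"
  shows "finite (tile_positions \<rho> len i j)" "card (tile_positions \<rho> len i j) = count_list (\<rho> j) i"
proof -
  define p where "p k = (\<Sum>m<k. len (\<rho> j ! m))" for k
  have "strict_mono p" using assms by (intro strict_monoI_Suc) (simp add: p_def)
  then have inj: "inj_on p K" for K by (meson inj_on_subset strict_mono_imp_inj_on subset_UNIV)
  have eq: "tile_positions \<rho> len i j = p ` {k. k < length (\<rho> j) \<and> \<rho> j ! k = i}"
    by (auto simp: tile_positions_def p_def)
  then show "finite (tile_positions \<rho> len i j)" by simp
  show "card (tile_positions \<rho> len i j) = count_list (\<rho> j) i"
    unfolding eq card_image[OF inj] count_list_eq_length_filter
    by (simp add: length_filter_conv_card eq_commute)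
qed

lemma sum_len_count_list:
  "(\<Sum>m<length w. len (w ! m)) = (\<Sum>i\<in>(UNIV :: 'a::finite set). len i * real (count_list w i))"
proof (induction w)
  case (Cons a w)
  have "(\<Sum>i\<in>UNIV. len i * real (count_list (a # w) i)) =
      (\<Sum>i\<in>UNIV. (if i = a then len i else 0) + len i * real (count_list w i))"
    by (intro sum.cong) (auto simp: algebra_simps)
  then show ?case using Cons unfolding length_Cons sum.lessThan_Suc_shift by (simp add: sum.distrib)
qed simp

lemma tile_positions_bounds:
  assumes "\<And>i. len i > 0" "t \<in> tile_positions \<rho> len i j"
  shows "0 \<le> t" "t < (\<Sum>m<length (\<rho> j). len (\<rho> j ! m))"
proof -
  obtain k where k: "t = (\<Sum>m<k. len (\<rho> j ! m))" "k < length (\<rho> j)"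
    using assms(2) by (auto simp: tile_positions_def)
  show "0 \<le> t" unfolding k by (intro sum_nonneg less_imp_le assms(1))
  show "t < (\<Sum>m<length (\<rho> j). len (\<rho> j ! m))"
    unfolding k(1) by (rule sum_strict_mono2[of _ _ k]) (use k(2) assms(1) in \<open>auto intro: less_imp_le\<close>)
qed


theorem theorem5p4:
  fixes \<rho> :: "'a::finite \<Rightarrow> 'a list" and lam c :: real and u v :: "real ^ 'a"
    and len :: "'a \<Rightarrow> real" and T :: "'a \<Rightarrow> 'a \<Rightarrow> real set"
    and w :: "int \<Rightarrow> 'a" and \<Lambda> :: "'a \<Rightarrow> real set" and a b :: 'a
    and cd :: "'m::finite \<Rightarrow> coordinate" and W :: "'a \<Rightarrow> (real ^ 'm) set"
  assumes primitive: "primitive_subst \<rho>"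
    and PF: "PF_eigenvalue \<rho> lam"
    and PV: "PV_unit lam"
    and right_eigenvector: "subst_matrix \<rho> *v v = lam *\<^sub>R v" "\<forall>i. v $ i > 0" "(\<Sum>i\<in>UNIV. v $ i) = 1"
    and left_eigenvector: "u v* subst_matrix \<rho> = lam *\<^sub>R u" "\<forall>i. u $ i > 0" "(\<Sum>i\<in>UNIV. u $ i * v $ i) = 1"
    and lengths: "c > 0" "len = (\<lambda>i. c * u $ i)"
    and positions: "T = tile_positions \<rho> len"
    and points: "\<Lambda> = control_points len w"
    and module: "(\<Union>i. \<Lambda> i) \<subseteq> int_ring lam"
      "\<forall>G. invariant_submodule lam G \<and> G \<subseteq> int_ring lam \<and> (\<Union>i. \<Lambda> i) \<subseteq> G \<longrightarrow> G = int_ring lam"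
    and legal_patches: "\<forall>k n. legal \<rho> (map (\<lambda>m. w (k + int m)) [0..<n])"
    and iteration: "legal \<rho> [a, b]" "\<forall>i. \<Lambda> i = (\<Union>n. (inflate lam T ^^ n) (seed_pair len a b) i)"
    and fixed_point: "\<forall>i. \<Lambda> i = inflate lam T \<Lambda> i" "\<forall>i. disjoint_family (inflate_from lam T \<Lambda> i)"
    and coordinates: "minkowski_coordinates lam cd"
    and windows: "window_system lam cd T W" "\<forall>i. measure lborel (W i) > 0"
  shows "\<forall>i.
      ((\<lambda>r :: real. real (card (\<Lambda> i \<inter> {-r..r})) / (2 * r)) \<longlongrightarrow> dens (\<Lambda> i)) at_top \<and>
      (\<forall>\<mu>. induces_measure cd (\<Lambda> i) \<mu> \<longleftrightarrow>
         \<mu> = density lborel (\<lambda>y. ennreal (dens (\<Lambda> i) / measure lborel (W i) * indicator (W i) y))) \<and>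
      star_uniformly_distributed cd (\<Lambda> i) (W i)"
proof -
  have len_pos: "len i > 0" for i using lengths left_eigenvector(2) by simp
  have lam_pos: "lam > 1" using PV by (simp add: PV_unit_def)
  obtain p S where "minkowski_embedding lam p cd S" using pisot_minkowski_embedding[OF PV coordinates] .
  then interpret mink: minkowski_embedding lam p cd S .
  have card_T: "card (T i j) = count_list (\<rho> j) i" and fin_T: "finite (T i j)" for i j
    using tile_positions_card[where len = len and \<rho> = \<rho>] len_pos positions by auto
  have right: "(\<Sum>j\<in>UNIV. real (card (T i j)) * v $ j) = lam * v $ i" for i
    using arg_cong[OF right_eigenvector(1), of "\<lambda>z. z $ i"]
    by (simp add: matrix_vector_mult_def subst_matrix_def card_T)
  have left: "(\<Sum>i\<in>UNIV. len i * real (card (T i j))) = lam * len j" for j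
  proof -
    have "(\<Sum>i\<in>UNIV. u $ i * real (card (T i j))) = lam * u $ j"
      using arg_cong[OF left_eigenvector(1), of "\<lambda>z. z $ j"]
      by (simp add: vector_matrix_mult_def subst_matrix_def card_T mult.commute)
    then have "c * (\<Sum>i\<in>UNIV. u $ i * real (card (T i j))) = c * (lam * u $ j)" by simp
    then show ?thesis unfolding sum_distrib_left lengths(2) by (simp add: mult_ac)
  qed
  obtain n where prim: "\<And>i j. i \<in> set ((subst_word \<rho> ^^ n) [j])"
    using primitive by (auto simp: primitive_subst_def)
  have inflation: "inflation_points \<Lambda> T lam (Max (range len)) len (($) v) n"
  proof
    show "x + len i \<le> y" if "x \<in> \<Lambda> i" "y \<in> \<Lambda> j" "x < y" for x y i j
      using that control_points_gap[of len x w i y j] len_pos points by simp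
    show "0 \<le> t \<and> t < lam * len j" if "t \<in> T i j" for i j t
    proof -
      \<comment> \<open>The left eigenvector equation: the tiles of a supertile have total length
        \<open>lam * len j\<close>.\<close>
      have "lam * len j = (\<Sum>m<length (\<rho> j). len (\<rho> j ! m))"
        unfolding sum_len_count_list left[symmetric] card_T ..
      then show ?thesis using tile_positions_bounds[of len t \<rho> i j] len_pos that positions by simp
    qed
    show "\<Lambda> i = (\<Union>j. inflate_from lam T \<Lambda> i j)" for i
      using fixed_point(1) unfolding inflate_def ..
    show "\<bar>(\<Sum>i\<in>UNIV. len i * real (card (\<Lambda> i \<inter> {- r..r}))) - 2 * r\<bar> \<le> Max (range len)" if "r \<ge> 0" for r
      unfolding points by (rule tiling_length_sum) (use len_pos that in auto)
    show "0 < iterated (\<lambda>i j. real (card (T i j))) n i j" for i j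
      using prim[of i j] unfolding card_T iterated_count_list
      by (metis count_list_0_iff gr0I of_nat_0_less_iff)
  qed (use lam_pos len_pos right_eigenvector(2) fin_T fixed_point(2) right in auto)
  then interpret pts: inflation_points \<Lambda> T lam "Max (range len)" len "($) v" n .
  have pts_nf: "x \<in> number_field lam" if "x \<in> \<Lambda> i" for x i
    using that module(1) mink.nf_int_ring by blast
  \<comment> \<open>An offset is a control point minus \<open>lam\<close> times another one. A point
    of type \<open>j\<close> exists since the density of that type is positive.\<close>
  have T_nf: "t \<in> number_field lam" if "t \<in> T i j" for t i j
  proof -
    have "\<Lambda> j \<noteq> {}"
    proof
      assume "\<Lambda> j = {}"
      then have "((\<lambda>r::real. 0::real) \<longlongrightarrow> v $ j / (\<Sum>k\<in>UNIV. len k * v $ k)) at_top"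
        using pts.density[of j] by simp
      then have "v $ j / (\<Sum>k\<in>UNIV. len k * v $ k) = 0" by (simp add: tendsto_const_iff)
      moreover have "(\<Sum>k\<in>UNIV. len k * v $ k) > 0" using len_pos right_eigenvector(2) by (intro sum_pos) auto
      ultimately show False using right_eigenvector(2) by (metis divide_eq_0_iff less_irrefl)
    qed
    then obtain x where x: "x \<in> \<Lambda> j" by blast
    then have "lam * x + t \<in> inflate lam T \<Lambda> i"
      using that by (auto simp: inflate_def inflate_from_def)
    then have "lam * x + t \<in> \<Lambda> i" using fixed_point(1) by metis
    then have "(lam * x + t) + - (lam * x) \<in> number_field lam"
      using x by (intro mink.nf_closed mink.nf_uminus mink.nf_basic pts_nf)
    then show ?thesis by simp
  qed
  obtain q where q: "0 < q" "q < 1" "\<And>y. norm (Q_matrix lam cd *v y) \<le> q * norm y"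
    by (rule mink.Q_contraction) (rule that, assumption+)
  have "window_ifs \<Lambda> T lam (Max (range len)) len (($) v) n ((*v) (Q_matrix lam cd)) (star cd) W q (seed_pair len a b)"
  proof (intro window_ifs.intro window_ifs_axioms.intro inflation)
    show "star cd (lam * x + t) = Q_matrix lam cd *v star cd x + star cd t" if "x \<in> \<Lambda> j" "t \<in> T i j" for i j x t
      using mink.star_add[OF mink.nf_closed(2)[OF mink.nf_basic(2) pts_nf[OF that(1)]] T_nf[OF that(2)]]
        mink.star_mult[OF pts_nf[OF that(1)]] by simp
    show "dist (Q_matrix lam cd *v x) (Q_matrix lam cd *v y) \<le> q * dist x y" for x y
      using q(3)[of "x - y"] by (simp add: dist_norm matrix_vector_mult_diff_distrib)
    show "integral\<^sup>L lborel h = 1 / lam * (\<integral>y. h (Q_matrix lam cd *v y + t) \<partial>lborel)"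
      if "h \<in> borel_measurable borel" for h :: "real ^ 'm \<Rightarrow> real" and t
      using that by (rule mink.substitution_Q)
    show "compact (W i)" for i using windows(1) unfolding window_system_def by blast
    show "W i = (\<Union>j. \<Union>t\<in>T i j. (\<lambda>y. Q_matrix lam cd *v y + star cd t) ` W j)" for i
      using windows(1) unfolding window_system_def by blast
    show "measure lborel (W i) > 0" for i using windows(2) by blast
    show "\<Lambda> i = (\<Union>n. (inflate lam T ^^ n) (seed_pair len a b) i)" for i using iteration(2) by blast
  qed (use q left mink.Q_inj in \<open>simp_all add: seed_pair_def\<close>)
  then interpret ifs: window_ifs \<Lambda> T lam "Max (range len)" len "($) v" n "(*v) (Q_matrix lam cd)" "star cd" W q
    "seed_pair len a b" .
  show ?thesis
  proof (intro allI conjI)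
    fix i
    have lim: "((\<lambda>r :: real. real (card (\<Lambda> i \<inter> {-r..r})) / (2 * r)) \<longlongrightarrow> ifs.dns i) at_top"
      unfolding ifs.dns_def by (rule pts.density)
    \<comment> \<open>\<open>dens\<close> is defined by \<open>Lim\<close>, so its value is known
      only once convergence has been established.\<close>
    then have dens: "dens (\<Lambda> i) = ifs.dns i" unfolding dens_def by (intro tendsto_Lim) auto
    show "((\<lambda>r :: real. real (card (\<Lambda> i \<inter> {-r..r})) / (2 * r)) \<longlongrightarrow> dens (\<Lambda> i)) at_top"
      unfolding dens by (rule lim)
    define \<nu> where "\<nu> = density lborel (\<lambda>y. ennreal (dens (\<Lambda> i) / measure lborel (W i) * indicator (W i) y))"
    have nonneg: "dens (\<Lambda> i) / measure lborel (W i) \<ge> 0" unfolding dens using ifs.dns_pos[of i] by simp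
    have conv: "weakly_converges (point_measures cd (\<Lambda> i)) \<nu>"
      unfolding weakly_converges_def
    proof (intro conjI allI impI)
      show "finite_measure \<nu>" unfolding \<nu>_def by (rule density_finite_measure[OF nonneg ifs.W_compact])
      fix g :: "real ^ 'm \<Rightarrow> real" assume g: "continuous_on UNIV g \<and> bounded (range g)"
      show "(\<lambda>n. integral\<^sup>L (point_measures cd (\<Lambda> i) n) g) \<longlonglongrightarrow> integral\<^sup>L \<nu> g"
      proof -
        have cont: "continuous_on UNIV g" using g by blast
        show ?thesis
          using ifs.avg_sequence[OF cont, of i]
          unfolding \<nu>_def density_const_integral[OF nonneg[unfolded dens] ifs.W_sets cont]
            point_measures_integral[OF ifs.points_finite cont] dens ifs.vint_def .
      qed
    qed (simp add: \<nu>_def)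
    show "induces_measure cd (\<Lambda> i) \<mu> \<longleftrightarrow>
        \<mu> = density lborel (\<lambda>y. ennreal (dens (\<Lambda> i) / measure lborel (W i) * indicator (W i) y))" for \<mu>
      unfolding induces_measure_def \<nu>_def[symmetric] using conv weak_limit_unique by blast
    \<comment> \<open>Uniform distribution refers to the star images as a set, the averages to the
      points of the tiling; injectivity makes the two counts equal.\<close>
    have inj: "inj_on (star cd) {x. x \<in> \<Lambda> i \<and> \<bar>x\<bar> \<le> r}" for r
      by (rule inj_on_subset[OF mink.star_inj]) (auto intro: pts_nf)
    have vol: "1 / measure lborel (W i) \<ge> 0" using windows(2) by simp
    show "star_uniformly_distributed cd (\<Lambda> i) (W i)"
      unfolding star_uniformly_distributed_def weakly_converges_def
        uniform_measure_density[OF ifs.W_compact ifs.W_pos]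
    proof (intro conjI allI impI)
      show "finite_measure (density lborel (\<lambda>y. ennreal (1 / measure lborel (W i) * indicator (W i) y)))"
        by (rule density_finite_measure[OF vol ifs.W_compact])
      fix g :: "real ^ 'm \<Rightarrow> real" assume g: "continuous_on UNIV g \<and> bounded (range g)"
      have "integral\<^sup>L (distr (uniform_count_measure (star cd ` {x \<in> \<Lambda> i. \<bar>x\<bar> \<le> real n})) borel (\<lambda>y. y)) g =
          (\<Sum>x | x \<in> \<Lambda> i \<and> \<bar>x\<bar> \<le> real n. g (star cd x)) / real (card {x. x \<in> \<Lambda> i \<and> \<bar>x\<bar> \<le> real n})" for n
        using g by (subst uniform_count_integral)
          (simp_all add: finite_imageI[OF ifs.points_finite] sum.reindex[OF inj] card_image[OF inj])
      then show "(\<lambda>n. integral\<^sup>L (distr (uniform_count_measure (star cd ` {x \<in> \<Lambda> i. \<bar>x\<bar> \<le> real n})) borel (\<lambda>y. y)) g)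
          \<longlonglongrightarrow> integral\<^sup>L (density lborel (\<lambda>y. ennreal (1 / measure lborel (W i) * indicator (W i) y))) g"
        using ifs.normalised_avg[of g i] density_const_integral[OF vol ifs.W_sets, of g] g
        by (simp only: ifs.vint_def simp_thms)
    qed simp
  qed
qed

end
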